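(* Let $n\ge 2$, $0\le m\le n$ and let $p_{jk}$ ($1\le j,k\le n$) be real constants. Let $a=\mathrm{diag}(a_1,\dots,a_n)$, $b_d=\mathrm{diag}(b_1,\dots,b_n)$ and let $\tilde b=(\tilde b_{jk})$ be an $(n\times n)$-matrix, where $a_j,b_j,\tilde b_{jk}\in BC^1(\Pi)$ for all $j,k\le n$. Suppose that for some $\Lambda_0>0$ $$\inf_{(x,t)\in\overline\Pi}a_j\ge\Lambda_0\ \text{ for all } j\le m,\qquad \sup_{(x,t)\in\overline\Pi}a_j\le-\Lambda_0\ \text{ for all } j>m ,$$ and that there is $k\in\mathbb N$ such that $(CP)^ku\equiv0$ for all $u\in C(\overline\Pi)^n$, where the operators $C$ and $P$ (built from $a_j$, $b_j$, $p_{jk}$) are defined in the context. If $\tilde b_{jj}\equiv0$ for all $j\le n$ and for all $1\le j\ne k\le n$ there exists $\beta_{jk}\in BC^1(\Pi)$ such that $\tilde b_{jk}=\beta_{jk}(a_k-a_j)$, then the evolution family $\{\tilde U(t,\tau)\}_{t\ge\tau}$ on $L^2(0,1)^n$ generated by the perturbed problem $$\partial_t u+a(x,t)\partial_x u+(b_d(x,t)+\tilde b(x,t))u=0,\quad (x,t)\in\Pi,$$ $$u_j(0,t)=\sum_{k=1}^m p_{jk}u_k(1,t)+\sum_{k=m+1}^n p_{jk}u_k(0,t),\quad 1\le j\le m,$$ $$u_j(1,t)=\sum_{k=1}^m p_{jk}u_k(1,t)+\sum_{k=m+1}^n p_{jk}u_k(0,t),\quad m<j\le n,$$ is smoothing from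 $L^2(0,1)^n$ to $C^1([0,1])^n$.
   Context: $\Pi=\{(x,t):0<x<1,\ t\in\mathbb R\}$ and, for $\tau\in\mathbb R$, $\Pi_\tau=\{(x,t):0<x<1,\ t>\tau\}$. $BC(\Pi)$ is the space of bounded continuous functions $u:\overline\Pi\to\mathbb R$ with sup norm $\|\cdot\|_\infty$; $BC^1(\Pi)$ is the space of $u\in BC(\Pi)$ with $\partial_xu,\partial_tu\in BC(\Pi)$, with norm $\|u\|_1=\|u\|_\infty+\|\partial_xu\|_\infty+\|\partial_tu\|_\infty$. $X^n$ carries the norm $\max_{i\le n}\|u_i\|_X$. $\mathcal L(X,Y)$ is the space of bounded linear operators from $X$ to $Y$, $\mathcal L(X)=\mathcal L(X,X)$. Operators $C$ and $P$. For $j\le n$, $x\in[0,1]$, $t\in\mathbb R$, let $\xi\in[0,1]\mapsto\omega_j(\xi,x,t)$ be the solution of $\partial_\xi\omega_j(\xi,x,t)=1/a_j(\xi,\omega_j(\xi,x,t))$, $\omega_j(x,x,t)=t$. Put $c_j(\xi,x,t)=\exp\int_x^\xi\left(\frac{b_j}{a_j}\right)(\eta,\omega_j(\eta,x,t))\,d\eta$, and $x_j=0$ for $1\le j\le m$, $x_j=1$ for $m<j\le n$. For $u\in C(\overline\Pi)^n$ and $v\in C(\mathbb R)^n$ let $$(Pu)_j(t)=\sum_{k=1}^m p_{jk}u_k(1,t)+\sum_{k=m+1}^n p_{jk}u_k(0,t),\qquad (Cv)_j(x,t)=c_j(x_j,x,t)\,v_j(\omega_j(x_j,x,t)),\quad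 j\le n.$$ Evolution family. A family $\{U(t,\tau)\}_{t\ge\tau}$ of bounded linear operators on a Banach space $X$ is an evolution family if $U(\tau,\tau)=I$, $U(t,s)U(s,\tau)=U(t,\tau)$ for $t\ge s\ge\tau$, and $(t,\tau)\mapsto U(t,\tau)$ is strongly continuous on $\{t\ge\tau\}$. For every $\tau\in\mathbb R$ and $\varphi\in C_0^\infty([0,1])^n$ (smooth, compactly supported in $(0,1)$) there is a unique classical solution $u\in C^1(\overline\Pi_\tau)^n$ of the system in $\Pi_\tau$ with the boundary conditions and $u(x,\tau)=\varphi(x)$. The evolution family generated by the problem on $L^2(0,1)^n$ is the one that maps such $\varphi$ to $u(\cdot,t)$; for general $\varphi\in L^2(0,1)^n$ its value is the $L^2$-limit, uniform in $t$ on compact subintervals of $[\tau,\infty)$, of classical solutions with initial data $\varphi^l\in C_0^\infty([0,1])^n$, $\varphi^l\to\varphi$ in $L^2(0,1)^n$. Smoothing. Let $Y\hookrightarrow Z$ be continuously embedded Banach spaces and $V(t,\tau)\in\mathcal L(Z)$ for all $t\ge\tau$. The family $\{V(t,\tau)\}_{t\ge\tau}$ is smoothing from $Z$ to $Y$ if there is $T>0$ such that $V(t,\tau)\in\mathcal L(Z,Y)$ for all $t\ge\tau+T$ ($T$ independent of $\tau$ and $t$). *)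

theory Defs
  imports "HOL-Analysis.Analysis"
begin

(* Conventions.  Vector components are indexed by {1..n}; values of a vector at other indices
   are irrelevant.  A function on the closed strip is a total function of (x, t), of which only
   the values with 0 <= x <= 1 matter. *)

definition strip :: "(real \<times> real) set" where
  "strip = {0..1} \<times> UNIV"

definition BC :: "(real \<times> real \<Rightarrow> real) set" where
  "BC = {f. continuous_on strip f \<and> bounded (f ` strip)}"

(* f has the continuous partial derivatives fx and ft on the closed set [0,1] x I; at boundary
   points the derivatives are one-sided. *)
definition has_cont_partials ::
  "real set \<Rightarrow> (real \<times> real \<Rightarrow> real) \<Rightarrow> (real \<times> real \<Rightarrow> real) \<Rightarrow> (real \<times> real \<Rightarrow> real) \<Rightarrow> bool"
where
  "has_cont_partials I f fx ft \<longleftrightarrow>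
     continuous_on ({0..1} \<times> I) f \<and>
     continuous_on ({0..1} \<times> I) fx \<and>
     continuous_on ({0..1} \<times> I) ft \<and>
     (\<forall>x\<in>{0..1}. \<forall>t\<in>I.
        ((\<lambda>y. f (y, t)) has_real_derivative fx (x, t)) (at x within {0..1}) \<and>
        ((\<lambda>s. f (x, s)) has_real_derivative ft (x, t)) (at t within I))"

definition BC1 :: "(real \<times> real \<Rightarrow> real) set" where
  "BC1 = {f. f \<in> BC \<and> (\<exists>fx\<in>BC. \<exists>ft\<in>BC. has_cont_partials UNIV f fx ft)}"


section \<open>The operators C and P\<close>

(* charac \<alpha> \<xi> x t is the value at \<xi> of the solution w on [0,1] of w' = 1 / \<alpha>(., w), w x = t. *)
definition charac :: "(real \<times> real \<Rightarrow> real) \<Rightarrow> real \<Rightarrow> real \<Rightarrow> real \<Rightarrow> real" where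
  "charac \<alpha> \<xi> x t =
     (THE s. \<exists>w. (\<forall>\<eta>\<in>{0..1}. (w has_real_derivative 1 / \<alpha> (\<eta>, w \<eta>)) (at \<eta> within {0..1})) \<and>
                 w x = t \<and> w \<xi> = s)"

definition char_weight ::
  "(real \<times> real \<Rightarrow> real) \<Rightarrow> (real \<times> real \<Rightarrow> real) \<Rightarrow> real \<Rightarrow> real \<Rightarrow> real \<Rightarrow> real"
where
  "char_weight \<alpha> \<beta> \<xi> x t =
     exp (LBINT \<eta>=ereal x..ereal \<xi>. \<beta> (\<eta>, charac \<alpha> \<eta> x t) / \<alpha> (\<eta>, charac \<alpha> \<eta> x t))"

definition inflow_end :: "nat \<Rightarrow> nat \<Rightarrow> real" where
  "inflow_end m j = (if j \<le> m then 0 else 1)"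

definition C_op ::
  "nat \<Rightarrow> (nat \<Rightarrow> real \<times> real \<Rightarrow> real) \<Rightarrow> (nat \<Rightarrow> real \<times> real \<Rightarrow> real) \<Rightarrow>
   (nat \<Rightarrow> real \<Rightarrow> real) \<Rightarrow> nat \<Rightarrow> real \<times> real \<Rightarrow> real"
where
  "C_op m a b v = (\<lambda>j (x, t).
     char_weight (a j) (b j) (inflow_end m j) x t * v j (charac (a j) (inflow_end m j) x t))"

definition P_op ::
  "nat \<Rightarrow> nat \<Rightarrow> (nat \<Rightarrow> nat \<Rightarrow> real) \<Rightarrow> (nat \<Rightarrow> real \<times> real \<Rightarrow> real) \<Rightarrow> nat \<Rightarrow> real \<Rightarrow> real"
where
  "P_op n m p u = (\<lambda>j t. (\<Sum>k\<in>{1..m}. p j k * u k (1, t)) + (\<Sum>k\<in>{m+1..n}. p j k * u k (0, t)))"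


section \<open>Function spaces on the unit interval\<close>

type_synonym vecfun = "nat \<Rightarrow> real \<Rightarrow> real"

definition vec_diff :: "vecfun \<Rightarrow> vecfun \<Rightarrow> vecfun" where
  "vec_diff \<phi> \<psi> = (\<lambda>j x. \<phi> j x - \<psi> j x)"

definition lin_comb :: "real \<Rightarrow> vecfun \<Rightarrow> real \<Rightarrow> vecfun \<Rightarrow> vecfun" where
  "lin_comb c \<phi> d \<psi> = (\<lambda>j x. c * \<phi> j x + d * \<psi> j x)"

(* Equality almost everywhere on (0,1).  Elements of L2(0,1)^n are handled through
   representatives, so equality of vector functions always means this relation. *)
definition ae_eq :: "nat \<Rightarrow> vecfun \<Rightarrow> vecfun \<Rightarrow> bool" where
  "ae_eq n \<phi> \<psi> \<longleftrightarrow> (\<forall>j\<in>{1..n}. AE x in lebesgue_on {0<..<1}. \<phi> j x = \<psi> j x)"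

definition L2 :: "nat \<Rightarrow> vecfun set" where
  "L2 n = {\<phi>. \<forall>j\<in>{1..n}. \<phi> j \<in> borel_measurable (lebesgue_on {0<..<1}) \<and>
                          integrable (lebesgue_on {0<..<1}) (\<lambda>x. (\<phi> j x)\<^sup>2)}"

definition L2_norm :: "nat \<Rightarrow> vecfun \<Rightarrow> real" where
  "L2_norm n \<phi> = (MAX j\<in>{1..n}. sqrt (LINT x|lebesgue_on {0<..<1}. (\<phi> j x)\<^sup>2))"

definition C1 :: "nat \<Rightarrow> vecfun set" where
  "C1 n = {\<psi>. \<forall>j\<in>{1..n}. \<exists>d. continuous_on {0..1} d \<and>
                 (\<forall>x\<in>{0..1}. (\<psi> j has_real_derivative d x) (at x within {0..1}))}"

definition C1_norm :: "nat \<Rightarrow> vecfun \<Rightarrow> real" where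
  "C1_norm n \<psi> = (MAX j\<in>{1..n}.
     (SUP x\<in>{0..1}. \<bar>\<psi> j x\<bar>) + (SUP x\<in>{0..1}. \<bar>vector_derivative (\<psi> j) (at x within {0..1})\<bar>))"

(* Smooth functions with compact support in (0,1), extended by zero to the real line. *)
definition test_fun :: "nat \<Rightarrow> vecfun set" where
  "test_fun n = {\<phi>. \<forall>j\<in>{1..n}.
     (\<forall>r. (deriv ^^ r) (\<phi> j) differentiable_on UNIV) \<and>
     (\<exists>K. compact K \<and> K \<subseteq> {0<..<1} \<and> (\<forall>x. x \<notin> K \<longrightarrow> \<phi> j x = 0))}"


section \<open>Bounded operators, evolution families, smoothing\<close>

(* A is a bounded linear operator from (Z, NZ) to (Y, NY), up to equality almost everywhere:
   the class of A \<phi> has a representative in Y.  The estimate and linearity make A compatible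
   with equality almost everywhere on Z = L2. *)
definition bounded_operator ::
  "nat \<Rightarrow> vecfun set \<Rightarrow> (vecfun \<Rightarrow> real) \<Rightarrow> vecfun set \<Rightarrow> (vecfun \<Rightarrow> real) \<Rightarrow> (vecfun \<Rightarrow> vecfun) \<Rightarrow> bool"
where
  "bounded_operator n Z NZ Y NY A \<longleftrightarrow>
     (\<forall>\<phi>\<in>Z. \<forall>\<psi>\<in>Z. \<forall>c d. ae_eq n (A (lin_comb c \<phi> d \<psi>)) (lin_comb c (A \<phi>) d (A \<psi>))) \<and>
     (\<exists>K. \<forall>\<phi>\<in>Z. \<exists>\<psi>\<in>Y. ae_eq n (A \<phi>) \<psi> \<and> NY \<psi> \<le> K * NZ \<phi>)"

definition evolution_family :: "nat \<Rightarrow> (real \<Rightarrow> real \<Rightarrow> vecfun \<Rightarrow> vecfun) \<Rightarrow> bool" where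
  "evolution_family n U \<longleftrightarrow>
     (\<forall>t \<tau>. \<tau> \<le> t \<longrightarrow> bounded_operator n (L2 n) (L2_norm n) (L2 n) (L2_norm n) (U t \<tau>)) \<and>
     (\<forall>\<tau>. \<forall>\<phi>\<in>L2 n. ae_eq n (U \<tau> \<tau> \<phi>) \<phi>) \<and>
     (\<forall>t s \<tau>. \<tau> \<le> s \<and> s \<le> t \<longrightarrow> (\<forall>\<phi>\<in>L2 n. ae_eq n (U t s (U s \<tau> \<phi>)) (U t \<tau> \<phi>))) \<and>
     (\<forall>\<phi>\<in>L2 n. \<forall>t0 \<tau>0. \<tau>0 \<le> t0 \<longrightarrow>
        ((\<lambda>(t, \<tau>). L2_norm n (vec_diff (U t \<tau> \<phi>) (U t0 \<tau>0 \<phi>))) \<longlongrightarrow> 0)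
          (at (t0, \<tau>0) within {(t, \<tau>). \<tau> \<le> t}))"

definition smoothing ::
  "nat \<Rightarrow> vecfun set \<Rightarrow> (vecfun \<Rightarrow> real) \<Rightarrow> vecfun set \<Rightarrow> (vecfun \<Rightarrow> real) \<Rightarrow>
   (real \<Rightarrow> real \<Rightarrow> vecfun \<Rightarrow> vecfun) \<Rightarrow> bool"
where
  "smoothing n Z NZ Y NY V \<longleftrightarrow>
     (\<forall>t \<tau>. \<tau> \<le> t \<longrightarrow> bounded_operator n Z NZ Z NZ (V t \<tau>)) \<and>
     (\<exists>T>0. \<forall>t \<tau>. \<tau> + T \<le> t \<longrightarrow> bounded_operator n Z NZ Y NY (V t \<tau>))"


section \<open>The initial boundary value problem\<close>

(* Here B is the full zero-order coefficient matrix of the system. *)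
definition classical_solution ::
  "nat \<Rightarrow> nat \<Rightarrow> (nat \<Rightarrow> real \<times> real \<Rightarrow> real) \<Rightarrow> (nat \<Rightarrow> nat \<Rightarrow> real \<times> real \<Rightarrow> real) \<Rightarrow>
   (nat \<Rightarrow> nat \<Rightarrow> real) \<Rightarrow> real \<Rightarrow> vecfun \<Rightarrow> (nat \<Rightarrow> real \<times> real \<Rightarrow> real) \<Rightarrow> bool"
where
  "classical_solution n m a B p \<tau> \<phi> u \<longleftrightarrow>
     (\<exists>ux ut. (\<forall>j\<in>{1..n}. has_cont_partials {\<tau>..} (u j) (ux j) (ut j)) \<and>
        (\<forall>j\<in>{1..n}. \<forall>x\<in>{0<..<1}. \<forall>t>\<tau>.
           ut j (x, t) + a j (x, t) * ux j (x, t) + (\<Sum>k\<in>{1..n}. B j k (x, t) * u k (x, t)) = 0)) \<and>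
     (\<forall>j\<in>{1..m}. \<forall>t>\<tau>. u j (0, t) = P_op n m p u j t) \<and>
     (\<forall>j\<in>{m+1..n}. \<forall>t>\<tau>. u j (1, t) = P_op n m p u j t) \<and>
     (\<forall>j\<in>{1..n}. \<forall>x\<in>{0..1}. u j (x, \<tau>) = \<phi> j x)"

definition time_slice :: "(nat \<Rightarrow> real \<times> real \<Rightarrow> real) \<Rightarrow> real \<Rightarrow> vecfun" where
  "time_slice u t = (\<lambda>j x. u j (x, t))"

definition generated_by ::
  "nat \<Rightarrow> nat \<Rightarrow> (nat \<Rightarrow> real \<times> real \<Rightarrow> real) \<Rightarrow> (nat \<Rightarrow> nat \<Rightarrow> real \<times> real \<Rightarrow> real) \<Rightarrow>
   (nat \<Rightarrow> nat \<Rightarrow> real) \<Rightarrow> (real \<Rightarrow> real \<Rightarrow> vecfun \<Rightarrow> vecfun) \<Rightarrow> bool"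
where
  "generated_by n m a B p U \<longleftrightarrow>
     (\<forall>\<tau>. \<forall>\<phi>\<in>test_fun n. \<exists>u. classical_solution n m a B p \<tau> \<phi> u \<and>
        (\<forall>t\<ge>\<tau>. ae_eq n (U t \<tau> \<phi>) (time_slice u t))) \<and>
     (\<forall>\<tau>. \<forall>\<phi>\<in>L2 n. \<forall>\<phi>s us.
        (\<forall>l. \<phi>s l \<in> test_fun n \<and> classical_solution n m a B p \<tau> (\<phi>s l) (us l)) \<and>
        (\<lambda>l. L2_norm n (vec_diff (\<phi>s l) \<phi>)) \<longlonglongrightarrow> 0 \<longrightarrow>
        (\<forall>S\<ge>\<tau>. uniform_limit {\<tau>..S}
           (\<lambda>l t. L2_norm n (vec_diff (time_slice (us l) t) (U t \<tau> \<phi>))) (\<lambda>_. 0) sequentially))"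

end

theory Submission
  imports Defs
begin

text \<open>
  Divide the \<open>j\<close>-th equation by \<open>a j\<close>, so that with \<open>f j = 1 / a j\<close> the coupling coefficients become
  \<open>\<kappa> j k * (f j - f k)\<close>. Along a characteristic of the \<open>j\<close>-th equation,
  \<open>(f j - f k) * \<partial>\<^sub>t u k\<close> is the derivative of \<open>u k\<close> up to terms without derivatives, and likewise
  \<open>(f j - f k) * u k\<close> is the derivative of \<open>\<integral> u k dt\<close> up to integrals of \<open>u\<close>. Integrating by parts along the
  characteristic therefore gains one derivative: the part of \<open>u j\<close> created by the coupling is bounded in the
  sup norm by the \<open>L\<^sup>2\<close> norm of \<open>u\<close>, and its time derivative by the sup norm of \<open>u\<close>. The remaining part is
  \<open>C P u\<close>; since \<open>(C P)\<^sup>N = 0\<close>, \<open>N\<close> reflections remove it, and \<open>u\<close> is expressed by the coupling part alone.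
  Applying this twice bounds a classical solution in \<open>C\<^sup>1\<close>, after a fixed time, by the \<open>L\<^sup>2\<close> norm of the initial
  data; density of the test functions gives the rest. In all estimates \<open>x\<close> plays the role of the evolution
  variable, so that the signs of the \<open>a j\<close> enter only through the boundary conditions.
\<close>

text \<open>Three points shape the argument. Each equation is integrated in x, in both directions,
  so the estimate at time t uses the solution on a window around t, including later times. The
  window is finite because a characteristic crosses the strip within time \<open>Q\<close>, a common
  bound for all \<open>f j\<close>, and every reflection costs at most another \<open>Q\<close>.
  Hence the waiting time depends only on \<open>N\<close> and \<open>Q\<close>, while the operator
  bound may depend on \<tau> and t. The nilpotency of C P concerns functions on the whole strip,
  whereas a solution exists only from \<tau> on. Its outflow traces are therefore continued
  constantly below \<tau>; with \<open>G\<close> the trace form of C P, the telescoped identity z =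
  (1 - G^N) z needs (1 - G) z only at times after \<tau>. Finally, a classical solution has no
  second derivatives. An equation for u_t is available only along characteristics, and the C^1
  iteration differentiates the telescoped trace identity instead of assuming that the differentiated
  reflection operator is nilpotent.\<close>

section \<open>Calculus on the unit interval with one-sided derivatives\<close>

definition deriv01 :: "(real \<Rightarrow> real) \<Rightarrow> (real \<Rightarrow> real) \<Rightarrow> bool" where
  "deriv01 F G \<longleftrightarrow> (\<forall>\<xi>\<in>{0..1}. (F has_real_derivative G \<xi>) (at \<xi> within {0..1}))"

lemma deriv01D: "deriv01 F G \<Longrightarrow> \<xi> \<in> {0..1} \<Longrightarrow> (F has_real_derivative G \<xi>) (at \<xi> within {0..1})"
  by (simp add: deriv01_def)

lemma deriv01_continuous: "deriv01 F G \<Longrightarrow> continuous_on {0..1} F"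
  unfolding deriv01_def by (meson DERIV_continuous continuous_on_eq_continuous_within)

lemma deriv_nonneg_imp_le:
  fixes P :: "real \<Rightarrow> real"
  assumes "u \<le> v" and d: "\<And>\<eta>. \<eta> \<in> {u..v} \<Longrightarrow> (P has_real_derivative P' \<eta>) (at \<eta> within {u..v})"
    and "\<And>\<eta>. \<eta> \<in> {u..v} \<Longrightarrow> P' \<eta> \<ge> 0"
  shows "P u \<le> P v"
proof -
  have "\<exists>x\<in>{u..v}. P v - P u = (*) (P' x) (v - u)"
    using d by (intro mvt_very_simple[OF \<open>u \<le> v\<close>]) (simp add: has_field_derivative_def)
  then show ?thesis using assms(1,3) by (metis diff_ge_0_iff_ge mult_nonneg_nonneg)
qed

lemma deriv01_mono:
  assumes F: "deriv01 F F'" and G: "deriv01 G G'" and uv: "0 \<le> u" "u \<le> v" "v \<le> 1"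
    and le: "\<And>\<eta>. \<eta> \<in> {u..v} \<Longrightarrow> F' \<eta> \<le> G' \<eta>"
  shows "F v - F u \<le> G v - G u"
proof -
  have "G u - F u \<le> G v - F v"
  proof (rule deriv_nonneg_imp_le[OF \<open>u \<le> v\<close>, where P' = "\<lambda>\<eta>. G' \<eta> - F' \<eta>"])
    fix \<eta> assume \<eta>: "\<eta> \<in> {u..v}"
    have sub: "{u..v} \<subseteq> {0..1}" using uv by auto
    have "(F has_real_derivative F' \<eta>) (at \<eta> within {u..v})"
         "(G has_real_derivative G' \<eta>) (at \<eta> within {u..v})"
      using F G \<eta> sub by (auto intro!: DERIV_subset[OF _ sub] deriv01D)
    then show "((\<lambda>\<eta>. G \<eta> - F \<eta>) has_real_derivative G' \<eta> - F' \<eta>) (at \<eta> within {u..v})"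
      by (auto intro!: derivative_eq_intros)
    show "G' \<eta> - F' \<eta> \<ge> 0" using le \<eta> by simp
  qed
  then show ?thesis by simp
qed

lemma deriv01_uminus: "deriv01 F G \<Longrightarrow> deriv01 (\<lambda>x. - F x) (\<lambda>x. - G x)"
  by (auto simp: deriv01_def intro!: derivative_eq_intros)

lemma deriv01_unique:
  assumes F: "deriv01 F G" and F': "deriv01 F' G" and "x \<in> {0..1}" "\<xi> \<in> {0..1}"
  shows "F \<xi> - F x = F' \<xi> - F' x"
proof (cases "x \<le> \<xi>")
  case True
  then show ?thesis using deriv01_mono[OF F F', of x \<xi>] deriv01_mono[OF F' F, of x \<xi>] assms by auto
next
  case False
  then show ?thesis using deriv01_mono[OF F F', of \<xi> x] deriv01_mono[OF F' F, of \<xi> x] assms by auto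
qed

lemma deriv01_integral:
  assumes "continuous_on {0..1} g"
  shows "deriv01 (\<lambda>\<xi>. integral {0..\<xi>} g - c) g"
  using integral_has_real_derivative[OF assms]
  by (auto simp: deriv01_def intro!: derivative_eq_intros)

lemma deriv01_bound:
  assumes F: "deriv01 F G" and b: "\<And>\<eta>. \<eta> \<in> {0..1} \<Longrightarrow> \<bar>G \<eta>\<bar> \<le> C" and x: "x \<in> {0..1}" "\<xi> \<in> {0..1}"
  shows "\<bar>F \<xi> - F x\<bar> \<le> C * \<bar>\<xi> - x\<bar>"
proof -
  have *: "\<bar>F v - F u\<bar> \<le> C * (v - u)" if "0 \<le> u" "u \<le> v" "v \<le> 1" for u v
  proof -
    have l: "deriv01 (\<lambda>x. C * x) (\<lambda>x. C)" "deriv01 (\<lambda>x. - C * x) (\<lambda>x. - C)"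
      by (auto simp: deriv01_def intro!: derivative_eq_intros)
    have b': "G \<eta> \<le> C" "- C \<le> G \<eta>" if "\<eta> \<in> {u..v}" for \<eta>
      using b[of \<eta>] that \<open>0 \<le> u\<close> \<open>v \<le> 1\<close> by auto
    show ?thesis
      using deriv01_mono[OF F l(1) that b'(1)] deriv01_mono[OF l(2) F that b'(2)]
      by (simp add: algebra_simps abs_le_iff)
  qed
  show ?thesis
    using *[of x \<xi>] *[of \<xi> x] x by (cases "x \<le> \<xi>") (auto simp: abs_minus_commute)
qed

text \<open>Later majorants contain solution values at a fixed time, which are controlled in L2 but
  not pointwise in x, so the bound on the derivative must be integrated. Monotonicity of the
  primitive of the nonnegative \<open>h\<close> extends the bound to all of [0, 1].\<close>

lemma deriv01_bound_integral:
  assumes F: "deriv01 F G" and b: "\<And>\<eta>. \<eta> \<in> {0..1} \<Longrightarrow> \<bar>G \<eta>\<bar> \<le> h \<eta>"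
    and h: "continuous_on {0..1} h" and x: "x \<in> {0..1}" "\<xi> \<in> {0..1}"
  shows "\<bar>F \<xi> - F x\<bar> \<le> integral {0..1} h"
proof -
  let ?H = "\<lambda>\<xi>. integral {0..\<xi>} h - 0"
  have H: "deriv01 ?H h" by (rule deriv01_integral[OF h])
  have h0: "h \<eta> \<ge> 0" if "\<eta> \<in> {0..1}" for \<eta> using b[OF that] by linarith
  have z: "deriv01 (\<lambda>_. 0) (\<lambda>_. 0)" by (auto simp: deriv01_def)
  have Hmono: "?H u \<le> ?H v" if "0 \<le> u" "u \<le> v" "v \<le> 1" for u v
    using deriv01_mono[OF z H that] h0 that by simp
  have *: "\<bar>F v - F u\<bar> \<le> ?H 1" if "0 \<le> u" "u \<le> v" "v \<le> 1" for u v
  proof -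
    have b': "G \<eta> \<le> h \<eta>" "- G \<eta> \<le> h \<eta>" if "\<eta> \<in> {u..v}" for \<eta>
      using b[of \<eta>] that \<open>0 \<le> u\<close> \<open>v \<le> 1\<close> by auto
    show ?thesis
      using deriv01_mono[OF F H that b'(1)] deriv01_mono[OF deriv01_uminus[OF F] H that b'(2)]
        Hmono[of 0 u] Hmono[of v 1] that
      by (simp add: abs_le_iff)
  qed
  show ?thesis
    using *[of x \<xi>] *[of \<xi> x] x by (cases "x \<le> \<xi>") (auto simp: abs_minus_commute)
qed

text \<open>On each side of \<open>x\<close> the majorant is, up to sign, the derivative of the
  right-hand side; this is what makes the exponentially weighted Picard map contract below.\<close>

lemma exp_growth_bound:
  assumes F: "deriv01 F G" and "F x = 0" and x: "x \<in> {0..1}" "\<xi> \<in> {0..1}"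
    and b: "\<And>\<eta>. \<eta> \<in> {0..1} \<Longrightarrow> \<bar>G \<eta>\<bar> \<le> C * K * exp (K * \<bar>\<eta> - x\<bar>)" and "0 \<le> C"
  shows "\<bar>F \<xi>\<bar> \<le> C * exp (K * \<bar>\<xi> - x\<bar>)"
proof (cases "x \<le> \<xi>")
  case True
  have e: "deriv01 (\<lambda>\<eta>. C * exp (K * (\<eta> - x))) (\<lambda>\<eta>. C * K * exp (K * (\<eta> - x)))"
    by (auto simp: deriv01_def algebra_simps intro!: derivative_eq_intros)
  have b': "G \<eta> \<le> C * K * exp (K * (\<eta> - x))" "- G \<eta> \<le> C * K * exp (K * (\<eta> - x))"
    if "\<eta> \<in> {x..\<xi>}" for \<eta> using b[of \<eta>] that x by auto
  show ?thesis
    using deriv01_mono[OF F e _ True _ b'(1)] deriv01_mono[OF deriv01_uminus[OF F] e _ True _ b'(2)] x True \<open>0 \<le> C\<close> \<open>F x = 0\<close>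
    by (simp add: abs_le_iff)
next
  case False
  then have le: "\<xi> \<le> x" by simp
  have e: "deriv01 (\<lambda>\<eta>. - C * exp (K * (x - \<eta>))) (\<lambda>\<eta>. C * K * exp (K * (x - \<eta>)))"
    by (auto simp: deriv01_def algebra_simps intro!: derivative_eq_intros)
  have b': "G \<eta> \<le> C * K * exp (K * (x - \<eta>))" "- G \<eta> \<le> C * K * exp (K * (x - \<eta>))"
    if "\<eta> \<in> {\<xi>..x}" for \<eta> using b[of \<eta>] that x by auto
  show ?thesis
    using deriv01_mono[OF F e _ le _ b'(1)] deriv01_mono[OF deriv01_uminus[OF F] e _ le _ b'(2)] x le \<open>0 \<le> C\<close> \<open>F x = 0\<close>
    by (simp add: abs_le_iff)
qed

text \<open>The square of \<open>F\<close> replaces the absolute value, which need not be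
  differentiable. Multiplied by an exponential of rate 2 L it becomes monotone to the right of
  \<open>x\<close>, and with the opposite rate to the left. The interval has length one, hence the
  factor \<open>exp L\<close>.\<close>

lemma gronwall01:
  assumes F: "deriv01 F G" and x: "x \<in> {0..1}" "\<xi> \<in> {0..1}" and L: "0 \<le> L"
    and b: "\<And>\<eta>. \<eta> \<in> {0..1} \<Longrightarrow> \<bar>G \<eta>\<bar> \<le> L * \<bar>F \<eta>\<bar>"
  shows "\<bar>F \<xi>\<bar> \<le> exp L * \<bar>F x\<bar>"
proof -
  have FG: "- (L * (F \<eta>)\<^sup>2) \<le> F \<eta> * G \<eta>" "F \<eta> * G \<eta> \<le> L * (F \<eta>)\<^sup>2" if "\<eta> \<in> {0..1}" for \<eta>
  proof -
    have "\<bar>F \<eta> * G \<eta>\<bar> \<le> \<bar>F \<eta>\<bar> * (L * \<bar>F \<eta>\<bar>)" unfolding abs_mult using b[OF that] by (intro mult_left_mono) auto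
    also have "\<dots> = L * (F \<eta>)\<^sup>2" by (simp add: power2_eq_square)
    finally show "- (L * (F \<eta>)\<^sup>2) \<le> F \<eta> * G \<eta>" "F \<eta> * G \<eta> \<le> L * (F \<eta>)\<^sup>2" by linarith+
  qed
  have z: "deriv01 (\<lambda>_. 0) (\<lambda>_. 0)" by (auto simp: deriv01_def)
  have "(F \<xi>)\<^sup>2 \<le> exp (2 * L * \<bar>\<xi> - x\<bar>) * (F x)\<^sup>2"
  proof (cases "x \<le> \<xi>")
    case True
    have e: "deriv01 (\<lambda>\<eta>. (F \<eta>)\<^sup>2 * exp (- 2 * L * \<eta>))
      (\<lambda>\<eta>. 2 * (F \<eta> * G \<eta> - L * (F \<eta>)\<^sup>2) * exp (- 2 * L * \<eta>))"
      using F by (auto simp: deriv01_def algebra_simps power2_eq_square intro!: derivative_eq_intros)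
    have "(F \<xi>)\<^sup>2 * exp (- 2 * L * \<xi>) \<le> (F x)\<^sup>2 * exp (- 2 * L * x)"
      using deriv01_mono[OF e z _ True] FG(2) x
      by (auto simp: mult_le_0_iff)
    then have "(F \<xi>)\<^sup>2 * exp (- 2 * L * \<xi>) * exp (2 * L * \<xi>) \<le> (F x)\<^sup>2 * exp (- 2 * L * x) * exp (2 * L * \<xi>)"
      by (intro mult_right_mono) auto
    then show ?thesis using True by (simp add: mult.assoc flip: exp_add) (simp add: algebra_simps)
  next
    case False
    then have le: "\<xi> \<le> x" by simp
    have e: "deriv01 (\<lambda>\<eta>. (F \<eta>)\<^sup>2 * exp (2 * L * \<eta>))
      (\<lambda>\<eta>. 2 * (F \<eta> * G \<eta> + L * (F \<eta>)\<^sup>2) * exp (2 * L * \<eta>))"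
      using F by (auto simp: deriv01_def algebra_simps power2_eq_square intro!: derivative_eq_intros)
    have nn: "0 \<le> 2 * (F \<eta> * G \<eta> + L * (F \<eta>)\<^sup>2) * exp (2 * L * \<eta>)" if "\<eta> \<in> {0..1}" for \<eta>
      using FG(1)[OF that] by simp
    have "(F \<xi>)\<^sup>2 * exp (2 * L * \<xi>) \<le> (F x)\<^sup>2 * exp (2 * L * x)"
      using deriv01_mono[OF z e _ le] nn x by auto
    then have "(F \<xi>)\<^sup>2 * exp (2 * L * \<xi>) * exp (- 2 * L * \<xi>) \<le> (F x)\<^sup>2 * exp (2 * L * x) * exp (- 2 * L * \<xi>)"
      by (intro mult_right_mono) auto
    then show ?thesis using le by (simp add: mult.assoc flip: exp_add) (simp add: algebra_simps)
  qed
  also have "\<dots> \<le> exp (2 * L) * (F x)\<^sup>2"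
    using x L by (intro mult_right_mono) (auto simp: abs_le_iff intro!: mult_left_le)
  also have "\<dots> = (exp L * \<bar>F x\<bar>)\<^sup>2" by (simp add: power_mult_distrib exp_double)
  finally show ?thesis by (simp add: abs_le_square_iff[symmetric] abs_mult)
qed

section \<open>Characteristics\<close>

lemma continuous_on_strip_curve:
  assumes "continuous_on strip g" "continuous_on {0..1} w"
  shows "continuous_on {0..1} (\<lambda>\<eta>. g (\<eta>, w \<eta>))"
  by (rule continuous_on_compose2[OF assms(1)])
    (auto simp: strip_def intro!: continuous_intros assms(2))

text \<open>Banach's theorem for the unknown rescaled by \<open>exp (- 2 L \<bar>\<xi> - x\<bar>)\<close>, which makes the Picard map a
  contraction on the whole interval at once.\<close>

lemma ode_exists:
  fixes f :: "real \<times> real \<Rightarrow> real"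
  assumes f: "continuous_on strip f" and L: "0 < L"
    and lip: "\<And>\<eta> s r. \<eta> \<in> {0..1} \<Longrightarrow> \<bar>f (\<eta>, s) - f (\<eta>, r)\<bar> \<le> L * \<bar>s - r\<bar>"
    and x: "x \<in> {0..1}"
  shows "\<exists>w. deriv01 w (\<lambda>\<eta>. f (\<eta>, w \<eta>)) \<and> w x = t"
proof -
  \<comment> \<open>Retraction of the line onto [0, 1]: it lets the Picard map act on the complete
    space of bounded continuous functions on the whole line.\<close>
  define c where "c = (\<lambda>\<xi>::real. max 0 (min 1 \<xi>))"
  have c01: "c \<xi> \<in> {0..1}" for \<xi> by (auto simp: c_def)
  have cid: "\<xi> \<in> {0..1} \<Longrightarrow> c \<xi> = \<xi>" for \<xi> by (auto simp: c_def)
  have cc: "continuous_on UNIV c" unfolding c_def by (intro continuous_intros)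
  define E where "E = (\<lambda>\<xi>. exp (2 * L * \<bar>\<xi> - x\<bar>))"
  define g where "g = (\<lambda>y \<eta>. f (\<eta>, E \<eta> * y \<eta>))"
  define A where "A = (\<lambda>y \<xi>. integral {0..\<xi>} (g y) - integral {0..x} (g y))"
  define T where "T = (\<lambda>y \<xi>. (t + A y (c \<xi>)) / E (c \<xi>))"
  have E0: "E \<xi> > 0" for \<xi> by (simp add: E_def)
  have contE: "continuous_on S E" for S unfolding E_def by (intro continuous_intros)
  have contg: "continuous_on {0..1} (g y)" if "continuous_on UNIV y" for y
    unfolding g_def
    by (intro continuous_on_strip_curve[OF f] continuous_intros contE continuous_on_subset[OF that]) auto
  have dA: "deriv01 (A y) (g y)" if "continuous_on UNIV y" for y
    unfolding A_def by (rule deriv01_integral[OF contg[OF that]])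
  have contA: "continuous_on {0..1} (\<lambda>\<xi>. (t + A y \<xi>) / E \<xi>)" if "continuous_on UNIV y" for y
    using deriv01_continuous[OF dA[OF that]] E0 by (intro continuous_intros contE) (auto simp: less_imp_neq[symmetric])
  have TB: "T y \<in> bcontfun" if "continuous_on UNIV y" for y
  proof -
    have "bounded ((\<lambda>\<xi>. (t + A y \<xi>) / E \<xi>) ` {0..1})"
      by (intro compact_imp_bounded compact_continuous_image contA that) auto
    then have "bounded (range (T y))"
      by (rule bounded_subset) (use c01 in \<open>auto simp: T_def\<close>)
    moreover have "continuous_on UNIV (T y)"
      unfolding T_def
      by (rule continuous_on_compose2[OF contA[OF that] cc]) (use c01 in auto)
    ultimately show ?thesis by (simp add: bcontfun_def)
  qed
  define \<Phi> where "\<Phi> = (\<lambda>y::real \<Rightarrow>\<^sub>C real. Bcontfun (T (apply_bcontfun y)))"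
  have \<Phi>: "apply_bcontfun (\<Phi> y) = T (apply_bcontfun y)" for y
    unfolding \<Phi>_def by (rule Bcontfun_inverse) (auto intro: TB)
  \<comment> \<open>The weight has rate 2 L and the Lipschitz constant is L, so integrating the
    difference gains the factor 1/2.\<close>
  have contr: "dist (\<Phi> y) (\<Phi> z) \<le> 1/2 * dist y z" for y z
  proof (rule dist_bound)
    fix \<xi>
    define \<zeta> where "\<zeta> = c \<xi>"
    have \<zeta>: "\<zeta> \<in> {0..1}" using c01 by (simp add: \<zeta>_def)
    have d: "deriv01 (\<lambda>\<eta>. A y \<eta> - A z \<eta>) (\<lambda>\<eta>. g y \<eta> - g z \<eta>)"
      using dA[of "apply_bcontfun y"] dA[of "apply_bcontfun z"]
      by (auto simp: deriv01_def intro!: derivative_eq_intros)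
    have "\<bar>A y \<zeta> - A z \<zeta>\<bar> \<le> (dist y z / 2) * exp ((2 * L) * \<bar>\<zeta> - x\<bar>)"
    proof (rule exp_growth_bound[OF d _ x \<zeta>])
      fix \<eta> :: real assume \<eta>: "\<eta> \<in> {0..1}"
      have "\<bar>g y \<eta> - g z \<eta>\<bar> \<le> L * \<bar>E \<eta> * y \<eta> - E \<eta> * z \<eta>\<bar>"
        unfolding g_def by (rule lip[OF \<eta>])
      also have "\<dots> = L * (E \<eta> * \<bar>y \<eta> - z \<eta>\<bar>)"
        using E0[of \<eta>] by (simp flip: right_diff_distrib add: abs_mult)
      also have "\<dots> \<le> L * (E \<eta> * dist y z)"
        using E0[of \<eta>] L dist_bounded[of y \<eta> z] by (intro mult_left_mono) (auto simp: dist_real_def)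
      finally show "\<bar>g y \<eta> - g z \<eta>\<bar> \<le> dist y z / 2 * (2 * L) * exp (2 * L * \<bar>\<eta> - x\<bar>)"
        by (simp add: E_def ac_simps)
    qed (auto simp: A_def)
    then have "\<bar>A y \<zeta> - A z \<zeta>\<bar> / E \<zeta> \<le> dist y z / 2"
      using E0[of \<zeta>] by (simp add: E_def divide_le_eq)
    then show "dist (\<Phi> y \<xi>) (\<Phi> z \<xi>) \<le> 1/2 * dist y z"
      using E0[of \<zeta>] by (simp add: \<Phi> T_def \<zeta>_def[symmetric] dist_real_def flip: diff_divide_distrib)
  qed
  obtain y where y: "\<Phi> y = y"
    using banach_fix_type[of "1/2" \<Phi>] contr by auto
  define w where "w = (\<lambda>\<xi>. E \<xi> * y \<xi>)"
  have w: "w \<xi> = t + A y \<xi>" if "\<xi> \<in> {0..1}" for \<xi>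
  proof -
    have "y \<xi> = T y \<xi>" using \<Phi>[of y] y by simp
    then show ?thesis using E0[of \<xi>] that by (simp add: w_def T_def cid)
  qed
  have "deriv01 w (\<lambda>\<eta>. f (\<eta>, w \<eta>))"
    unfolding deriv01_def
  proof
    fix \<xi> :: real assume \<xi>: "\<xi> \<in> {0..1}"
    have "((\<lambda>\<xi>. t + A y \<xi>) has_real_derivative g y \<xi>) (at \<xi> within {0..1})"
      using deriv01D[OF dA \<xi>, of y] by (auto intro!: derivative_eq_intros)
    then show "(w has_real_derivative f (\<xi>, w \<xi>)) (at \<xi> within {0..1})"
      by (rule has_field_derivative_transform_within[OF _ zero_less_one \<xi>, THEN DERIV_cong])
        (use w in \<open>auto simp: g_def w_def\<close>)
  qed
  moreover have "w x = t" using w[OF x] by (simp add: A_def)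
  ultimately show ?thesis by blast
qed

lemma ode_diff_bound:
  assumes w: "deriv01 w (\<lambda>\<eta>. f (\<eta>, w \<eta>))" and v: "deriv01 v (\<lambda>\<eta>. f (\<eta>, v \<eta>))"
    and lip: "\<And>\<eta> s r. \<eta> \<in> {0..1} \<Longrightarrow> \<bar>f (\<eta>, s) - f (\<eta>, r)\<bar> \<le> L * \<bar>s - r\<bar>"
    and "0 \<le> L" "x \<in> {0..1}" "\<xi> \<in> {0..1}"
  shows "\<bar>w \<xi> - v \<xi>\<bar> \<le> exp L * \<bar>w x - v x\<bar>"
proof (rule gronwall01[OF _ \<open>x \<in> _\<close> \<open>\<xi> \<in> _\<close> \<open>0 \<le> L\<close>])
  show "deriv01 (\<lambda>\<xi>. w \<xi> - v \<xi>) (\<lambda>\<xi>. f (\<xi>, w \<xi>) - f (\<xi>, v \<xi>))"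
    using w v by (auto simp: deriv01_def intro!: derivative_eq_intros)
qed (use lip in auto)

section \<open>Coefficients\<close>

lemma strip_iff [simp]: "(x, t) \<in> strip \<longleftrightarrow> 0 \<le> x \<and> x \<le> 1"
  by (simp add: strip_def)

text \<open>The derivatives are named and share one bound \<open>Q\<close> with the function, so
  that later constants depend on the coefficients through \<open>Q\<close> alone.\<close>

definition bc1 :: "real \<Rightarrow> (real \<times> real \<Rightarrow> real) \<Rightarrow> (real \<times> real \<Rightarrow> real) \<Rightarrow> (real \<times> real \<Rightarrow> real) \<Rightarrow> bool" where
  "bc1 Q f fx ft \<longleftrightarrow> has_cont_partials UNIV f fx ft \<and>
     (\<forall>z\<in>strip. \<bar>f z\<bar> \<le> Q \<and> \<bar>fx z\<bar> \<le> Q \<and> \<bar>ft z\<bar> \<le> Q)"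

lemma BC_bound:
  assumes "f \<in> BC" obtains Q where "\<And>z. z \<in> strip \<Longrightarrow> \<bar>f z\<bar> \<le> Q"
  using assms unfolding BC_def bounded_iff by (auto simp: image_iff)

lemma BC1_imp_bc1:
  assumes "f \<in> BC1" shows "\<exists>Q fx ft. bc1 Q f fx ft"
proof -
  obtain fx ft where f: "f \<in> BC" "fx \<in> BC" "ft \<in> BC" and h: "has_cont_partials UNIV f fx ft"
    using assms by (auto simp: BC1_def)
  obtain Q1 Q2 Q3 where "\<And>z. z \<in> strip \<Longrightarrow> \<bar>f z\<bar> \<le> Q1" "\<And>z. z \<in> strip \<Longrightarrow> \<bar>fx z\<bar> \<le> Q2"
    "\<And>z. z \<in> strip \<Longrightarrow> \<bar>ft z\<bar> \<le> Q3"
    using f[THEN BC_bound] by metis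
  then have "bc1 (max Q1 (max Q2 Q3)) f fx ft"
    unfolding bc1_def le_max_iff_disj using h by blast
  then show ?thesis by blast
qed

lemma bc1_mono: "bc1 Q f fx ft \<Longrightarrow> Q \<le> Q' \<Longrightarrow> bc1 Q' f fx ft"
  unfolding bc1_def by (meson order_trans)

lemma BC_I:
  assumes "continuous_on strip f" "\<And>z. z \<in> strip \<Longrightarrow> \<bar>f z\<bar> \<le> Q"
  shows "f \<in> BC"
  using assms unfolding BC_def bounded_iff by fastforce

lemma BC_continuous: "f \<in> BC \<Longrightarrow> continuous_on strip f"
  by (simp add: BC_def)

lemma BC_mult:
  assumes "f \<in> BC" "g \<in> BC" shows "(\<lambda>z. f z * g z) \<in> BC"
proof -
  obtain P Q where PQ: "\<And>z. z \<in> strip \<Longrightarrow> \<bar>f z\<bar> \<le> P" "\<And>z. z \<in> strip \<Longrightarrow> \<bar>g z\<bar> \<le> Q"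
    using assms[THEN BC_bound] by metis
  show ?thesis
  proof (rule BC_I)
    show "\<bar>f z * g z\<bar> \<le> P * Q" if "z \<in> strip" for z
      unfolding abs_mult using PQ[OF that] by (intro mult_mono) auto
  qed (intro continuous_intros assms[THEN BC_continuous])
qed

lemma BC_add:
  assumes "f \<in> BC" "g \<in> BC" shows "(\<lambda>z. f z + g z) \<in> BC"
proof -
  obtain P Q where PQ: "\<And>z. z \<in> strip \<Longrightarrow> \<bar>f z\<bar> \<le> P" "\<And>z. z \<in> strip \<Longrightarrow> \<bar>g z\<bar> \<le> Q"
    using assms[THEN BC_bound] by metis
  show ?thesis
  proof (rule BC_I)
    show "\<bar>f z + g z\<bar> \<le> P + Q" if "z \<in> strip" for z
      using PQ[OF that] by linarith
  qed (intro continuous_intros assms[THEN BC_continuous])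
qed

lemma BC_const: "(\<lambda>_. c) \<in> BC"
  by (rule BC_I[where Q = "\<bar>c\<bar>"]) auto

lemma BC_minus:
  assumes "f \<in> BC" shows "(\<lambda>z. - f z) \<in> BC"
  using BC_mult[OF BC_const[of "-1"] assms] by simp

lemma BC_inverse:
  assumes "f \<in> BC" "0 < \<Lambda>" "\<And>z. z \<in> strip \<Longrightarrow> \<Lambda> \<le> \<bar>f z\<bar>"
  shows "(\<lambda>z. 1 / f z) \<in> BC"
proof (rule BC_I)
  have nz: "f z \<noteq> 0" if "z \<in> strip" for z using assms(2) assms(3)[OF that] by auto
  then show "continuous_on strip (\<lambda>z. 1 / f z)"
    using BC_continuous[OF assms(1)] by (intro continuous_intros) auto
  show "\<bar>1 / f z\<bar> \<le> 1 / \<Lambda>" if "z \<in> strip" for z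
    unfolding abs_divide abs_one using assms(2) assms(3)[OF that] by (intro divide_left_mono mult_pos_pos) auto
qed

lemma BC1_const: "(\<lambda>_. c) \<in> BC1"
  unfolding BC1_def has_cont_partials_def
  by (auto intro!: bexI[of _ "\<lambda>_. 0"] BC_const)

lemma BC1_mult:
  assumes "f \<in> BC1" "g \<in> BC1" shows "(\<lambda>z. f z * g z) \<in> BC1"
proof -
  obtain fx ft where f: "f \<in> BC" "fx \<in> BC" "ft \<in> BC" "has_cont_partials UNIV f fx ft"
    using assms by (auto simp: BC1_def)
  obtain gx gt where g: "g \<in> BC" "gx \<in> BC" "gt \<in> BC" "has_cont_partials UNIV g gx gt"
    using assms by (auto simp: BC1_def)
  have "has_cont_partials UNIV (\<lambda>z. f z * g z) (\<lambda>z. fx z * g z + f z * gx z) (\<lambda>z. ft z * g z + f z * gt z)"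
    using f(4) g(4) unfolding has_cont_partials_def
    by (auto intro!: continuous_intros) (auto intro!: derivative_eq_intros)
  moreover have "(\<lambda>z. fx z * g z + f z * gx z) \<in> BC" "(\<lambda>z. ft z * g z + f z * gt z) \<in> BC" "(\<lambda>z. f z * g z) \<in> BC"
    by (intro BC_mult BC_add f(1-3) g(1-3))+
  ultimately show ?thesis unfolding BC1_def by blast
qed

lemma BC1_inverse:
  assumes "f \<in> BC1" and L: "0 < \<Lambda>" "\<And>z. z \<in> strip \<Longrightarrow> \<Lambda> \<le> \<bar>f z\<bar>"
  shows "(\<lambda>z. 1 / f z) \<in> BC1"
proof -
  obtain fx ft where f: "f \<in> BC" "fx \<in> BC" "ft \<in> BC" "has_cont_partials UNIV f fx ft"
    using assms by (auto simp: BC1_def)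
  have nz: "f z \<noteq> 0" if "z \<in> strip" for z using L(1) L(2)[OF that] by auto
  have i: "(\<lambda>z. 1 / f z) \<in> BC" by (rule BC_inverse[OF f(1) L])
  have c: "continuous_on strip (\<lambda>z. 1 / f z)" using i by (simp add: BC_def)
  have "has_cont_partials UNIV (\<lambda>z. 1 / f z) (\<lambda>z. - (fx z * ((1 / f z) * (1 / f z)))) (\<lambda>z. - (ft z * ((1 / f z) * (1 / f z))))"
    using f(4) c unfolding has_cont_partials_def strip_def[symmetric]
    by (auto intro!: continuous_intros) (auto intro!: derivative_eq_intros simp: nz)
  moreover have "(\<lambda>z. - (fx z * ((1 / f z) * (1 / f z)))) \<in> BC" "(\<lambda>z. - (ft z * ((1 / f z) * (1 / f z)))) \<in> BC"
    by (intro BC_mult BC_minus f(1-3) i)+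
  ultimately show ?thesis using i unfolding BC1_def by blast
qed

lemma has_cont_partialsD:
  assumes "has_cont_partials I f fx ft"
  shows "continuous_on ({0..1} \<times> I) f" "continuous_on ({0..1} \<times> I) fx" "continuous_on ({0..1} \<times> I) ft"
    "x \<in> {0..1} \<Longrightarrow> t \<in> I \<Longrightarrow> ((\<lambda>y. f (y, t)) has_real_derivative fx (x, t)) (at x within {0..1})"
    "x \<in> {0..1} \<Longrightarrow> t \<in> I \<Longrightarrow> ((\<lambda>s. f (x, s)) has_real_derivative ft (x, t)) (at t within I)"
  using assms by (auto simp: has_cont_partials_def)

text \<open>Existence of the x-derivative and continuity of the t-derivative give the total
  derivative relative to the closed set, edges and corners included. This covers curves that touch
  the lateral boundary or the initial time, where only one-sided derivatives exist.\<close>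

lemma has_cont_partials_chain:
  assumes f: "has_cont_partials I f fx ft" and w: "deriv01 w w'" and I: "convex I"
    and wI: "\<And>\<xi>. \<xi> \<in> {0..1} \<Longrightarrow> w \<xi> \<in> I"
  shows "deriv01 (\<lambda>\<xi>. f (\<xi>, w \<xi>)) (\<lambda>\<xi>. fx (\<xi>, w \<xi>) + ft (\<xi>, w \<xi>) * w' \<xi>)"
  unfolding deriv01_def
proof
  fix \<xi> :: real assume \<xi>: "\<xi> \<in> {0..1}"
  have "((\<lambda>(x, t). f (x, t)) has_derivative (\<lambda>(h, k). fx (\<xi>, w \<xi>) * h + blinfun_mult_right (ft (\<xi>, w \<xi>)) k))
      (at (\<xi>, w \<xi>) within {0..1} \<times> I)"
  proof (rule has_derivative_partialsI)
    show "((\<lambda>x. f (x, w \<xi>)) has_derivative (*) (fx (\<xi>, w \<xi>))) (at \<xi> within {0..1})"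
      using has_cont_partialsD(4)[OF f \<xi> wI[OF \<xi>]] by (simp add: has_field_derivative_def)
    show "((\<lambda>y. f (x, y)) has_derivative blinfun_apply (blinfun_mult_right (ft (x, y)))) (at y within I)"
      if "x \<in> {0..1}" "y \<in> I" for x y
      using has_cont_partialsD(5)[OF f that] by (simp add: has_field_derivative_def)
    have "continuous_on ({0..1} \<times> I) (\<lambda>(x, y). blinfun_mult_right (ft (x, y)))"
      using has_cont_partialsD(3)[OF f] by (auto simp: split_beta intro!: continuous_intros)
    then show "continuous (at (\<xi>, w \<xi>) within {0..1} \<times> I) (\<lambda>(x, y). blinfun_mult_right (ft (x, y)))"
      using \<xi> wI[OF \<xi>] unfolding continuous_on_eq_continuous_within by blast
  qed (use \<xi> wI I in auto)
  then have D: "(f has_derivative (\<lambda>(h, k). fx (\<xi>, w \<xi>) * h + ft (\<xi>, w \<xi>) * k)) (at (\<xi>, w \<xi>) within {0..1} \<times> I)"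
    by simp
  have c: "((\<lambda>\<xi>. (\<xi>, w \<xi>)) has_derivative (\<lambda>h. (h, w' \<xi> * h))) (at \<xi> within {0..1})"
    using deriv01D[OF w \<xi>] by (auto simp: has_field_derivative_def intro!: derivative_eq_intros)
  have "((\<lambda>\<xi>. f (\<xi>, w \<xi>)) has_derivative (\<lambda>h. fx (\<xi>, w \<xi>) * h + ft (\<xi>, w \<xi>) * (w' \<xi> * h))) (at \<xi> within {0..1})"
    using has_derivative_in_compose[OF c has_derivative_subset[OF D]] wI by (auto simp: image_subset_iff)
  then show "((\<lambda>\<xi>. f (\<xi>, w \<xi>)) has_real_derivative fx (\<xi>, w \<xi>) + ft (\<xi>, w \<xi>) * w' \<xi>) (at \<xi> within {0..1})"
    by (rule has_derivative_imp_has_field_derivative) (simp add: algebra_simps)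
qed

lemma continuous_on_curve:
  assumes "continuous_on ({0..1} \<times> I) g" "continuous_on {0..1} w" "\<And>\<xi>. \<xi> \<in> {0..1} \<Longrightarrow> w \<xi> \<in> I"
  shows "continuous_on {0..1::real} (\<lambda>\<eta>. g (\<eta>, w \<eta>))"
  by (rule continuous_on_compose2[OF assms(1)]) (auto intro!: continuous_intros assms)

lemma bc1_lipschitz:
  assumes "bc1 Q f fx ft" "\<eta> \<in> {0..1}"
  shows "\<bar>f (\<eta>, s) - f (\<eta>, r)\<bar> \<le> Q * \<bar>s - r\<bar>"
  using field_differentiable_bound[of UNIV "\<lambda>s. f (\<eta>, s)" "\<lambda>s. ft (\<eta>, s)" Q s r] assms
  by (auto simp: bc1_def has_cont_partials_def)

lemma bc1_continuous:
  assumes "bc1 Q f fx ft"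
  shows "continuous_on strip f" "continuous_on strip fx" "continuous_on strip ft"
  using assms by (auto simp: bc1_def has_cont_partials_def strip_def)

lemma bc1_bounds:
  assumes "bc1 Q f fx ft" "x \<in> {0..1}"
  shows "\<bar>f (x, t)\<bar> \<le> Q" "\<bar>fx (x, t)\<bar> \<le> Q" "\<bar>ft (x, t)\<bar> \<le> Q"
  using assms by (auto simp: bc1_def)

lemma bc1_deriv_t:
  assumes "bc1 Q f fx ft" "x \<in> {0..1}"
  shows "((\<lambda>s. f (x, s)) has_real_derivative ft (x, t)) (at t)"
  using assms by (auto simp: bc1_def has_cont_partials_def)

lemma bc1_nonneg: "bc1 Q f fx ft \<Longrightarrow> 0 \<le> Q"
  using bc1_bounds(1)[of Q f fx ft 0 0] abs_ge_zero[of "f (0, 0)"] by simp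

section \<open>The characteristic flow, its dependence on time, and the weights\<close>

definition flow :: "(real \<times> real \<Rightarrow> real) \<Rightarrow> real \<Rightarrow> real \<Rightarrow> real \<Rightarrow> real" where
  "flow f \<xi> x t = (THE s. \<exists>w. deriv01 w (\<lambda>\<eta>. f (\<eta>, w \<eta>)) \<and> w x = t \<and> w \<xi> = s)"

lemma charac_eq_flow: "charac \<alpha> = flow (\<lambda>z. 1 / \<alpha> z)"
  unfolding charac_def flow_def deriv01_def by (intro ext) simp

lemma bc1_ode_unique:
  assumes f: "bc1 Q f fx ft" and w: "deriv01 w (\<lambda>\<eta>. f (\<eta>, w \<eta>))" "deriv01 v (\<lambda>\<eta>. f (\<eta>, v \<eta>))"
    and "w x = v x" "x \<in> {0..1}" "\<xi> \<in> {0..1}"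
  shows "w \<xi> = v \<xi>"
  using ode_diff_bound[of w f v Q x \<xi>] assms bc1_lipschitz[OF f] bc1_nonneg[OF f] by auto

lemma flow_eq:
  assumes f: "bc1 Q f fx ft" and w: "deriv01 w (\<lambda>\<eta>. f (\<eta>, w \<eta>))" and x: "x \<in> {0..1}" "\<xi> \<in> {0..1}"
  shows "flow f \<xi> x (w x) = w \<xi>"
  unfolding flow_def
proof (rule the_equality)
  show "\<exists>v. deriv01 v (\<lambda>\<eta>. f (\<eta>, v \<eta>)) \<and> v x = w x \<and> v \<xi> = w \<xi>" using w by blast
  show "s = w \<xi>" if "\<exists>v. deriv01 v (\<lambda>\<eta>. f (\<eta>, v \<eta>)) \<and> v x = w x \<and> v \<xi> = s" for s
    using bc1_ode_unique[OF f _ w _ x] that by blast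
qed

lemma flow_solution:
  assumes f: "bc1 Q f fx ft" and x: "x \<in> {0..1}"
  shows "deriv01 (\<lambda>\<xi>. flow f \<xi> x t) (\<lambda>\<xi>. f (\<xi>, flow f \<xi> x t))" "flow f x x t = t"
proof -
  have f': "bc1 (Q + 1) f fx ft" using f by (rule bc1_mono) simp
  obtain w where w: "deriv01 w (\<lambda>\<eta>. f (\<eta>, w \<eta>))" "w x = t"
    using ode_exists[OF bc1_continuous(1)[OF f'] _ bc1_lipschitz[OF f'] x, of t] bc1_nonneg[OF f] by auto
  have eq: "flow f \<xi> x t = w \<xi>" if "\<xi> \<in> {0..1}" for \<xi>
    using flow_eq[OF f w(1) x that] w(2) by simp
  show "flow f x x t = t" using eq[OF x] w by simp
  show "deriv01 (\<lambda>\<xi>. flow f \<xi> x t) (\<lambda>\<xi>. f (\<xi>, flow f \<xi> x t))"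
    unfolding deriv01_def
  proof
    fix \<xi> :: real assume \<xi>: "\<xi> \<in> {0..1}"
    show "((\<lambda>\<xi>. flow f \<xi> x t) has_real_derivative f (\<xi>, flow f \<xi> x t)) (at \<xi> within {0..1})"
      unfolding eq[OF \<xi>]
      by (rule has_field_derivative_transform_within[OF deriv01D[OF w(1) \<xi>] zero_less_one \<xi>])
        (use eq in auto)
  qed
qed

text \<open>The slope in x is at most \<open>Q\<close> and the strip has width one. \<open>Q\<close>
  thereby becomes the unit of time of the whole argument: the cost of one crossing.\<close>

lemma flow_dist:
  assumes f: "bc1 Q f fx ft" and x: "x \<in> {0..1}" "\<xi> \<in> {0..1}"
  shows "\<bar>flow f \<xi> x t - t\<bar> \<le> Q"
proof -
  have "\<bar>flow f \<xi> x t - flow f x x t\<bar> \<le> Q * \<bar>\<xi> - x\<bar>"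
    by (rule deriv01_bound[OF flow_solution(1)[OF f x(1)] _ x]) (rule bc1_bounds[OF f])
  also have "\<dots> \<le> Q" using x bc1_nonneg[OF f] by (intro mult_left_le) auto
  finally show ?thesis using flow_solution(2)[OF f x(1)] by simp
qed

text \<open>Gronwall applies in either direction along the characteristics. The reversed inequality
  says that distinct starting times never merge, which permits division by the difference of two
  characteristics when the flow is differentiated.\<close>

lemma flow_diff:
  assumes f: "bc1 Q f fx ft" and x: "x \<in> {0..1}" "\<xi> \<in> {0..1}"
  shows "\<bar>flow f \<xi> x s - flow f \<xi> x t\<bar> \<le> exp Q * \<bar>s - t\<bar>"
    and "\<bar>s - t\<bar> \<le> exp Q * \<bar>flow f \<xi> x s - flow f \<xi> x t\<bar>"
proof -
  have *: "\<bar>flow f v x s - flow f v x t\<bar> \<le> exp Q * \<bar>flow f u x s - flow f u x t\<bar>"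
    if "u \<in> {0..1}" "v \<in> {0..1}" for u v
    using ode_diff_bound[OF flow_solution(1)[OF f x(1)] flow_solution(1)[OF f x(1)] bc1_lipschitz[OF f] bc1_nonneg[OF f] that] .
  show "\<bar>flow f \<xi> x s - flow f \<xi> x t\<bar> \<le> exp Q * \<bar>s - t\<bar>"
    using *[OF x] flow_solution(2)[OF f x(1)] by simp
  show "\<bar>s - t\<bar> \<le> exp Q * \<bar>flow f \<xi> x s - flow f \<xi> x t\<bar>"
    using *[OF x(2,1)] flow_solution(2)[OF f x(1)] by simp
qed

lemma linear_ode_solution:
  assumes D: "deriv01 D (\<lambda>\<eta>. q \<eta> * D \<eta>)" and B: "deriv01 B q" and x: "x \<in> {0..1}" "\<xi> \<in> {0..1}"
  shows "D \<xi> = D x * exp (B \<xi> - B x)"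
proof -
  have d: "deriv01 (\<lambda>\<eta>. D \<eta> * exp (- B \<eta>)) (\<lambda>_. 0)"
    using D B by (auto simp: deriv01_def intro!: derivative_eq_intros)
  have z: "deriv01 (\<lambda>_. 0) (\<lambda>_. 0)" by (auto simp: deriv01_def)
  have "D \<xi> * exp (- B \<xi>) = D x * exp (- B x)"
    using deriv01_unique[OF d z x] by simp
  then show ?thesis by (simp add: exp_diff exp_minus field_simps)
qed

lemma has_real_derivative_sequentially:
  "(f has_real_derivative D) (at t) \<longleftrightarrow>
    (\<forall>X. (\<forall>i. X i \<noteq> t) \<longrightarrow> X \<longlonglongrightarrow> t \<longrightarrow> (\<lambda>i. (f (X i) - f t) / (X i - t)) \<longlonglongrightarrow> D)"
  unfolding has_field_derivative_iff tendsto_at_iff_sequentially o_def by simp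

lemma dominated_convergence_bounded:
  fixes q :: "nat \<Rightarrow> real \<Rightarrow> real"
  assumes "\<And>i. continuous_on {u..v} (q i)" "\<And>i \<eta>. \<eta> \<in> {u..v} \<Longrightarrow> \<bar>q i \<eta>\<bar> \<le> Q"
    "\<And>\<eta>. \<eta> \<in> {u..v} \<Longrightarrow> (\<lambda>i. q i \<eta>) \<longlonglongrightarrow> g \<eta>"
  shows "(\<lambda>i. integral {u..v} (q i)) \<longlonglongrightarrow> integral {u..v} g"
proof (rule dominated_convergence(2)[of q "{u..v}" "\<lambda>_. Q" g])
  show "q i integrable_on {u..v}" for i using assms(1) by (rule integrable_continuous_real)
qed (use assms in \<open>simp_all add: integrable_continuous_real\<close>)

text \<open>The difference of two characteristics solves a linear equation whose coefficient is the
  difference quotient of \<open>f\<close> between them, so the quotient of the flow is an exact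
  exponential before any limit is taken. The coefficients are bounded by \<open>Q\<close> and tend
  to \<open>ft\<close>; dominated convergence passes to the limit in the exponent.\<close>

lemma flow_deriv_t:
  assumes f: "bc1 Q f fx ft" and A: "deriv01 A (\<lambda>\<eta>. ft (\<eta>, flow f \<eta> x t))"
    and x: "x \<in> {0..1}" "\<xi> \<in> {0..1}"
  shows "((\<lambda>t. flow f \<xi> x t) has_real_derivative exp (A \<xi> - A x)) (at t)"
  unfolding has_real_derivative_sequentially
proof (intro allI impI)
  fix X :: "nat \<Rightarrow> real" assume Xt: "\<forall>i. X i \<noteq> t" and lim: "X \<longlonglongrightarrow> t"
  define w where "w = (\<lambda>s \<eta>. flow f \<eta> x s)"
  have w: "deriv01 (w s) (\<lambda>\<eta>. f (\<eta>, w s \<eta>))" "w s x = s" for s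
    using flow_solution[OF f x(1)] by (auto simp: w_def)
  have wc: "continuous_on {0..1} (w s)" for s by (rule deriv01_continuous[OF w(1)])
  define \<delta> where "\<delta> = (\<lambda>i \<eta>. w (X i) \<eta> - w t \<eta>)"
  define q where "q = (\<lambda>i \<eta>. (f (\<eta>, w (X i) \<eta>) - f (\<eta>, w t \<eta>)) / \<delta> i \<eta>)"
  have nz: "\<delta> i \<eta> \<noteq> 0" if "\<eta> \<in> {0..1}" for i \<eta>
    using flow_diff(2)[OF f x(1) that, of "X i" t] Xt by (auto simp: \<delta>_def w_def)
  have qc: "continuous_on {0..1} (q i)" for i
    unfolding q_def using nz
    by (auto simp: \<delta>_def intro!: continuous_intros continuous_on_strip_curve bc1_continuous(1)[OF f] wc)
  have qb: "\<bar>q i \<eta>\<bar> \<le> Q" if "\<eta> \<in> {0..1}" for i \<eta>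
    using bc1_lipschitz[OF f that] nz[OF that, of i] by (simp add: q_def \<delta>_def divide_le_eq)
  have ql: "(\<lambda>i. q i \<eta>) \<longlonglongrightarrow> ft (\<eta>, w t \<eta>)" if \<eta>: "\<eta> \<in> {0..1}" for \<eta>
  proof -
    have "(\<lambda>i. \<delta> i \<eta>) \<longlonglongrightarrow> 0"
    proof (rule Lim_null_comparison)
      show "\<forall>\<^sub>F i in sequentially. norm (\<delta> i \<eta>) \<le> exp Q * \<bar>X i - t\<bar>"
        using flow_diff(1)[OF f x(1) \<eta>] by (auto simp: \<delta>_def w_def)
      show "(\<lambda>i. exp Q * \<bar>X i - t\<bar>) \<longlonglongrightarrow> 0"
        using tendsto_mult_right_zero[OF tendsto_rabs_zero[OF LIM_zero[OF lim]]] by simp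
    qed
    then have "(\<lambda>i. w (X i) \<eta>) \<longlonglongrightarrow> w t \<eta>" by (simp add: \<delta>_def LIM_zero_iff)
    then show ?thesis
      using bc1_deriv_t[OF f \<eta>, of "w t \<eta>", unfolded has_real_derivative_sequentially, rule_format, of "\<lambda>i. w (X i) \<eta>"] nz[OF \<eta>]
      by (auto simp: q_def \<delta>_def)
  qed
  define B where "B = (\<lambda>i \<xi>. integral {0..\<xi>} (q i) - 0)"
  have B: "deriv01 (B i) (q i)" for i unfolding B_def by (rule deriv01_integral[OF qc])
  have "deriv01 (\<delta> i) (\<lambda>\<eta>. q i \<eta> * \<delta> i \<eta>)" for i
    using w(1)[of "X i"] w(1)[of t] nz
    by (auto simp: deriv01_def \<delta>_def q_def intro!: derivative_eq_intros)
  then have "\<delta> i \<xi> = \<delta> i x * exp (B i \<xi> - B i x)" for i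
    by (rule linear_ode_solution[OF _ B x])
  then have eq: "(flow f \<xi> x (X i) - flow f \<xi> x t) / (X i - t) = exp (B i \<xi> - B i x)" for i
    using Xt w(2) by (simp add: \<delta>_def) (simp add: w_def)
  have Blim: "(\<lambda>i. B i \<zeta>) \<longlonglongrightarrow> integral {0..\<zeta>} (\<lambda>\<eta>. ft (\<eta>, w t \<eta>))" if "\<zeta> \<in> {0..1}" for \<zeta>
    unfolding B_def diff_0_right
    by (rule dominated_convergence_bounded[of 0 \<zeta> q Q])
      (use that qb ql in \<open>auto intro: continuous_on_subset[OF qc]\<close>)
  have ftc: "continuous_on {0..1} (\<lambda>\<eta>. ft (\<eta>, w t \<eta>))"
    by (intro continuous_on_strip_curve bc1_continuous(3)[OF f] wc)
  have "A \<xi> - A x = integral {0..\<xi>} (\<lambda>\<eta>. ft (\<eta>, w t \<eta>)) - integral {0..x} (\<lambda>\<eta>. ft (\<eta>, w t \<eta>))"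
    using deriv01_unique[OF A deriv01_integral[OF ftc, of 0, unfolded w_def] x] by (simp add: w_def)
  then show "(\<lambda>i. (flow f \<xi> x (X i) - flow f \<xi> x t) / (X i - t)) \<longlonglongrightarrow> exp (A \<xi> - A x)"
    unfolding eq using Blim x by (auto intro!: tendsto_intros)
qed

text \<open>The Lipschitz bound dominates the difference quotients, so the derivative of the
  integrand has to be known only at the single time \<open>t\<close>. It serves to differentiate the
  exponent of the reflection weight.\<close>

lemma deriv_integral_param:
  fixes F :: "real \<Rightarrow> real \<Rightarrow> real"
  assumes c: "\<And>s. continuous_on {u..v} (F s)"
    and d: "\<And>\<eta>. \<eta> \<in> {u..v} \<Longrightarrow> ((\<lambda>s. F s \<eta>) has_real_derivative F' \<eta>) (at t)"
    and l: "\<And>\<eta> s. \<eta> \<in> {u..v} \<Longrightarrow> \<bar>F s \<eta> - F t \<eta>\<bar> \<le> L * \<bar>s - t\<bar>"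
  shows "((\<lambda>s. integral {u..v} (F s)) has_real_derivative integral {u..v} F') (at t)"
  unfolding has_real_derivative_sequentially
proof (intro allI impI)
  fix X :: "nat \<Rightarrow> real" assume Xt: "\<forall>i. X i \<noteq> t" and lim: "X \<longlonglongrightarrow> t"
  define q where "q = (\<lambda>i \<eta>. (F (X i) \<eta> - F t \<eta>) / (X i - t))"
  have "(\<lambda>i. integral {u..v} (q i)) \<longlonglongrightarrow> integral {u..v} F'"
  proof (rule dominated_convergence_bounded[of u v q L])
    show "continuous_on {u..v} (q i)" for i unfolding q_def using Xt by (auto intro!: continuous_intros c)
    show "\<bar>q i \<eta>\<bar> \<le> L" if "\<eta> \<in> {u..v}" for i \<eta>
      using l[OF that, of "X i"] Xt by (simp add: q_def divide_le_eq)
    show "(\<lambda>i. q i \<eta>) \<longlonglongrightarrow> F' \<eta>" if "\<eta> \<in> {u..v}" for \<eta>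
      using d[OF that, unfolded has_real_derivative_sequentially, rule_format, of X] Xt lim
      by (simp add: q_def)
  qed
  moreover have "integral {u..v} (q i) = (integral {u..v} (F (X i)) - integral {u..v} (F t)) / (X i - t)" for i
    unfolding q_def by (simp add: integral_diff c integrable_continuous_real)
  ultimately show "(\<lambda>i. (integral {u..v} (F (X i)) - integral {u..v} (F t)) / (X i - t)) \<longlonglongrightarrow> integral {u..v} F'"
    by simp
qed

text \<open>Any primitive along the characteristic evaluates the integral in the weight, for either
  order of \<open>x\<close> and \<open>\<xi>\<close>; the weight is thereby identified with an
  integrating factor.\<close>

lemma char_weight_eq:
  assumes f: "bc1 Q (\<lambda>z. 1 / \<alpha> z) fx ft" and r: "continuous_on strip (\<lambda>z. \<beta> z / \<alpha> z)"
    and A: "deriv01 A (\<lambda>\<eta>. \<beta> (\<eta>, charac \<alpha> \<eta> x t) / \<alpha> (\<eta>, charac \<alpha> \<eta> x t))"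
    and x: "x \<in> {0..1}" "\<xi> \<in> {0..1}"
  shows "char_weight \<alpha> \<beta> \<xi> x t = exp (A \<xi> - A x)"
proof -
  have c: "continuous_on {0..1} (\<lambda>\<eta>. charac \<alpha> \<eta> x t)"
    unfolding charac_eq_flow by (rule deriv01_continuous[OF flow_solution(1)[OF f x(1)]])
  have sub: "{min x \<xi>..max x \<xi>} \<subseteq> {0..1}" using x by auto
  have "(LBINT \<eta>=ereal x..ereal \<xi>. \<beta> (\<eta>, charac \<alpha> \<eta> x t) / \<alpha> (\<eta>, charac \<alpha> \<eta> x t)) = A \<xi> - A x"
  proof (rule interval_integral_FTC_finite)
    show "continuous_on {min x \<xi>..max x \<xi>} (\<lambda>\<eta>. \<beta> (\<eta>, charac \<alpha> \<eta> x t) / \<alpha> (\<eta>, charac \<alpha> \<eta> x t))"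
      using continuous_on_strip_curve[OF r c] by (rule continuous_on_subset) (rule sub)
    show "(A has_vector_derivative \<beta> (\<eta>, charac \<alpha> \<eta> x t) / \<alpha> (\<eta>, charac \<alpha> \<eta> x t)) (at \<eta> within {min x \<xi>..max x \<xi>})"
      if "min x \<xi> \<le> \<eta>" "\<eta> \<le> max x \<xi>" for \<eta>
    proof -
      have "\<eta> \<in> {0..1}" using that x by auto
      from DERIV_subset[OF deriv01D[OF A this] sub] show ?thesis
        by (simp add: has_real_derivative_iff_has_vector_derivative)
    qed
  qed
  then show ?thesis by (simp add: char_weight_def)
qed

section \<open>Estimates for classical solutions\<close>

text \<open>Freezing the integrand beyond the upper limit, through \<open>min r s\<close>, makes the
  interval of integration constant; the surplus \<open>(S - s) * g (x, s)\<close> is itself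
  continuous.\<close>

lemma integral_upper_limit_continuous:
  fixes g :: "real \<times> real \<Rightarrow> real"
  assumes g: "continuous_on ({0..1} \<times> {\<tau>..S}) g"
  shows "continuous_on ({0..1} \<times> {\<tau>..S}) (\<lambda>(x, s). integral {\<tau>..s} (\<lambda>r. g (x, r)))"
proof -
  have gx: "continuous_on {\<tau>..S} (\<lambda>r. g (x, r))" if "x \<in> {0..1}" for x
    by (rule continuous_on_compose2[OF g]) (use that in \<open>auto intro!: continuous_intros\<close>)
  have c: "continuous_on ({0..1} \<times> {\<tau>..S}) (\<lambda>z. integral (cbox \<tau> S) (\<lambda>r. g (fst z, min r (snd z))))"
  proof (rule integral_continuous_on_param)
    show "continuous_on (({0..1} \<times> {\<tau>..S}) \<times> cbox \<tau> S) (\<lambda>(z, r). g (fst z, min r (snd z)))"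
      unfolding split_beta
      by (rule continuous_on_compose2[OF g]) (auto intro!: continuous_intros)
  qed
  have eq: "integral {\<tau>..s} (\<lambda>r. g (x, r)) = integral (cbox \<tau> S) (\<lambda>r. g (x, min r s)) - (S - s) * g (x, s)"
    if x: "x \<in> {0..1}" and s: "s \<in> {\<tau>..S}" for x s
  proof -
    have "continuous_on {\<tau>..S} (\<lambda>r. g (x, min r s))"
      by (rule continuous_on_compose2[OF gx[OF x], of _ "\<lambda>r. min r s"])
        (use s in \<open>auto intro!: continuous_intros\<close>)
    then have "integral {\<tau>..s} (\<lambda>r. g (x, min r s)) + integral {s..S} (\<lambda>r. g (x, min r s)) = integral {\<tau>..S} (\<lambda>r. g (x, min r s))"
      using s by (intro Henstock_Kurzweil_Integration.integral_combine integrable_continuous_real) auto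
    moreover have "integral {\<tau>..s} (\<lambda>r. g (x, min r s)) = integral {\<tau>..s} (\<lambda>r. g (x, r))"
      by (rule integral_cong) auto
    moreover have "integral {s..S} (\<lambda>r. g (x, min r s)) = integral {s..S} (\<lambda>r. g (x, s))"
      by (rule integral_cong) auto
    ultimately show ?thesis using s by simp
  qed
  have "continuous_on ({0..1} \<times> {\<tau>..S}) (\<lambda>z. integral (cbox \<tau> S) (\<lambda>r. g (fst z, min r (snd z))) - (S - snd z) * g z)"
    by (intro continuous_intros c g)
  then show ?thesis
    by (rule continuous_on_eq) (use eq in auto)
qed

text \<open>The pointwise inequality |h| <= M + h^2 / M takes the place of Cauchy-Schwarz. It
  requires M > 0, so the later estimates carry an arbitrary M above the L2 bound, which a limit
  removes at the end.\<close>

lemma integral_abs_le_square: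
  fixes h :: "real \<Rightarrow> real"
  assumes h: "continuous_on {u..v} h" and M: "0 < M" and uv: "u \<le> v"
    and sq: "integral {u..v} (\<lambda>x. (h x)\<^sup>2) \<le> K * M\<^sup>2"
  shows "integral {u..v} (\<lambda>x. \<bar>h x\<bar>) \<le> ((v - u) + K) * M"
proof -
  have "\<bar>h x\<bar> \<le> M + (h x)\<^sup>2 / M" for x
  proof -
    have "0 \<le> (\<bar>h x\<bar> - M)\<^sup>2 + M * \<bar>h x\<bar>" using M by (intro add_nonneg_nonneg) auto
    also have "\<dots> = (h x)\<^sup>2 + M * M - M * \<bar>h x\<bar>" by (simp add: power2_eq_square algebra_simps)
    finally show ?thesis using M by (simp add: field_simps power2_eq_square)
  qed
  then have "integral {u..v} (\<lambda>x. \<bar>h x\<bar>) \<le> integral {u..v} (\<lambda>x. M + (h x)\<^sup>2 / M)"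
    using M by (intro integral_le integrable_continuous_real continuous_intros h) auto
  also have "\<dots> = (v - u) * M + integral {u..v} (\<lambda>x. (h x)\<^sup>2) / M"
    using uv M by (subst integral_add) (auto intro!: integrable_continuous_real continuous_intros h)
  also have "\<dots> \<le> (v - u) * M + K * M\<^sup>2 / M"
    using sq M by (intro add_left_mono divide_right_mono) auto
  also have "\<dots> = ((v - u) + K) * M" using M by (simp add: power2_eq_square algebra_simps)
  finally show ?thesis .
qed

lemma continuous_on_slices:
  assumes "continuous_on ({0..1} \<times> I) (g :: real \<times> real \<Rightarrow> real)"
  shows "x \<in> {0..1} \<Longrightarrow> J \<subseteq> I \<Longrightarrow> continuous_on J (\<lambda>t. g (x, t))"
    and "t \<in> I \<Longrightarrow> continuous_on {0..1} (\<lambda>x. g (x, t))"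
  by (rule continuous_on_compose2[OF assms]; auto intro!: continuous_intros)+

section \<open>The normalised system and bounds along its characteristics\<close>

locale hyp_system =
  fixes n :: nat and f fx ft r rx rt :: "nat \<Rightarrow> real \<times> real \<Rightarrow> real"
    and \<kappa> \<kappa>x \<kappa>t :: "nat \<Rightarrow> nat \<Rightarrow> real \<times> real \<Rightarrow> real" and Q :: real
  assumes f: "j \<in> {1..n} \<Longrightarrow> bc1 Q (f j) (fx j) (ft j)"
    and r: "j \<in> {1..n} \<Longrightarrow> bc1 Q (r j) (rx j) (rt j)"
    and \<kappa>: "j \<in> {1..n} \<Longrightarrow> k \<in> {1..n} \<Longrightarrow> bc1 Q (\<kappa> j k) (\<kappa>x j k) (\<kappa>t j k)"
    and Q0: "0 \<le> Q"
begin

definition H :: "(nat \<Rightarrow> real \<times> real \<Rightarrow> real) \<Rightarrow> nat \<Rightarrow> real \<times> real \<Rightarrow> real" where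
  "H u j z = r j z * u j z + (\<Sum>k=1..n. \<kappa> j k z * (f j z - f k z) * u k z)"

text \<open>The system divided by \<open>a j\<close>: \<open>f j = 1 / a j\<close>, \<open>r j = b j / a j\<close> and \<open>\<kappa> j k = \<beta> j k * a k\<close>.\<close>

definition sol :: "real \<Rightarrow> (nat \<Rightarrow> real \<times> real \<Rightarrow> real) \<Rightarrow> (nat \<Rightarrow> real \<times> real \<Rightarrow> real) \<Rightarrow> (nat \<Rightarrow> real \<times> real \<Rightarrow> real) \<Rightarrow> bool" where
  "sol \<tau> u ux ut \<longleftrightarrow> (\<forall>j\<in>{1..n}. has_cont_partials {\<tau>..} (u j) (ux j) (ut j) \<and>
     (\<forall>x\<in>{0..1}. \<forall>t\<ge>\<tau>. ux j (x, t) = - f j (x, t) * ut j (x, t) - H u j (x, t)))"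

text \<open>The first \<open>Q\<close> comes from \<open>r j\<close>; in the coupling, \<kappa>
  contributes \<open>Q\<close> and the difference of two reciprocal speeds
  \<open>2 * Q\<close>.\<close>

definition CH :: real where "CH = Q + 2 * Q\<^sup>2"

lemma CH0: "0 \<le> CH" using Q0 by (simp add: CH_def)

lemma coef_bounds:
  assumes "x \<in> {0..1}" "j \<in> {1..n}" "k \<in> {1..n}"
  shows "\<bar>f j (x, t)\<bar> \<le> Q" "\<bar>fx j (x, t)\<bar> \<le> Q" "\<bar>ft j (x, t)\<bar> \<le> Q"
    "\<bar>r j (x, t)\<bar> \<le> Q" "\<bar>rx j (x, t)\<bar> \<le> Q" "\<bar>rt j (x, t)\<bar> \<le> Q"
    "\<bar>\<kappa> j k (x, t)\<bar> \<le> Q" "\<bar>\<kappa>x j k (x, t)\<bar> \<le> Q" "\<bar>\<kappa>t j k (x, t)\<bar> \<le> Q"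
  by (fact bc1_bounds[OF f[OF assms(2)] assms(1)] bc1_bounds[OF r[OF assms(2)] assms(1)]
      bc1_bounds[OF \<kappa>[OF assms(2,3)] assms(1)])+

lemma coef_continuous:
  assumes "j \<in> {1..n}" "k \<in> {1..n}"
  shows "continuous_on ({0..1} \<times> I) (f j)" "continuous_on ({0..1} \<times> I) (ft j)"
    "continuous_on ({0..1} \<times> I) (r j)" "continuous_on ({0..1} \<times> I) (rt j)"
    "continuous_on ({0..1} \<times> I) (\<kappa> j k)" "continuous_on ({0..1} \<times> I) (\<kappa>x j k)" "continuous_on ({0..1} \<times> I) (\<kappa>t j k)"
proof -
  have s: "{0..1} \<times> I \<subseteq> strip" by (auto simp: strip_def)
  show "continuous_on ({0..1} \<times> I) (f j)" "continuous_on ({0..1} \<times> I) (ft j)"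
    "continuous_on ({0..1} \<times> I) (r j)" "continuous_on ({0..1} \<times> I) (rt j)"
    "continuous_on ({0..1} \<times> I) (\<kappa> j k)" "continuous_on ({0..1} \<times> I) (\<kappa>x j k)" "continuous_on ({0..1} \<times> I) (\<kappa>t j k)"
    by (rule continuous_on_subset[OF _ s],
        fact bc1_continuous[OF f[OF assms(1)]] bc1_continuous[OF r[OF assms(1)]] bc1_continuous[OF \<kappa>[OF assms]])+
qed

lemma H_bound:
  assumes "x \<in> {0..1}" and j: "j \<in> {1..n}"
  shows "\<bar>H u j (x, t)\<bar> \<le> CH * (\<Sum>l=1..n. \<bar>u l (x, t)\<bar>)"
proof -
  have "\<bar>r j (x, t) * u j (x, t)\<bar> \<le> Q * (\<Sum>l=1..n. \<bar>u l (x, t)\<bar>)"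
    unfolding abs_mult
    using coef_bounds(4)[OF assms j] member_le_sum[OF j, of "\<lambda>l. \<bar>u l (x, t)\<bar>"] Q0
    by (intro mult_mono) auto
  moreover have "\<bar>\<Sum>k=1..n. \<kappa> j k (x, t) * (f j (x, t) - f k (x, t)) * u k (x, t)\<bar> \<le> (\<Sum>k=1..n. 2 * Q\<^sup>2 * \<bar>u k (x, t)\<bar>)"
  proof (rule order_trans[OF sum_abs], rule sum_mono)
    fix k assume k: "k \<in> {1..n}"
    have "\<bar>f j (x, t) - f k (x, t)\<bar> \<le> 2 * Q"
      using coef_bounds(1)[OF assms k, of t] coef_bounds(1)[OF assms(1) k k, of t] by linarith
    then have "\<bar>\<kappa> j k (x, t)\<bar> * \<bar>f j (x, t) - f k (x, t)\<bar> \<le> Q * (2 * Q)"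
      using coef_bounds(7)[OF assms k, of t] Q0 by (intro mult_mono) auto
    then show "\<bar>\<kappa> j k (x, t) * (f j (x, t) - f k (x, t)) * u k (x, t)\<bar> \<le> 2 * Q\<^sup>2 * \<bar>u k (x, t)\<bar>"
      unfolding abs_mult by (intro mult_right_mono) (auto simp: power2_eq_square)
  qed
  ultimately show ?thesis
    unfolding H_def CH_def distrib_right sum_distrib_left[symmetric] by linarith
qed

lemma solD:
  assumes "sol \<tau> u ux ut" "j \<in> {1..n}"
  shows "has_cont_partials {\<tau>..} (u j) (ux j) (ut j)"
    "x \<in> {0..1} \<Longrightarrow> \<tau> \<le> t \<Longrightarrow> ux j (x, t) = - f j (x, t) * ut j (x, t) - H u j (x, t)"
  using assms by (auto simp: sol_def)

lemma sol_continuous: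
  assumes "sol \<tau> u ux ut" "j \<in> {1..n}" "I \<subseteq> {\<tau>..}"
  shows "continuous_on ({0..1} \<times> I) (u j)" "continuous_on ({0..1} \<times> I) (ux j)" "continuous_on ({0..1} \<times> I) (ut j)"
    "continuous_on ({0..1} \<times> I) (H u j)"
proof -
  show u: "continuous_on ({0..1} \<times> I) (u j)" "continuous_on ({0..1} \<times> I) (ux j)" "continuous_on ({0..1} \<times> I) (ut j)"
    using has_cont_partialsD(1-3)[OF solD(1)[OF assms(1,2)]] assms(3) by (auto intro: continuous_on_subset)
  have "continuous_on ({0..1} \<times> I) (u k)" if "k \<in> {1..n}" for k
    using has_cont_partialsD(1)[OF solD(1)[OF assms(1) that]] assms(3) by (auto intro: continuous_on_subset)
  then show "continuous_on ({0..1} \<times> I) (H u j)"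
    unfolding H_def using assms(2)
    by (intro continuous_intros coef_continuous) auto
qed

text \<open>The first summand bounds the mean over x of the trace integral, \<open>2 * Q\<close> the
  boundary terms at the two ends of the time interval, and the last the bulk term of its
  x-derivative.\<close>

definition KS :: "real \<Rightarrow> real" where
  "KS d = d + 2 * Q + n * ((Q + CH * (n + 1)) * d)"

text \<open>The \<open>x\<close>-derivative of \<open>\<integral> u\<^sup>2 dt\<close> contains no derivative of \<open>u\<close> after integration by parts in \<open>t\<close>.\<close>

lemma trace_square_bound:
  assumes s: "sol \<tau> u ux ut" and S: "\<tau> \<le> S"
    and M: "\<And>t j. t \<in> {\<tau>..S} \<Longrightarrow> j \<in> {1..n} \<Longrightarrow> integral {0..1} (\<lambda>x. (u j (x, t))\<^sup>2) \<le> M\<^sup>2"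
    and x: "x \<in> {0..1}" and j: "j \<in> {1..n}"
  shows "integral {\<tau>..S} (\<lambda>t. (u j (x, t))\<^sup>2) \<le> KS (S - \<tau>) * M\<^sup>2"
proof -
  let ?I = "{\<tau>..S}"
  have sub: "?I \<subseteq> {\<tau>..}" by auto
  note cu = sol_continuous[OF s _ sub]
  define F where "F = (\<lambda>x. integral ?I (\<lambda>t. (u j (x, t))\<^sup>2))"
  define C where "C = Q + CH * (n + 1)"
  define h where "h = (\<lambda>x. Q * (u j (x, S))\<^sup>2 + Q * (u j (x, \<tau>))\<^sup>2 + C * (\<Sum>l=1..n. integral ?I (\<lambda>t. (u l (x, t))\<^sup>2)))"
  define F' where "F' = (\<lambda>x. integral ?I (\<lambda>t. 2 * u j (x, t) * ux j (x, t)))"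
  have C0: "0 \<le> C" using Q0 CH0 by (simp add: C_def)
  have cI: "continuous_on {0..1} (\<lambda>x. integral ?I (\<lambda>t. (u l (x, t))\<^sup>2))" if "l \<in> {1..n}" for l
    using integral_continuous_on_param[of "{0..1}" \<tau> S "\<lambda>x t. (u l (x, t))\<^sup>2"] cu(1)[OF that]
    by (auto simp: split_beta intro!: continuous_intros)
  have dF: "deriv01 F F'"
    unfolding deriv01_def F_def F'_def
  proof
    fix x :: real assume x: "x \<in> {0..1}"
    have "((\<lambda>x. integral (cbox \<tau> S) (\<lambda>t. (u j (x, t))\<^sup>2)) has_field_derivative
        integral (cbox \<tau> S) (\<lambda>t. 2 * u j (x, t) * ux j (x, t))) (at x within {0..1})"
    proof (rule leibniz_rule_field_derivative)
      show "((\<lambda>x. (u j (x, t))\<^sup>2) has_real_derivative 2 * u j (x, t) * ux j (x, t)) (at x within {0..1})"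
        if "x \<in> {0..1}" "t \<in> cbox \<tau> S" for x t
        using has_cont_partialsD(4)[OF solD(1)[OF s j] that(1), of t] that(2)
        by (auto intro!: derivative_eq_intros)
      show "(\<lambda>t. (u j (x, t))\<^sup>2) integrable_on cbox \<tau> S" if "x \<in> {0..1}" for x
        using continuous_on_slices(1)[OF cu(1)[OF j] that order_refl]
        by (auto intro!: integrable_continuous_real continuous_intros)
      show "continuous_on ({0..1} \<times> cbox \<tau> S) (\<lambda>(x, t). 2 * u j (x, t) * ux j (x, t))"
        using cu(1,2)[OF j] by (auto simp: split_beta intro!: continuous_intros)
    qed (use x in auto)
    then show "((\<lambda>x. integral ?I (\<lambda>t. (u j (x, t))\<^sup>2)) has_real_derivative
        integral ?I (\<lambda>t. 2 * u j (x, t) * ux j (x, t))) (at x within {0..1})" by simp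
  qed
  have F'h: "\<bar>F' x\<bar> \<le> h x" if x: "x \<in> {0..1}" for x
  proof -
    note ct = continuous_on_slices(1)[OF _ x order_refl]
    note cc = ct[OF cu(1)[OF j]] ct[OF cu(3)[OF j]] ct[OF cu(4)[OF j]] ct[OF coef_continuous(1)[OF j j]] ct[OF coef_continuous(2)[OF j j]]
    have cl: "continuous_on ?I (\<lambda>t. u l (x, t))" if "l \<in> {1..n}" for l using ct[OF cu(1)[OF that]] .
    \<comment> \<open>By the equation, 2 u u_x equals a term \<open>G\<close> without derivatives of
      u, minus \<open>P'\<close>, the time derivative of f u^2. Integrated in t, the latter leaves
      only values at the two end times.\<close>
    define P where "P = (\<lambda>t. f j (x, t) * (u j (x, t))\<^sup>2)"
    define P' where "P' = (\<lambda>t. ft j (x, t) * (u j (x, t))\<^sup>2 + f j (x, t) * (2 * u j (x, t) * ut j (x, t)))"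
    define G where "G = (\<lambda>t. ft j (x, t) * (u j (x, t))\<^sup>2 - 2 * u j (x, t) * H u j (x, t))"
    have "(P' has_integral P S - P \<tau>) ?I"
    proof (rule fundamental_theorem_of_calculus[OF S])
      fix t assume t: "t \<in> ?I"
      have "((\<lambda>t. u j (x, t)) has_real_derivative ut j (x, t)) (at t within ?I)"
        by (rule DERIV_subset[OF has_cont_partialsD(5)[OF solD(1)[OF s j] x] sub]) (use t in auto)
      moreover have "((\<lambda>t. f j (x, t)) has_real_derivative ft j (x, t)) (at t within ?I)"
        using bc1_deriv_t[OF f[OF j] x] by (rule has_field_derivative_at_within)
      ultimately have "(P has_real_derivative P' t) (at t within ?I)"
        unfolding P_def P'_def by (auto intro!: derivative_eq_intros)
      then show "(P has_vector_derivative P' t) (at t within ?I)"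
        by (simp add: has_real_derivative_iff_has_vector_derivative)
    qed
    then have iP: "integral ?I P' = P S - P \<tau>" by (rule integral_unique)
    have "F' x = integral ?I (\<lambda>t. G t - P' t)"
      unfolding F'_def
    proof (rule integral_cong)
      fix t assume "t \<in> ?I"
      then have "ux j (x, t) = - f j (x, t) * ut j (x, t) - H u j (x, t)"
        by (intro solD(2)[OF s j x]) auto
      then show "2 * u j (x, t) * ux j (x, t) = G t - P' t"
        unfolding G_def P'_def by (simp only:) (simp add: power2_eq_square algebra_simps)
    qed
    also have "\<dots> = integral ?I G - (P S - P \<tau>)"
      unfolding iP[symmetric] G_def P'_def
      by (intro integral_diff integrable_continuous_real continuous_intros cc)
    finally have F': "F' x = integral ?I G - P S + P \<tau>" by simp
    have "\<bar>integral ?I G\<bar> \<le> integral ?I (\<lambda>t. C * (\<Sum>l=1..n. (u l (x, t))\<^sup>2))"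
      unfolding real_norm_def[symmetric]
    proof (rule Henstock_Kurzweil_Integration.integral_norm_bound_integral)
      show "G integrable_on ?I" unfolding G_def by (intro integrable_continuous_real continuous_intros cc)
      show "(\<lambda>t. C * (\<Sum>l=1..n. (u l (x, t))\<^sup>2)) integrable_on ?I"
        by (intro integrable_continuous_real continuous_intros cl) auto
      fix t assume t: "t \<in> ?I"
      let ?N = "\<Sum>l=1..n. (u l (x, t))\<^sup>2"
      have uj: "(u j (x, t))\<^sup>2 \<le> ?N"
        using member_le_sum[OF j, of "\<lambda>l. (u l (x, t))\<^sup>2"] by simp
      \<comment> \<open>Each product of two components is split into squares; summing over l turns
        the square of \<open>u j\<close> into n copies, whence the factor n + 1.\<close>
      have "\<bar>2 * u j (x, t) * H u j (x, t)\<bar> \<le> 2 * \<bar>u j (x, t)\<bar> * (CH * (\<Sum>l=1..n. \<bar>u l (x, t)\<bar>))"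
        unfolding abs_mult using H_bound[OF x j, of u t] by (intro mult_mono) auto
      also have "\<dots> = CH * (\<Sum>l=1..n. 2 * \<bar>u j (x, t)\<bar> * \<bar>u l (x, t)\<bar>)"
        by (simp add: sum_distrib_left algebra_simps)
      also have "\<dots> \<le> CH * (\<Sum>l=1..n. (u j (x, t))\<^sup>2 + (u l (x, t))\<^sup>2)"
      proof (intro mult_left_mono sum_mono CH0)
        fix l show "2 * \<bar>u j (x, t)\<bar> * \<bar>u l (x, t)\<bar> \<le> (u j (x, t))\<^sup>2 + (u l (x, t))\<^sup>2"
          using sum_squares_bound[of "\<bar>u j (x, t)\<bar>" "\<bar>u l (x, t)\<bar>"] by simp
      qed
      also have "\<dots> = CH * (n * (u j (x, t))\<^sup>2 + ?N)" by (simp add: sum.distrib)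
      also have "\<dots> \<le> CH * (n * ?N + ?N)"
        using uj CH0 by (intro mult_left_mono add_right_mono) auto
      finally have a: "\<bar>2 * u j (x, t) * H u j (x, t)\<bar> \<le> CH * (n + 1) * ?N" by (simp add: algebra_simps)
      have "\<bar>ft j (x, t) * (u j (x, t))\<^sup>2\<bar> \<le> Q * ?N"
        unfolding abs_mult using coef_bounds(3)[OF x j j, of t] uj Q0 by (intro mult_mono) auto
      then have "\<bar>G t\<bar> \<le> Q * ?N + CH * (n + 1) * ?N"
        using a abs_triangle_ineq4[of "ft j (x, t) * (u j (x, t))\<^sup>2" "2 * u j (x, t) * H u j (x, t)"]
        unfolding G_def by linarith
      then show "norm (G t) \<le> C * ?N" by (simp add: C_def algebra_simps)
    qed
    also have "\<dots> = C * (\<Sum>l=1..n. integral ?I (\<lambda>t. (u l (x, t))\<^sup>2))"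
      by (simp, subst integral_sum) (auto intro!: integrable_continuous_real continuous_intros cl)
    finally have "\<bar>integral ?I G\<bar> \<le> C * (\<Sum>l=1..n. integral ?I (\<lambda>t. (u l (x, t))\<^sup>2))" .
    moreover have "\<bar>P t\<bar> \<le> Q * (u j (x, t))\<^sup>2" for t
      unfolding P_def abs_mult using coef_bounds(1)[OF x j j, of t] by (simp add: mult_right_mono)
    ultimately show ?thesis
      unfolding F' h_def by (smt (verit, best))
  qed
  have ch: "continuous_on {0..1} h"
    unfolding h_def using S
    by (intro continuous_intros continuous_on_slices(2)[OF cu(1)[OF j]] cI) auto
  \<comment> \<open>After exchanging the integrals, the mean over x of the trace integral is bounded
    directly by the L2 hypothesis at fixed times.\<close>
  have swap: "integral {0..1} (\<lambda>x. integral ?I (\<lambda>t. (u l (x, t))\<^sup>2)) \<le> (S - \<tau>) * M\<^sup>2" if l: "l \<in> {1..n}" for l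
  proof -
    have "integral (cbox 0 1) (\<lambda>x. integral (cbox \<tau> S) (\<lambda>t. (u l (x, t))\<^sup>2)) =
        integral (cbox \<tau> S) (\<lambda>t. integral (cbox 0 1) (\<lambda>x. (u l (x, t))\<^sup>2))"
    proof (rule integral_swap_continuous)
      show "continuous_on (cbox (0, \<tau>) (1, S)) (\<lambda>(x, t). (u l (x, t))\<^sup>2)"
        using cu(1)[OF l] by (auto simp: split_beta cbox_Pair_eq intro!: continuous_intros)
    qed
    then have "integral {0..1} (\<lambda>x. integral ?I (\<lambda>t. (u l (x, t))\<^sup>2)) = integral ?I (\<lambda>t. integral {0..1} (\<lambda>x. (u l (x, t))\<^sup>2))"
      by simp
    also have "\<dots> \<le> integral ?I (\<lambda>t. M\<^sup>2)"
    proof (rule integral_le)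
      have "continuous_on (?I \<times> cbox 0 1) (\<lambda>(t, x). (u l (x, t))\<^sup>2)"
        unfolding split_beta
        by (intro continuous_intros continuous_on_compose2[OF cu(1)[OF l]]) auto
      from integral_continuous_on_param[OF this]
      show "(\<lambda>t. integral {0..1} (\<lambda>x. (u l (x, t))\<^sup>2)) integrable_on ?I"
        by (intro integrable_continuous_real) simp
    qed (use M l in auto)
    finally show ?thesis using S by simp
  qed
  have ih: "integral {0..1} h \<le> (2 * Q + C * (n * (S - \<tau>))) * M\<^sup>2"
  proof -
    note c2 = continuous_on_slices(2)[OF cu(1)[OF j]]
    have e1: "integral {0..1} (\<lambda>x. Q * (u j (x, S))\<^sup>2) \<le> Q * M\<^sup>2" "integral {0..1} (\<lambda>x. Q * (u j (x, \<tau>))\<^sup>2) \<le> Q * M\<^sup>2"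
      using M[OF _ j, of S] M[OF _ j, of \<tau>] S Q0 by (auto intro!: mult_left_mono)
    have "integral {0..1} (\<lambda>x. C * (\<Sum>l=1..n. integral ?I (\<lambda>t. (u l (x, t))\<^sup>2)))
      = C * (\<Sum>l=1..n. integral {0..1} (\<lambda>x. integral ?I (\<lambda>t. (u l (x, t))\<^sup>2)))"
      by (simp, subst integral_sum) (auto intro!: integrable_continuous_real cI)
    also have "\<dots> \<le> C * (\<Sum>l=1..n. (S - \<tau>) * M\<^sup>2)"
      by (intro mult_left_mono sum_mono swap C0)
    finally have e2: "integral {0..1} (\<lambda>x. C * (\<Sum>l=1..n. integral ?I (\<lambda>t. (u l (x, t))\<^sup>2))) \<le> C * (n * (S - \<tau>)) * M\<^sup>2"
      by (simp add: algebra_simps)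
    have "integral {0..1} h = integral {0..1} (\<lambda>x. Q * (u j (x, S))\<^sup>2) + integral {0..1} (\<lambda>x. Q * (u j (x, \<tau>))\<^sup>2)
      + integral {0..1} (\<lambda>x. C * (\<Sum>l=1..n. integral ?I (\<lambda>t. (u l (x, t))\<^sup>2)))"
      unfolding h_def using S
      by (subst integral_add, (intro integrable_continuous_real continuous_intros c2 cI; simp)+)+ simp
    then show ?thesis using e1 e2 by (simp add: algebra_simps)
  qed
  \<comment> \<open>No particular point has a trace bound known in advance, but the variation of
    \<open>F\<close> between any two points is bounded. Averaging over the comparison point y
    replaces \<open>F y\<close> by its mean.\<close>
  have "F x \<le> F y + integral {0..1} h" if "y \<in> {0..1}" for y
    using deriv01_bound_integral[OF dF F'h ch that x] by linarith
  then have "integral {0..1} (\<lambda>y::real. F x) \<le> integral {0..1} (\<lambda>y. F y + integral {0..1} h)"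
    by (intro integral_le integrable_continuous_real continuous_intros deriv01_continuous[OF dF]) auto
  also have "\<dots> = integral {0..1} F + integral {0..1} h"
    by (subst integral_add) (auto intro!: integrable_continuous_real deriv01_continuous[OF dF])
  also have "\<dots> \<le> (S - \<tau>) * M\<^sup>2 + (2 * Q + C * (n * (S - \<tau>))) * M\<^sup>2"
    using swap[OF j] ih by (simp add: F_def)
  also have "\<dots> = KS (S - \<tau>) * M\<^sup>2" by (simp add: KS_def C_def algebra_simps)
  finally show ?thesis by (simp add: F_def)
qed

text \<open>Bounds the L1 norm in time of a trace: \<open>integral_abs_le_square\<close> on an
  interval of length d, fed with \<open>KS d\<close>.\<close>

definition KW :: "real \<Rightarrow> real" where "KW d = d + KS d"

text \<open>The first summand bounds the variation of the corrected quantity \<open>Y\<close> below,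
  the number 2 in \<open>Q * 2\<close> coming from the L1 norm of the initial slice; the last
  summand bounds the correction at the two end points.\<close>

definition K1 :: "real \<Rightarrow> real \<Rightarrow> real" where
  "K1 B d = B * (n * ((2 * Q\<^sup>2 + Q) * KW d + Q * (Q * 2 + (Q + CH * n) * KW d))) + 2 * (B * (n * (Q * KW d)))"

text \<open>Along a characteristic of the \<open>j\<close>-th equation, \<open>(f j - f k) u k\<close> is, up to lower order terms, the
  derivative of \<open>\<integral> u k dt\<close>; this is where the factor \<open>a k - a j\<close> of the coupling is used.\<close>

lemma transport_L2_bound:
  assumes s: "sol \<tau> u ux ut" and S: "\<tau> \<le> S" and M0: "0 < M"
    and M: "\<And>t j. t \<in> {\<tau>..S} \<Longrightarrow> j \<in> {1..n} \<Longrightarrow> integral {0..1} (\<lambda>x. (u j (x, t))\<^sup>2) \<le> M\<^sup>2"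
    and j: "j \<in> {1..n}"
    and w: "deriv01 w (\<lambda>\<eta>. f j (\<eta>, w \<eta>))" and wI: "\<And>\<eta>. \<eta> \<in> {0..1} \<Longrightarrow> w \<eta> \<in> {\<tau>..S}"
    and E: "deriv01 E (\<lambda>\<eta>. r j (\<eta>, w \<eta>) * E \<eta>)" and EB: "\<And>\<eta>. \<eta> \<in> {0..1} \<Longrightarrow> 0 \<le> E \<eta> \<and> E \<eta> \<le> B"
    and x: "x \<in> {0..1}" "\<xi> \<in> {0..1}"
  shows "\<bar>E \<xi> * u j (\<xi>, w \<xi>) - E x * u j (x, w x)\<bar> \<le> K1 B (S - \<tau>) * M"
proof -
  let ?I = "{\<tau>..S}"
  have sub: "?I \<subseteq> {\<tau>..}" by auto
  have B0: "0 \<le> B" using EB[OF x(1)] by linarith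
  note cu = sol_continuous[OF s _ sub]
  \<comment> \<open>\<open>W k\<close> is one order smoother than \<open>u k\<close>: its
    t-derivative is \<open>u k\<close>, and the equation expresses its x-derivative
    \<open>Wx k\<close> by \<open>- f k * u k\<close> and the remainder \<open>R k\<close>, which
    contains no derivative of u.\<close>
  define W where "W = (\<lambda>k (x, s). integral {\<tau>..s} (\<lambda>r. u k (x, r)))"
  define Wx where "Wx = (\<lambda>k (x, s). integral {\<tau>..s} (\<lambda>r. ux k (x, r)))"
  define g where "g = (\<lambda>k (x, r). ft k (x, r) * u k (x, r) - H u k (x, r))"
  define R where "R = (\<lambda>k \<xi>. f k (\<xi>, \<tau>) * u k (\<xi>, \<tau>) + integral {\<tau>..w \<xi>} (\<lambda>r. g k (\<xi>, r)))"
  define N where "N = KW (S - \<tau>) * M"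
  have cuI: "continuous_on ?I (\<lambda>r. u k (x, r))" "continuous_on ?I (\<lambda>r. ux k (x, r))"
     "continuous_on ?I (\<lambda>r. ut k (x, r))" "continuous_on ?I (\<lambda>r. g k (x, r))"
     "continuous_on ?I (\<lambda>r. ft k (x, r))" "continuous_on ?I (\<lambda>r. f k (x, r))"
    if k: "k \<in> {1..n}" and x: "x \<in> {0..1}" for k x
  proof -
    note ct = continuous_on_slices(1)[OF _ x order_refl]
    show *: "continuous_on ?I (\<lambda>r. u k (x, r))" "continuous_on ?I (\<lambda>r. ux k (x, r))" "continuous_on ?I (\<lambda>r. ut k (x, r))"
      "continuous_on ?I (\<lambda>r. ft k (x, r))" "continuous_on ?I (\<lambda>r. f k (x, r))"
      by (rule ct[OF cu(1)[OF k]] ct[OF cu(2)[OF k]] ct[OF cu(3)[OF k]] ct[OF coef_continuous(2)[OF k k]] ct[OF coef_continuous(1)[OF k k]])+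
    show "continuous_on ?I (\<lambda>r. g k (x, r))"
      unfolding g_def prod.case by (intro continuous_intros * ct[OF cu(4)[OF k]])
  qed
  have L1: "integral ?I (\<lambda>r. \<bar>u k (x, r)\<bar>) \<le> N" if "k \<in> {1..n}" "x \<in> {0..1}" for k x
    using integral_abs_le_square[OF cuI(1)[OF that] M0 S trace_square_bound[OF s S M that(2,1)]]
    by (simp add: N_def KW_def)
  have N0: "0 \<le> N"
    using L1[OF j x(1)] integral_nonneg[OF integrable_continuous_real[OF continuous_on_rabs[OF cuI(1)[OF j x(1)]]]]
    by fastforce
  have part: "\<bar>integral {\<tau>..s} (\<lambda>r. v r)\<bar> \<le> integral ?I h"
    if "s \<in> ?I" "continuous_on ?I v" "continuous_on ?I h" "\<And>r. r \<in> ?I \<Longrightarrow> \<bar>v r\<bar> \<le> h r" for s and v h :: "real \<Rightarrow> real"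
  proof -
    have i: "\<bar>v r\<bar> \<le> h r" "0 \<le> h r" if "r \<in> ?I" for r using that(1) \<open>\<And>r. r \<in> ?I \<Longrightarrow> \<bar>v r\<bar> \<le> h r\<close>[OF that] by linarith+
    have ss: "{\<tau>..s} \<subseteq> ?I" using that(1) by auto
    have "norm (integral {\<tau>..s} v) \<le> integral {\<tau>..s} h"
      using i ss that(2,3)
      by (intro Henstock_Kurzweil_Integration.integral_norm_bound_integral integrable_continuous_real)
        (auto intro: continuous_on_subset)
    also have "\<dots> \<le> integral ?I h"
      using i ss that(3)
      by (intro integral_subset_le integrable_continuous_real) (auto intro: continuous_on_subset)
    finally show ?thesis by simp
  qed
  have dW: "has_cont_partials ?I (W k) (Wx k) (u k)" if k: "k \<in> {1..n}" for k
    unfolding has_cont_partials_def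
  proof (intro conjI ballI)
    show "continuous_on ({0..1} \<times> ?I) (W k)" "continuous_on ({0..1} \<times> ?I) (Wx k)"
      unfolding W_def Wx_def by (intro integral_upper_limit_continuous cu k)+
    show "continuous_on ({0..1} \<times> ?I) (u k)" by (rule cu(1)[OF k])
    fix x t assume x: "x \<in> {0..1::real}" and t: "t \<in> ?I"
    have "((\<lambda>s. integral {\<tau>..s} (\<lambda>r. u k (x, r))) has_real_derivative u k (x, t)) (at t within ?I)"
      by (rule integral_has_real_derivative[OF cuI(1)[OF k x] t])
    then show "((\<lambda>s. W k (x, s)) has_real_derivative u k (x, t)) (at t within ?I)" by (simp add: W_def)
    have "((\<lambda>x. integral (cbox \<tau> t) (\<lambda>r. u k (x, r))) has_field_derivative
        integral (cbox \<tau> t) (\<lambda>r. ux k (x, r))) (at x within {0..1})"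
    proof (rule leibniz_rule_field_derivative)
      show "((\<lambda>x. u k (x, r)) has_real_derivative ux k (x, r)) (at x within {0..1})"
        if "x \<in> {0..1}" "r \<in> cbox \<tau> t" for x r
        using has_cont_partialsD(4)[OF solD(1)[OF s k] that(1), of r] that(2) by simp
      show "(\<lambda>r. u k (x, r)) integrable_on cbox \<tau> t" if "x \<in> {0..1}" for x
        using continuous_on_subset[OF cuI(1)[OF k that], of "{\<tau>..t}"] t
        by (auto intro!: integrable_continuous_real)
      show "continuous_on ({0..1} \<times> cbox \<tau> t) (\<lambda>(x, r). ux k (x, r))"
        using sol_continuous(2)[OF s k, of "{\<tau>..t}"] by auto
    qed (use x in auto)
    then show "((\<lambda>y. W k (y, t)) has_real_derivative Wx k (x, t)) (at x within {0..1})"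
      by (simp add: W_def Wx_def)
  qed
  have Wx_eq: "Wx k (\<xi>, w \<xi>) = - f k (\<xi>, w \<xi>) * u k (\<xi>, w \<xi>) + R k \<xi>" if k: "k \<in> {1..n}" and \<xi>: "\<xi> \<in> {0..1}" for k \<xi>
  proof -
    let ?J = "{\<tau>..w \<xi>}"
    have J: "?J \<subseteq> ?I" "?J \<subseteq> {\<tau>..}" "\<tau> \<le> w \<xi>" using wI[OF \<xi>] by auto
    note cJ = cuI[OF k \<xi>, THEN continuous_on_subset, OF J(1)]
    define P where "P = (\<lambda>t. f k (\<xi>, t) * u k (\<xi>, t))"
    define P' where "P' = (\<lambda>t. ft k (\<xi>, t) * u k (\<xi>, t) + f k (\<xi>, t) * ut k (\<xi>, t))"
    have "(P' has_integral P (w \<xi>) - P \<tau>) ?J"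
    proof (rule fundamental_theorem_of_calculus[OF J(3)])
      fix t assume t: "t \<in> ?J"
      have "((\<lambda>t. u k (\<xi>, t)) has_real_derivative ut k (\<xi>, t)) (at t within ?J)"
        by (rule DERIV_subset[OF has_cont_partialsD(5)[OF solD(1)[OF s k] \<xi>] J(2)]) (use t in auto)
      moreover have "((\<lambda>t. f k (\<xi>, t)) has_real_derivative ft k (\<xi>, t)) (at t within ?J)"
        using bc1_deriv_t[OF f[OF k] \<xi>] by (rule has_field_derivative_at_within)
      ultimately have "(P has_real_derivative P' t) (at t within ?J)"
        unfolding P_def P'_def by (auto intro!: derivative_eq_intros)
      then show "(P has_vector_derivative P' t) (at t within ?J)"
        by (simp add: has_real_derivative_iff_has_vector_derivative)
    qed
    then have iP: "integral ?J P' = P (w \<xi>) - P \<tau>" by (rule integral_unique)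
    have "Wx k (\<xi>, w \<xi>) = integral ?J (\<lambda>t. g k (\<xi>, t) - P' t)"
      unfolding Wx_def prod.case
    proof (rule integral_cong)
      fix t assume "t \<in> ?J"
      then have "ux k (\<xi>, t) = - f k (\<xi>, t) * ut k (\<xi>, t) - H u k (\<xi>, t)"
        by (intro solD(2)[OF s k \<xi>]) auto
      then show "ux k (\<xi>, t) = g k (\<xi>, t) - P' t" by (simp add: g_def P'_def)
    qed
    also have "\<dots> = integral ?J (\<lambda>t. g k (\<xi>, t)) - (P (w \<xi>) - P \<tau>)"
      unfolding iP[symmetric] P'_def
      by (intro integral_diff integrable_continuous_real continuous_intros cJ)
    finally show ?thesis by (simp add: R_def P_def)
  qed
  have Rb: "\<bar>R k \<xi>\<bar> \<le> Q * \<bar>u k (\<xi>, \<tau>)\<bar> + (Q + CH * n) * N" if k: "k \<in> {1..n}" and \<xi>: "\<xi> \<in> {0..1}" for k \<xi>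
  proof -
    have a: "\<bar>f k (\<xi>, \<tau>) * u k (\<xi>, \<tau>)\<bar> \<le> Q * \<bar>u k (\<xi>, \<tau>)\<bar>"
      unfolding abs_mult using coef_bounds(1)[OF \<xi> k k] by (intro mult_right_mono) auto
    have "\<bar>integral {\<tau>..w \<xi>} (\<lambda>r. g k (\<xi>, r))\<bar> \<le> integral ?I (\<lambda>r. Q * \<bar>u k (\<xi>, r)\<bar> + CH * (\<Sum>l=1..n. \<bar>u l (\<xi>, r)\<bar>))"
    proof (rule part[OF wI[OF \<xi>] cuI(4)[OF k \<xi>]])
      show "continuous_on ?I (\<lambda>r. Q * \<bar>u k (\<xi>, r)\<bar> + CH * (\<Sum>l=1..n. \<bar>u l (\<xi>, r)\<bar>))"
        by (intro continuous_intros cuI(1)[OF _ \<xi>] k) auto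
      fix t assume "t \<in> ?I"
      have "\<bar>ft k (\<xi>, t) * u k (\<xi>, t)\<bar> \<le> Q * \<bar>u k (\<xi>, t)\<bar>"
        unfolding abs_mult using coef_bounds(3)[OF \<xi> k k] by (intro mult_right_mono) auto
      then show "\<bar>g k (\<xi>, t)\<bar> \<le> Q * \<bar>u k (\<xi>, t)\<bar> + CH * (\<Sum>l=1..n. \<bar>u l (\<xi>, t)\<bar>)"
        using H_bound[OF \<xi> k, of u t] unfolding g_def by (auto simp: abs_le_iff)
    qed
    also have "\<dots> = Q * integral ?I (\<lambda>r. \<bar>u k (\<xi>, r)\<bar>) + CH * (\<Sum>l=1..n. integral ?I (\<lambda>r. \<bar>u l (\<xi>, r)\<bar>))"
    proof -
      have "integral ?I (\<lambda>r. \<Sum>l=1..n. \<bar>u l (\<xi>, r)\<bar>) = (\<Sum>l=1..n. integral ?I (\<lambda>r. \<bar>u l (\<xi>, r)\<bar>))"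
        by (intro integral_sum integrable_continuous_real continuous_intros cuI(1)[OF _ \<xi>]) auto
      then show ?thesis
        by (subst integral_add; (intro integrable_continuous_real continuous_intros cuI(1)[OF _ \<xi>] k)?; simp)
    qed
    also have "\<dots> \<le> Q * N + CH * (\<Sum>l=1..n. N)"
      by (intro add_mono mult_left_mono sum_mono L1[OF _ \<xi>] k Q0 CH0)
    finally show ?thesis using a unfolding R_def by (simp add: algebra_simps abs_le_iff)
  qed
  have Wb: "\<bar>W k (\<xi>, w \<xi>)\<bar> \<le> N" if k: "k \<in> {1..n}" and \<xi>: "\<xi> \<in> {0..1}" for k \<xi>
    using part[OF wI[OF \<xi>] cuI(1)[OF k \<xi>] continuous_on_rabs[OF cuI(1)[OF k \<xi>]] order_refl] L1[OF k \<xi>]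
    by (simp add: W_def)
  have dU: "deriv01 (\<lambda>\<xi>. u j (\<xi>, w \<xi>)) (\<lambda>\<xi>. - H u j (\<xi>, w \<xi>))"
    using has_cont_partials_chain[OF solD(1)[OF s j] w] wI solD(2)[OF s j]
    by (auto simp: deriv01_def algebra_simps)
  \<comment> \<open>The t-direction of the j-th characteristic contributes \<open>f j * u k\<close>,
    the x-derivative of \<open>W k\<close> contributes \<open>- f k * u k\<close>. Up to the factor
    \<kappa> and the remainder \<open>R k\<close>, their sum is the coupling term of the j-th
    equation.\<close>
  have dWw: "deriv01 (\<lambda>\<xi>. W k (\<xi>, w \<xi>)) (\<lambda>\<xi>. (f j (\<xi>, w \<xi>) - f k (\<xi>, w \<xi>)) * u k (\<xi>, w \<xi>) + R k \<xi>)" if k: "k \<in> {1..n}" for k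
    using has_cont_partials_chain[OF dW[OF k] w _ wI] Wx_eq[OF k]
    by (auto simp: deriv01_def algebra_simps)
  define \<kappa>' where "\<kappa>' = (\<lambda>k \<xi>. \<kappa>x j k (\<xi>, w \<xi>) + \<kappa>t j k (\<xi>, w \<xi>) * f j (\<xi>, w \<xi>))"
  have d\<kappa>: "deriv01 (\<lambda>\<xi>. \<kappa> j k (\<xi>, w \<xi>)) (\<kappa>' k)" if k: "k \<in> {1..n}" for k
    using has_cont_partials_chain[of UNIV, OF _ w] \<kappa>[OF j k] unfolding \<kappa>'_def by (auto simp: bc1_def)
  \<comment> \<open>Adding \<kappa> W cancels the coupling in the derivative of \<open>u j\<close>,
    and the weight \<open>E\<close> cancels the term with \<open>r j\<close>; what remains in
    \<open>Y'\<close> involves only \<open>W\<close> and \<open>R\<close>.\<close>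
  define Y where "Y = (\<lambda>\<xi>. E \<xi> * (u j (\<xi>, w \<xi>) + (\<Sum>k=1..n. \<kappa> j k (\<xi>, w \<xi>) * W k (\<xi>, w \<xi>))))"
  define Y' where "Y' = (\<lambda>\<xi>. E \<xi> * (\<Sum>k=1..n. (r j (\<xi>, w \<xi>) * \<kappa> j k (\<xi>, w \<xi>) + \<kappa>' k \<xi>) * W k (\<xi>, w \<xi>) + \<kappa> j k (\<xi>, w \<xi>) * R k \<xi>))"
  have dY: "deriv01 Y Y'"
    unfolding deriv01_def
  proof
    fix \<xi> :: real assume \<xi>: "\<xi> \<in> {0..1}"
    let ?F = "at \<xi> within {0..1}"
    have "((\<lambda>\<xi>. \<Sum>k=1..n. \<kappa> j k (\<xi>, w \<xi>) * W k (\<xi>, w \<xi>)) has_real_derivative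
      (\<Sum>k=1..n. \<kappa>' k \<xi> * W k (\<xi>, w \<xi>) + ((f j (\<xi>, w \<xi>) - f k (\<xi>, w \<xi>)) * u k (\<xi>, w \<xi>) + R k \<xi>) * \<kappa> j k (\<xi>, w \<xi>))) ?F"
      by (intro DERIV_sum DERIV_mult deriv01D[OF d\<kappa> \<xi>] deriv01D[OF dWw \<xi>])
    note DERIV_mult[OF deriv01D[OF E \<xi>] DERIV_add[OF deriv01D[OF dU \<xi>] this]]
    then show "(Y has_real_derivative Y' \<xi>) ?F"
      unfolding Y_def
      by (rule DERIV_cong) (simp add: Y'_def H_def sum.distrib sum_distrib_left sum_distrib_right sum_subtractf algebra_simps)
  qed
  \<comment> \<open>The initial slice enters pointwise in \<xi> but is controlled only in the mean,
    so the bound for \<open>Y'\<close> is kept as a function and integrated.\<close>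
  define h where "h = (\<lambda>\<xi>. B * (\<Sum>k=1..n. (2 * Q\<^sup>2 + Q) * N + Q * (Q * \<bar>u k (\<xi>, \<tau>)\<bar> + (Q + CH * n) * N)))"
  have c\<tau>: "continuous_on {0..1} (\<lambda>\<xi>. u k (\<xi>, \<tau>))" if "k \<in> {1..n}" for k
    by (rule continuous_on_slices(2)[OF cu(1)[OF that]]) (use S in auto)
  have ch: "continuous_on {0..1} h" unfolding h_def by (intro continuous_intros c\<tau>) auto
  have Y'h: "\<bar>Y' \<xi>\<bar> \<le> h \<xi>" if \<xi>: "\<xi> \<in> {0..1}" for \<xi>
    unfolding Y'_def h_def abs_mult
  proof (intro mult_mono order_trans[OF sum_abs] sum_mono)
    fix k assume k: "k \<in> {1..n}"
    have "\<bar>r j (\<xi>, w \<xi>) * \<kappa> j k (\<xi>, w \<xi>) + \<kappa>' k \<xi>\<bar> \<le> \<bar>r j (\<xi>, w \<xi>)\<bar> * \<bar>\<kappa> j k (\<xi>, w \<xi>)\<bar> + (\<bar>\<kappa>x j k (\<xi>, w \<xi>)\<bar> + \<bar>\<kappa>t j k (\<xi>, w \<xi>)\<bar> * \<bar>f j (\<xi>, w \<xi>)\<bar>)"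
      unfolding \<kappa>'_def abs_mult[symmetric] by linarith
    also have "\<dots> \<le> Q * Q + (Q + Q * Q)"
      using coef_bounds[OF \<xi> j k] Q0 by (intro add_mono mult_mono) auto
    finally have "\<bar>r j (\<xi>, w \<xi>) * \<kappa> j k (\<xi>, w \<xi>) + \<kappa>' k \<xi>\<bar> * \<bar>W k (\<xi>, w \<xi>)\<bar> \<le> (2 * Q\<^sup>2 + Q) * N"
      using Wb[OF k \<xi>] Q0 by (intro mult_mono) (auto simp: power2_eq_square)
    moreover have "\<bar>\<kappa> j k (\<xi>, w \<xi>)\<bar> * \<bar>R k \<xi>\<bar> \<le> Q * (Q * \<bar>u k (\<xi>, \<tau>)\<bar> + (Q + CH * n) * N)"
      using coef_bounds(7)[OF \<xi> j k] Rb[OF k \<xi>] Q0 by (intro mult_mono) auto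
    ultimately show "\<bar>(r j (\<xi>, w \<xi>) * \<kappa> j k (\<xi>, w \<xi>) + \<kappa>' k \<xi>) * W k (\<xi>, w \<xi>) + \<kappa> j k (\<xi>, w \<xi>) * R k \<xi>\<bar>
        \<le> (2 * Q\<^sup>2 + Q) * N + Q * (Q * \<bar>u k (\<xi>, \<tau>)\<bar> + (Q + CH * n) * N)"
      unfolding abs_mult[symmetric] by linarith
  qed (use EB[OF \<xi>] B0 in auto)
  have "integral {0..1} h \<le> B * (n * ((2 * Q\<^sup>2 + Q) * N + Q * (Q * (2 * M) + (Q + CH * n) * N)))"
  proof -
    have i: "integral {0..1} (\<lambda>\<xi>. (2 * Q\<^sup>2 + Q) * N + Q * (Q * \<bar>u k (\<xi>, \<tau>)\<bar> + (Q + CH * n) * N))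
        \<le> (2 * Q\<^sup>2 + Q) * N + Q * (Q * (2 * M) + (Q + CH * n) * N)" if k: "k \<in> {1..n}" for k
    proof -
      have "integral {0..1} (\<lambda>\<xi>. \<bar>u k (\<xi>, \<tau>)\<bar>) \<le> 2 * M"
        using integral_abs_le_square[OF c\<tau>[OF k] M0 _ M[OF _ k, of \<tau>, THEN order_trans], of 1] S by simp
      moreover have "integral {0..1} (\<lambda>\<xi>. (2 * Q\<^sup>2 + Q) * N + Q * (Q * \<bar>u k (\<xi>, \<tau>)\<bar> + (Q + CH * n) * N))
        = (2 * Q\<^sup>2 + Q) * N + Q * (Q * integral {0..1} (\<lambda>\<xi>. \<bar>u k (\<xi>, \<tau>)\<bar>) + (Q + CH * n) * N)"
        by (subst integral_add, (intro integrable_continuous_real continuous_intros c\<tau> k)+, simp,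
            subst integral_add, (intro integrable_continuous_real continuous_intros c\<tau> k)+, simp)
      ultimately show ?thesis using Q0 by (auto intro!: mult_left_mono)
    qed
    have "integral {0..1} h = B * (\<Sum>k=1..n. integral {0..1} (\<lambda>\<xi>. (2 * Q\<^sup>2 + Q) * N + Q * (Q * \<bar>u k (\<xi>, \<tau>)\<bar> + (Q + CH * n) * N)))"
      unfolding h_def by (simp, subst integral_sum, simp, intro integrable_continuous_real continuous_intros c\<tau>) auto
    also have "\<dots> \<le> B * (\<Sum>k=1..n. (2 * Q\<^sup>2 + Q) * N + Q * (Q * (2 * M) + (Q + CH * n) * N))"
      by (intro mult_left_mono sum_mono i B0)
    finally show ?thesis by simp
  qed
  then have Yd: "\<bar>Y \<xi> - Y x\<bar> \<le> B * (n * ((2 * Q\<^sup>2 + Q) * N + Q * (Q * (2 * M) + (Q + CH * n) * N)))"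
    using deriv01_bound_integral[OF dY Y'h ch x] by linarith
  have Z: "\<bar>E \<xi> * (\<Sum>k=1..n. \<kappa> j k (\<xi>, w \<xi>) * W k (\<xi>, w \<xi>))\<bar> \<le> B * (n * (Q * N))" if \<xi>: "\<xi> \<in> {0..1}" for \<xi>
  proof -
    have "\<bar>\<Sum>k=1..n. \<kappa> j k (\<xi>, w \<xi>) * W k (\<xi>, w \<xi>)\<bar> \<le> (\<Sum>k=1..n. Q * N)"
      using coef_bounds(7)[OF \<xi> j] Wb[OF _ \<xi>] Q0
      by (intro order_trans[OF sum_abs] sum_mono) (auto simp: abs_mult intro!: mult_mono)
    then show ?thesis unfolding abs_mult using EB[OF \<xi>] B0 by (intro mult_mono) auto
  qed
  have "E \<xi> * u j (\<xi>, w \<xi>) - E x * u j (x, w x) = (Y \<xi> - Y x) - E \<xi> * (\<Sum>k=1..n. \<kappa> j k (\<xi>, w \<xi>) * W k (\<xi>, w \<xi>))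
      + E x * (\<Sum>k=1..n. \<kappa> j k (x, w x) * W k (x, w x))"
    by (simp add: Y_def algebra_simps)
  then have "\<bar>E \<xi> * u j (\<xi>, w \<xi>) - E x * u j (x, w x)\<bar>
     \<le> B * (n * ((2 * Q\<^sup>2 + Q) * N + Q * (Q * (2 * M) + (Q + CH * n) * N))) + 2 * (B * (n * (Q * N)))"
    using Yd Z[OF x(1)] Z[OF x(2)] by linarith
  also have "\<dots> = K1 B (S - \<tau>) * M" by (simp add: K1_def N_def algebra_simps)
  finally show ?thesis .
qed

end

text \<open>The time derivative of a solution that is only once differentiable still satisfies the differentiated
  transport equation along characteristics: pass to the limit in the equation for difference quotients.\<close>

lemma transport_time_derivative:
  assumes v: "has_cont_partials {\<tau>..} v vx vt" and f: "bc1 Q f fx ft"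
    and eq: "\<And>x t. x \<in> {0..1} \<Longrightarrow> \<tau> \<le> t \<Longrightarrow> vx (x, t) = - f (x, t) * vt (x, t) - G (x, t)"
    and G: "\<And>x t. x \<in> {0..1} \<Longrightarrow> \<tau> \<le> t \<Longrightarrow> ((\<lambda>s. G (x, s)) has_real_derivative Gt (x, t)) (at t within {\<tau>..})"
    and cG: "continuous_on ({0..1} \<times> {\<tau>..}) G" "continuous_on ({0..1} \<times> {\<tau>..}) Gt"
    and w: "deriv01 w (\<lambda>\<eta>. f (\<eta>, w \<eta>))" and w\<tau>: "\<And>\<eta>. \<eta> \<in> {0..1} \<Longrightarrow> \<tau> \<le> w \<eta>"
  shows "deriv01 (\<lambda>\<xi>. vt (\<xi>, w \<xi>)) (\<lambda>\<xi>. - ft (\<xi>, w \<xi>) * vt (\<xi>, w \<xi>) - Gt (\<xi>, w \<xi>))"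
proof -
  \<comment> \<open>Forward shifts only, so that the shifted curve stays in the domain t \<ge>
    \<tau>; being at most one, they also keep it below \<open>S + 1\<close>.\<close>
  define s where "s = (\<lambda>i::nat. inverse (real (Suc i)))"
  have s0: "0 < s i" "s i \<le> 1" for i by (auto simp: s_def field_simps)
  have slim: "s \<longlonglongrightarrow> 0" unfolding s_def by (rule LIMSEQ_inverse_real_of_nat)
  have wc: "continuous_on {0..1} w" by (rule deriv01_continuous[OF w])
  have "bounded (w ` {0..1})"
    by (rule compact_imp_bounded[OF compact_continuous_image[OF wc compact_Icc]])
  then obtain S where "\<forall>y\<in>w ` {0..1}. norm y \<le> S" unfolding bounded_iff by blast
  then have S: "w \<eta> \<le> S" if "\<eta> \<in> {0..1}" for \<eta> using that by (simp add: abs_le_iff)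
  let ?K = "{0..1} \<times> {\<tau>..S + 1}"
  have sub: "?K \<subseteq> {0..1} \<times> {\<tau>..}" by auto
  have bdd: "\<exists>C. \<forall>z\<in>?K. \<bar>g z\<bar> \<le> C" if "continuous_on ({0..1} \<times> {\<tau>..}) g" for g :: "real \<times> real \<Rightarrow> real"
    using compact_imp_bounded[OF compact_continuous_image[OF continuous_on_subset[OF that sub] compact_Times[OF compact_Icc compact_Icc]]]
    by (auto simp: bounded_iff)
  obtain Bv where Bv: "\<And>z. z \<in> ?K \<Longrightarrow> \<bar>vt z\<bar> \<le> Bv" using bdd[OF has_cont_partialsD(3)[OF v]] by blast
  obtain Bg where Bg: "\<And>z. z \<in> ?K \<Longrightarrow> \<bar>Gt z\<bar> \<le> Bg" using bdd[OF cG(2)] by blast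
  have Q0: "0 \<le> Q" by (rule bc1_nonneg[OF f])
  have mem: "(\<xi>, w \<xi> + s i) \<in> ?K" "(\<xi>, w \<xi>) \<in> ?K" if "\<xi> \<in> {0..1}" for \<xi> i
    using w\<tau>[OF that] S[OF that] s0[of i] that by auto
  have cs: "continuous_on {0..1} (\<lambda>\<xi>. g (\<xi>, w \<xi> + s i))" "continuous_on {0..1} (\<lambda>\<xi>. g (\<xi>, w \<xi>))"
    if "continuous_on ({0..1} \<times> {\<tau>..}) g" for g :: "real \<times> real \<Rightarrow> real" and i
    using mem by (intro continuous_on_curve[OF that] continuous_intros wc; force)+
  define q where "q = (\<lambda>i \<xi>. (v (\<xi>, w \<xi> + s i) - v (\<xi>, w \<xi>)) / s i)"
  \<comment> \<open>The shifted curve is not a characteristic. The mismatch of \<open>f\<close>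
    along it multiplies \<open>vt\<close> and, divided by the shift, becomes the term with
    \<open>ft\<close> in the limit.\<close>
  define g where "g = (\<lambda>i \<xi>. ((f (\<xi>, w \<xi>) - f (\<xi>, w \<xi> + s i)) * vt (\<xi>, w \<xi> + s i) - (G (\<xi>, w \<xi> + s i) - G (\<xi>, w \<xi>))) / s i)"
  define N where "N = (\<lambda>\<xi>. - ft (\<xi>, w \<xi>) * vt (\<xi>, w \<xi>) - Gt (\<xi>, w \<xi>))"
  have cf: "continuous_on ({0..1} \<times> {\<tau>..}) f" "continuous_on ({0..1} \<times> {\<tau>..}) ft"
    using bc1_continuous[OF f] by (auto intro: continuous_on_subset simp: strip_def)
  have cN: "continuous_on {0..1} N"
    unfolding N_def by (intro continuous_intros cs cf has_cont_partialsD(3)[OF v] cG)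
  have dq: "deriv01 (q i) (g i)" for i
    unfolding deriv01_def
  proof
    fix \<xi> :: real assume \<xi>: "\<xi> \<in> {0..1}"
    have ws: "deriv01 (\<lambda>\<eta>. w \<eta> + s i) (\<lambda>\<eta>. f (\<eta>, w \<eta>))"
      using w by (auto simp: deriv01_def intro!: derivative_eq_intros)
    have d1: "deriv01 (\<lambda>\<xi>. v (\<xi>, w \<xi> + s i)) (\<lambda>\<xi>. vx (\<xi>, w \<xi> + s i) + vt (\<xi>, w \<xi> + s i) * f (\<xi>, w \<xi>))"
      by (rule has_cont_partials_chain[OF v ws]) (use mem in auto)
    have d2: "deriv01 (\<lambda>\<xi>. v (\<xi>, w \<xi>)) (\<lambda>\<xi>. vx (\<xi>, w \<xi>) + vt (\<xi>, w \<xi>) * f (\<xi>, w \<xi>))"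
      by (rule has_cont_partials_chain[OF v w]) (use w\<tau> in auto)
    have e: "vx (\<xi>, w \<xi> + s i) = - f (\<xi>, w \<xi> + s i) * vt (\<xi>, w \<xi> + s i) - G (\<xi>, w \<xi> + s i)"
      "vx (\<xi>, w \<xi>) = - f (\<xi>, w \<xi>) * vt (\<xi>, w \<xi>) - G (\<xi>, w \<xi>)"
      using eq[OF \<xi>] mem[OF \<xi>] by auto
    show "(q i has_real_derivative g i \<xi>) (at \<xi> within {0..1})"
      unfolding q_def
      by (rule DERIV_cong[OF DERIV_cdivide[OF DERIV_diff[OF deriv01D[OF d1 \<xi>] deriv01D[OF d2 \<xi>]]]])
        (simp only: g_def e, simp add: algebra_simps)
  qed
  have diffquot: "(\<lambda>i. (h (\<xi>, w \<xi> + s i) - h (\<xi>, w \<xi>)) / s i) \<longlonglongrightarrow> h'"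
    if "((\<lambda>r. h (\<xi>, r)) has_real_derivative h') (at (w \<xi>) within {\<tau>..})" and \<xi>: "\<xi> \<in> {0..1}" for h :: "real \<times> real \<Rightarrow> real" and h' \<xi>
  proof -
    have "(\<lambda>i. w \<xi> + s i) \<longlonglongrightarrow> w \<xi>" using tendsto_add[OF tendsto_const slim, of "w \<xi>"] by simp
    moreover have "\<forall>i. w \<xi> + s i \<in> {\<tau>..} - {w \<xi>}" 
    proof
      fix i show "w \<xi> + s i \<in> {\<tau>..} - {w \<xi>}" using s0(1)[of i] w\<tau>[OF \<xi>] by simp
    qed
    ultimately show ?thesis
      using that(1)[unfolded has_field_derivative_iff tendsto_at_iff_sequentially, rule_format, of "\<lambda>i. w \<xi> + s i"]
      by (simp add: o_def)
  qed
  have cont: "continuous_on {0..1} (g i)" for i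
    unfolding g_def using s0(1)[of i]
    by (intro continuous_intros cs cf has_cont_partialsD(3)[OF v] cG) auto
  have bound: "\<bar>g i \<xi>\<bar> \<le> Q * Bv + Bg" if \<xi>: "\<xi> \<in> {0..1}" for i \<xi>
  proof -
    have "\<bar>f (\<xi>, w \<xi>) - f (\<xi>, w \<xi> + s i)\<bar> \<le> Q * s i"
      using bc1_lipschitz[OF f \<xi>, of "w \<xi>" "w \<xi> + s i"] s0(1)[of i] by simp
    then have "\<bar>(f (\<xi>, w \<xi>) - f (\<xi>, w \<xi> + s i)) * vt (\<xi>, w \<xi> + s i)\<bar> \<le> (Q * s i) * Bv"
      unfolding abs_mult using Bv[OF mem(1)[OF \<xi>]] Q0 s0(1)[of i] by (intro mult_mono) auto
    moreover have "\<bar>G (\<xi>, w \<xi> + s i) - G (\<xi>, w \<xi>)\<bar> \<le> Bg * s i"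
    proof -
      have "norm (G (\<xi>, w \<xi> + s i) - G (\<xi>, w \<xi>)) \<le> Bg * norm (w \<xi> + s i - w \<xi>)"
      proof (rule field_differentiable_bound[of "{\<tau>..S+1}" "\<lambda>r. G (\<xi>, r)" "\<lambda>r. Gt (\<xi>, r)"])
        show "((\<lambda>r. G (\<xi>, r)) has_real_derivative Gt (\<xi>, z)) (at z within {\<tau>..S + 1})" if "z \<in> {\<tau>..S + 1}" for z
          by (rule DERIV_subset[OF G[OF \<xi>]]) (use that in auto)
      qed (use Bg mem[OF \<xi>] \<xi> in auto)
      then show ?thesis using s0(1)[of i] by simp
    qed
    ultimately have "\<bar>(f (\<xi>, w \<xi>) - f (\<xi>, w \<xi> + s i)) * vt (\<xi>, w \<xi> + s i) - (G (\<xi>, w \<xi> + s i) - G (\<xi>, w \<xi>))\<bar> \<le> (Q * Bv + Bg) * s i"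
      by (simp add: algebra_simps abs_le_iff)
    then show ?thesis unfolding g_def abs_divide using s0(1)[of i] by (simp add: divide_le_eq)
  qed
  have lim: "(\<lambda>i. g i \<xi>) \<longlonglongrightarrow> N \<xi>" if \<xi>: "\<xi> \<in> {0..1}" for \<xi>
  proof -
    have "((\<lambda>r. f (\<xi>, r)) has_real_derivative ft (\<xi>, w \<xi>)) (at (w \<xi>) within {\<tau>..})"
      using bc1_deriv_t[OF f \<xi>] by (rule has_field_derivative_at_within)
    then have l1: "(\<lambda>i. (f (\<xi>, w \<xi> + s i) - f (\<xi>, w \<xi>)) / s i) \<longlonglongrightarrow> ft (\<xi>, w \<xi>)"
      using \<xi> by (rule diffquot)
    have l2: "(\<lambda>i. (G (\<xi>, w \<xi> + s i) - G (\<xi>, w \<xi>)) / s i) \<longlonglongrightarrow> Gt (\<xi>, w \<xi>)"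
      by (rule diffquot[OF G[OF \<xi> w\<tau>[OF \<xi>]] \<xi>])
    have "(\<lambda>i. w \<xi> + s i) \<longlonglongrightarrow> w \<xi>" using tendsto_add[OF tendsto_const slim, of "w \<xi>"] by simp
    then have l3: "(\<lambda>i. vt (\<xi>, w \<xi> + s i)) \<longlonglongrightarrow> vt (\<xi>, w \<xi>)"
      by (intro continuous_on_tendsto_compose[OF has_cont_partialsD(3)[OF v]] tendsto_intros)
        (use mem[OF \<xi>] sub in auto)
    have "(\<lambda>i. - ((f (\<xi>, w \<xi> + s i) - f (\<xi>, w \<xi>)) / s i) * vt (\<xi>, w \<xi> + s i) - (G (\<xi>, w \<xi> + s i) - G (\<xi>, w \<xi>)) / s i) \<longlonglongrightarrow> N \<xi>"
      unfolding N_def by (intro tendsto_intros l1 l2 l3)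
    moreover have "- ((f (\<xi>, w \<xi> + s i) - f (\<xi>, w \<xi>)) / s i) * vt (\<xi>, w \<xi> + s i) - (G (\<xi>, w \<xi> + s i) - G (\<xi>, w \<xi>)) / s i = g i \<xi>" for i
      using s0(1)[of i] by (simp add: g_def field_simps)
    ultimately show ?thesis by simp
  qed
  \<comment> \<open>The derivatives \<open>g i\<close> converge boundedly and pointwise, so the
    limit is taken in the integrated identity; continuity of \<open>N\<close> then returns the
    derivative.\<close>
  have eqI: "vt (\<xi>, w \<xi>) - vt (0, w 0) = integral {0..\<xi>} N" if \<xi>: "\<xi> \<in> {0..1}" for \<xi>
  proof -
    have q0: "(\<lambda>i. q i \<zeta>) \<longlonglongrightarrow> vt (\<zeta>, w \<zeta>)" if "\<zeta> \<in> {0..1}" for \<zeta>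
      unfolding q_def by (rule diffquot[OF has_cont_partialsD(5)[OF v that] that]) (use w\<tau>[OF that] in auto)
    have z: "(0::real) \<in> {0..1}" by simp
    have "(\<lambda>i. integral {0..\<xi>} (g i)) \<longlonglongrightarrow> integral {0..\<xi>} N"
      by (rule dominated_convergence_bounded[of 0 \<xi> g "Q * Bv + Bg"])
        (use \<xi> bound lim in \<open>auto intro: continuous_on_subset[OF cont]\<close>)
    moreover have "integral {0..\<xi>} (g i) = q i \<xi> - q i 0" for i
      using deriv01_unique[OF deriv01_integral[OF cont, of i 0] dq z \<xi>] by simp
    ultimately have "(\<lambda>i. q i \<xi> - q i 0) \<longlonglongrightarrow> integral {0..\<xi>} N" by simp
    then show ?thesis
      using LIMSEQ_unique[OF tendsto_diff[OF q0[OF \<xi>] q0[OF z]]] by simp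
  qed
  show ?thesis
    unfolding deriv01_def N_def[symmetric, THEN fun_cong]
  proof
    fix \<xi> :: real assume \<xi>: "\<xi> \<in> {0..1}"
    have "((\<lambda>\<xi>. integral {0..\<xi>} N - (- vt (0, w 0))) has_real_derivative N \<xi>) (at \<xi> within {0..1})"
      by (rule deriv01D[OF deriv01_integral[OF cN] \<xi>])
    then show "((\<lambda>\<xi>. vt (\<xi>, w \<xi>)) has_real_derivative N \<xi>) (at \<xi> within {0..1})"
      by (rule has_field_derivative_transform_within[OF _ zero_less_one \<xi>]) (use eqI in \<open>force\<close>)
  qed
qed

section \<open>The time derivative along characteristics\<close>

context hyp_system
begin

definition Ht :: "(nat \<Rightarrow> real \<times> real \<Rightarrow> real) \<Rightarrow> (nat \<Rightarrow> real \<times> real \<Rightarrow> real) \<Rightarrow> nat \<Rightarrow> real \<times> real \<Rightarrow> real" where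
  "Ht u ut j z = rt j z * u j z + r j z * ut j z + (\<Sum>k=1..n.
     (\<kappa>t j k z * (f j z - f k z) + \<kappa> j k z * (ft j z - ft k z)) * u k z + \<kappa> j k z * (f j z - f k z) * ut k z)"

lemma H_deriv_t:
  assumes s: "sol \<tau> u ux ut" and j: "j \<in> {1..n}" and x: "x \<in> {0..1}" and t: "\<tau> \<le> t"
  shows "((\<lambda>s. H u j (x, s)) has_real_derivative Ht u ut j (x, t)) (at t within {\<tau>..})"
proof -
  let ?F = "at t within {\<tau>..}"
  have u: "((\<lambda>s. u k (x, s)) has_real_derivative ut k (x, t)) ?F" if "k \<in> {1..n}" for k
    by (rule has_cont_partialsD(5)[OF solD(1)[OF s that] x]) (use t in auto)
  note c = bc1_deriv_t[OF _ x, THEN has_field_derivative_at_within]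
  have "((\<lambda>s. \<Sum>k=1..n. \<kappa> j k (x, s) * (f j (x, s) - f k (x, s)) * u k (x, s)) has_real_derivative
     (\<Sum>k=1..n. (\<kappa>t j k (x, t) * (f j (x, t) - f k (x, t)) + (ft j (x, t) - ft k (x, t)) * \<kappa> j k (x, t)) * u k (x, t)
       + ut k (x, t) * (\<kappa> j k (x, t) * (f j (x, t) - f k (x, t))))) ?F"
    by (intro DERIV_sum DERIV_mult DERIV_diff u c[OF f] c[OF \<kappa>] j)
  from DERIV_add[OF DERIV_mult[OF c[OF r[OF j]] u[OF j]] this]
  show ?thesis
    unfolding H_def by (rule DERIV_cong) (simp add: Ht_def algebra_simps)
qed

lemma Ht_continuous:
  assumes s: "sol \<tau> u ux ut" and j: "j \<in> {1..n}"
  shows "continuous_on ({0..1} \<times> {\<tau>..}) (Ht u ut j)"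
  unfolding Ht_def
  by (intro continuous_intros coef_continuous(1-4)[OF _ j] coef_continuous(5-7)[OF j] sol_continuous[OF s] j order_refl; simp)

text \<open>The coefficient 7 is 2 + 1 + 4: two from the weight, one from the derivative of \<kappa>
  along the curve, four from the time derivative of the coupling coefficient. The last summand
  bounds the correction at the two end points.\<close>

definition K2 :: "real \<Rightarrow> real" where
  "K2 B = B * (Q + n * (7 * Q\<^sup>2 + Q + Q * (CH * n))) + 2 * (B * (n * Q))"

text \<open>Here \<open>(f j - f k) \<partial>\<^sub>t u k\<close> is, up to lower order terms, the derivative of \<open>u k\<close> along the
  \<open>j\<close>-th characteristic.\<close>

lemma transport_derivative_bound:
  assumes s: "sol \<tau> u ux ut" and j: "j \<in> {1..n}"
    and w: "deriv01 w (\<lambda>\<eta>. f j (\<eta>, w \<eta>))" and w\<tau>: "\<And>\<eta>. \<eta> \<in> {0..1} \<Longrightarrow> \<tau> \<le> w \<eta>"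
    and M: "\<And>\<eta> l. \<eta> \<in> {0..1} \<Longrightarrow> l \<in> {1..n} \<Longrightarrow> \<bar>u l (\<eta>, w \<eta>)\<bar> \<le> M"
    and E: "deriv01 E (\<lambda>\<eta>. (r j (\<eta>, w \<eta>) + ft j (\<eta>, w \<eta>)) * E \<eta>)" and EB: "\<And>\<eta>. \<eta> \<in> {0..1} \<Longrightarrow> 0 \<le> E \<eta> \<and> E \<eta> \<le> B"
    and x: "x \<in> {0..1}" "\<xi> \<in> {0..1}"
  shows "\<bar>E \<xi> * ut j (\<xi>, w \<xi>) - E x * ut j (x, w x)\<bar> \<le> K2 B * M"
proof -
  have B0: "0 \<le> B" using EB[OF x(1)] by linarith
  have M0: "0 \<le> M" using M[OF x(1) j] by linarith
  have dV: "deriv01 (\<lambda>\<xi>. ut j (\<xi>, w \<xi>)) (\<lambda>\<xi>. - ft j (\<xi>, w \<xi>) * ut j (\<xi>, w \<xi>) - Ht u ut j (\<xi>, w \<xi>))"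
    by (rule transport_time_derivative[OF solD(1)[OF s j] f[OF j] solD(2)[OF s j] H_deriv_t[OF s j]
       sol_continuous(4)[OF s j order_refl] Ht_continuous[OF s j] w w\<tau>])
  have du: "deriv01 (\<lambda>\<xi>. u k (\<xi>, w \<xi>)) (\<lambda>\<xi>. (f j (\<xi>, w \<xi>) - f k (\<xi>, w \<xi>)) * ut k (\<xi>, w \<xi>) - H u k (\<xi>, w \<xi>))" if k: "k \<in> {1..n}" for k
    using has_cont_partials_chain[OF solD(1)[OF s k] w] w\<tau> solD(2)[OF s k]
    by (auto simp: deriv01_def algebra_simps)
  define \<kappa>' where "\<kappa>' = (\<lambda>k \<xi>. \<kappa>x j k (\<xi>, w \<xi>) + \<kappa>t j k (\<xi>, w \<xi>) * f j (\<xi>, w \<xi>))"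
  have d\<kappa>: "deriv01 (\<lambda>\<xi>. \<kappa> j k (\<xi>, w \<xi>)) (\<kappa>' k)" if k: "k \<in> {1..n}" for k
    using has_cont_partials_chain[of UNIV, OF _ w] \<kappa>[OF j k] unfolding \<kappa>'_def by (auto simp: bc1_def)
  \<comment> \<open>The same correction one order higher: \<kappa> u in place of \<kappa> W removes
    the terms (f j - f k) u_t, and the additional \<open>ft j\<close> in the weight removes the term
    produced by differentiating the reciprocal speed.\<close>
  define Y where "Y = (\<lambda>\<xi>. E \<xi> * (ut j (\<xi>, w \<xi>) + (\<Sum>k=1..n. \<kappa> j k (\<xi>, w \<xi>) * u k (\<xi>, w \<xi>))))"
  define c where "c = (\<lambda>k \<xi>. (r j (\<xi>, w \<xi>) + ft j (\<xi>, w \<xi>)) * \<kappa> j k (\<xi>, w \<xi>) + \<kappa>' k \<xi>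
     - (\<kappa>t j k (\<xi>, w \<xi>) * (f j (\<xi>, w \<xi>) - f k (\<xi>, w \<xi>)) + \<kappa> j k (\<xi>, w \<xi>) * (ft j (\<xi>, w \<xi>) - ft k (\<xi>, w \<xi>))))"
  define Y' where "Y' = (\<lambda>\<xi>. E \<xi> * (- rt j (\<xi>, w \<xi>) * u j (\<xi>, w \<xi>) + (\<Sum>k=1..n. c k \<xi> * u k (\<xi>, w \<xi>) - \<kappa> j k (\<xi>, w \<xi>) * H u k (\<xi>, w \<xi>))))"
  have dY: "deriv01 Y Y'"
    unfolding deriv01_def
  proof
    fix \<xi> :: real assume \<xi>: "\<xi> \<in> {0..1}"
    let ?F = "at \<xi> within {0..1}"
    have "((\<lambda>\<xi>. \<Sum>k=1..n. \<kappa> j k (\<xi>, w \<xi>) * u k (\<xi>, w \<xi>)) has_real_derivative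
      (\<Sum>k=1..n. \<kappa>' k \<xi> * u k (\<xi>, w \<xi>) + ((f j (\<xi>, w \<xi>) - f k (\<xi>, w \<xi>)) * ut k (\<xi>, w \<xi>) - H u k (\<xi>, w \<xi>)) * \<kappa> j k (\<xi>, w \<xi>))) ?F"
      by (intro DERIV_sum DERIV_mult deriv01D[OF d\<kappa> \<xi>] deriv01D[OF du \<xi>])
    note DERIV_mult[OF deriv01D[OF E \<xi>] DERIV_add[OF deriv01D[OF dV \<xi>] this]]
    then show "(Y has_real_derivative Y' \<xi>) ?F"
      unfolding Y_def
      by (rule DERIV_cong)
        (simp add: Y'_def Ht_def c_def sum.distrib sum_distrib_left sum_distrib_right sum_subtractf algebra_simps)
  qed
  have Y'b: "\<bar>Y' \<xi>\<bar> \<le> B * (Q + n * (7 * Q\<^sup>2 + Q + Q * (CH * n))) * M" if \<xi>: "\<xi> \<in> {0..1}" for \<xi>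
  proof -
    have c: "\<bar>c k \<xi>\<bar> \<le> 7 * Q\<^sup>2 + Q" if k: "k \<in> {1..n}" for k
    proof -
      note b = coef_bounds[OF \<xi> j k, of "w \<xi>"] and b' = coef_bounds[OF \<xi> k k, of "w \<xi>"]
      have d: "\<bar>r j (\<xi>, w \<xi>) + ft j (\<xi>, w \<xi>)\<bar> \<le> 2 * Q" "\<bar>f j (\<xi>, w \<xi>) - f k (\<xi>, w \<xi>)\<bar> \<le> 2 * Q"
        "\<bar>ft j (\<xi>, w \<xi>) - ft k (\<xi>, w \<xi>)\<bar> \<le> 2 * Q"
        using b(1,3,4) b'(1,3) by linarith+
      have 1: "\<bar>(r j (\<xi>, w \<xi>) + ft j (\<xi>, w \<xi>)) * \<kappa> j k (\<xi>, w \<xi>)\<bar> \<le> (2 * Q) * Q"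
        unfolding abs_mult by (intro mult_mono d b(7)) (use Q0 in auto)
      have 2: "\<bar>\<kappa>' k \<xi>\<bar> \<le> Q + Q * Q"
        unfolding \<kappa>'_def
        by (rule order_trans[OF abs_triangle_ineq], unfold abs_mult, intro add_mono mult_mono b(1,8,9)) (use Q0 in auto)
      have 3: "\<bar>\<kappa>t j k (\<xi>, w \<xi>) * (f j (\<xi>, w \<xi>) - f k (\<xi>, w \<xi>))\<bar> \<le> Q * (2 * Q)"
        unfolding abs_mult by (intro mult_mono d b(9)) (use Q0 in auto)
      have 4: "\<bar>\<kappa> j k (\<xi>, w \<xi>) * (ft j (\<xi>, w \<xi>) - ft k (\<xi>, w \<xi>))\<bar> \<le> Q * (2 * Q)"
        unfolding abs_mult by (intro mult_mono d b(7)) (use Q0 in auto)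
      have "7 * Q\<^sup>2 + Q = 2 * Q * Q + (Q + Q * Q) + (Q * (2 * Q) + Q * (2 * Q))" by (simp add: power2_eq_square)
      then show ?thesis using 1 2 3 4 unfolding c_def by linarith
    qed
    have Hk: "\<bar>H u k (\<xi>, w \<xi>)\<bar> \<le> CH * (n * M)" if k: "k \<in> {1..n}" for k
    proof -
      have "(\<Sum>l=1..n. \<bar>u l (\<xi>, w \<xi>)\<bar>) \<le> (\<Sum>l=1..n. M)" by (intro sum_mono M \<xi>)
      then show ?thesis
        using H_bound[OF \<xi> k, of u "w \<xi>"] mult_left_mono[OF _ CH0, of "\<Sum>l=1..n. \<bar>u l (\<xi>, w \<xi>)\<bar>" "n * M"] by simp
    qed
    have "\<bar>c k \<xi> * u k (\<xi>, w \<xi>) - \<kappa> j k (\<xi>, w \<xi>) * H u k (\<xi>, w \<xi>)\<bar> \<le> (7 * Q\<^sup>2 + Q + Q * (CH * n)) * M" if k: "k \<in> {1..n}" for k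
    proof -
      have "\<bar>c k \<xi> * u k (\<xi>, w \<xi>)\<bar> \<le> (7 * Q\<^sup>2 + Q) * M"
        unfolding abs_mult using c[OF k] M[OF \<xi> k] Q0 by (intro mult_mono) auto
      moreover have "\<bar>\<kappa> j k (\<xi>, w \<xi>) * H u k (\<xi>, w \<xi>)\<bar> \<le> Q * (CH * (n * M))"
        unfolding abs_mult using coef_bounds(7)[OF \<xi> j k] Hk[OF k] Q0 by (intro mult_mono) auto
      ultimately show ?thesis by (simp add: algebra_simps abs_le_iff)
    qed
    then have "(\<Sum>k=1..n. \<bar>c k \<xi> * u k (\<xi>, w \<xi>) - \<kappa> j k (\<xi>, w \<xi>) * H u k (\<xi>, w \<xi>)\<bar>) \<le> (\<Sum>k=1..n. (7 * Q\<^sup>2 + Q + Q * (CH * n)) * M)"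
      by (intro sum_mono)
    moreover have "\<bar>- rt j (\<xi>, w \<xi>) * u j (\<xi>, w \<xi>)\<bar> \<le> Q * M"
      unfolding abs_mult using coef_bounds(6)[OF \<xi> j j, of "w \<xi>"] M[OF \<xi> j] Q0 by (intro mult_mono) auto
    ultimately have "\<bar>- rt j (\<xi>, w \<xi>) * u j (\<xi>, w \<xi>) + (\<Sum>k=1..n. c k \<xi> * u k (\<xi>, w \<xi>) - \<kappa> j k (\<xi>, w \<xi>) * H u k (\<xi>, w \<xi>))\<bar>
        \<le> Q * M + (\<Sum>k=1..n. (7 * Q\<^sup>2 + Q + Q * (CH * n)) * M)"
      by (intro order_trans[OF abs_triangle_ineq] add_mono order_trans[OF sum_abs])
    then have "\<bar>Y' \<xi>\<bar> \<le> B * (Q * M + (\<Sum>k=1..n. (7 * Q\<^sup>2 + Q + Q * (CH * n)) * M))"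
      unfolding Y'_def abs_mult using EB[OF \<xi>] B0 by (intro mult_mono) auto
    then show ?thesis by (simp add: algebra_simps)
  qed
  define C where "C = B * (Q + n * (7 * Q\<^sup>2 + Q + Q * (CH * n))) * M"
  have C0: "0 \<le> C" unfolding C_def using Q0 CH0 B0 M0 by (intro mult_nonneg_nonneg add_nonneg_nonneg) auto
  have "\<bar>Y \<xi> - Y x\<bar> \<le> C * \<bar>\<xi> - x\<bar>"
    by (rule deriv01_bound[OF dY _ x]) (use Y'b in \<open>simp add: C_def\<close>)
  also have "\<dots> \<le> C" using x C0 by (intro mult_left_le) auto
  finally have Yd: "\<bar>Y \<xi> - Y x\<bar> \<le> C" .
  have Z: "\<bar>E \<xi> * (\<Sum>k=1..n. \<kappa> j k (\<xi>, w \<xi>) * u k (\<xi>, w \<xi>))\<bar> \<le> B * (n * (Q * M))" if \<xi>: "\<xi> \<in> {0..1}" for \<xi>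
  proof -
    have "\<bar>\<Sum>k=1..n. \<kappa> j k (\<xi>, w \<xi>) * u k (\<xi>, w \<xi>)\<bar> \<le> (\<Sum>k=1..n. Q * M)"
      using coef_bounds(7)[OF \<xi> j] M[OF \<xi>] Q0
      by (intro order_trans[OF sum_abs] sum_mono) (auto simp: abs_mult intro!: mult_mono)
    then show ?thesis unfolding abs_mult using EB[OF \<xi>] B0 by (intro mult_mono) auto
  qed
  have "E \<xi> * ut j (\<xi>, w \<xi>) - E x * ut j (x, w x) = (Y \<xi> - Y x) - E \<xi> * (\<Sum>k=1..n. \<kappa> j k (\<xi>, w \<xi>) * u k (\<xi>, w \<xi>))
      + E x * (\<Sum>k=1..n. \<kappa> j k (x, w x) * u k (x, w x))"
    by (simp add: Y_def algebra_simps)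
  then have "\<bar>E \<xi> * ut j (\<xi>, w \<xi>) - E x * ut j (x, w x)\<bar> \<le> C + 2 * (B * (n * (Q * M)))"
    using Yd Z[OF x(1)] Z[OF x(2)] by linarith
  also have "\<dots> = K2 B * M" by (simp add: K2_def C_def algebra_simps)
  finally show ?thesis .
qed

end

section \<open>Reflection at the boundary\<close>

text \<open>Components with index up to m leave at 1, the others at 0, so both sums sample the end
  opposite to \<open>inflow_end\<close>.\<close>

lemma P_op_outflow:
  assumes "m \<le> n"
  shows "P_op n m p u j t = (\<Sum>k=1..n. p j k * u k (1 - inflow_end m k, t))"
proof -
  have "{1..n} = {1..m} \<union> {m+1..n}" using assms by auto
  then have "(\<Sum>k=1..n. p j k * u k (1 - inflow_end m k, t)) =
     (\<Sum>k=1..m. p j k * u k (1 - inflow_end m k, t)) + (\<Sum>k=m+1..n. p j k * u k (1 - inflow_end m k, t))"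
    by (simp add: sum.union_disjoint)
  then show ?thesis by (simp add: P_op_def inflow_end_def)
qed

text \<open>Besides bounding the coefficients, \<open>Q\<close> measures waiting times, which have
  to be strictly positive: hence \<open>Qpos\<close>.\<close>

locale hyp_boundary = hyp_system +
  fixes m :: nat and a b :: "nat \<Rightarrow> real \<times> real \<Rightarrow> real" and p :: "nat \<Rightarrow> nat \<Rightarrow> real" and N :: nat and Pm :: real
  assumes f_def: "f = (\<lambda>j z. 1 / a j z)" and r_def: "r = (\<lambda>j z. b j z / a j z)"
    and mn: "m \<le> n" and p: "j \<in> {1..n} \<Longrightarrow> k \<in> {1..n} \<Longrightarrow> \<bar>p j k\<bar> \<le> Pm" and Pm0: "0 \<le> Pm" and Qpos: "0 < Q"
    and nilpotent: "(\<And>j. j \<in> {1..n} \<Longrightarrow> continuous_on strip (u j)) \<Longrightarrow> j \<in> {1..n} \<Longrightarrow> z \<in> strip \<Longrightarrow>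
      ((\<lambda>w. C_op m a b (P_op n m p w)) ^^ N) u j z = 0"
begin

abbreviation inn :: "nat \<Rightarrow> real" where "inn \<equiv> inflow_end m"
definition out :: "nat \<Rightarrow> real" where "out j = 1 - inflow_end m j"

lemma inn01: "inn j \<in> {0..1}" and out01: "out j \<in> {0..1}"
  by (auto simp: inflow_end_def out_def)

text \<open>Time coordinate, at the inflow end, of the characteristic through the outflow end at
  time t; \<open>\<gamma> j t\<close> is the weight accumulated between the two ends.\<close>

definition \<sigma> :: "nat \<Rightarrow> real \<Rightarrow> real" where "\<sigma> j t = charac (a j) (inn j) (out j) t"
definition \<gamma> :: "nat \<Rightarrow> real \<Rightarrow> real" where "\<gamma> j t = char_weight (a j) (b j) (inn j) (out j) t"

text \<open>The operator \<open>C P\<close> acting on the traces at the outflow ends.\<close>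

definition G :: "(nat \<Rightarrow> real \<Rightarrow> real) \<Rightarrow> nat \<Rightarrow> real \<Rightarrow> real" where
  "G z = (\<lambda>j t. \<gamma> j t * (\<Sum>k=1..n. p j k * z k (\<sigma> j t)))"

lemma CP_trace1: "C_op m a b (P_op n m p v) j (out j, t) = G (\<lambda>k s. v k (out k, s)) j t"
  by (simp add: C_op_def P_op_outflow[OF mn] G_def \<sigma>_def \<gamma>_def out_def)

text \<open>C P u depends on u only through its outflow traces, so evaluation at the outflow ends
  intertwines the powers of C P with those of \<open>G\<close>, which acts on functions of time
  alone.\<close>

lemma CP_trace:
  "((\<lambda>w. C_op m a b (P_op n m p w)) ^^ i) u j (out j, t) = (G ^^ i) (\<lambda>j t. u j (out j, t)) j t"
proof (induction i arbitrary: j t)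
  case (Suc i)
  have "(\<lambda>k s. ((\<lambda>w. C_op m a b (P_op n m p w)) ^^ i) u k (out k, s)) = (G ^^ i) (\<lambda>j t. u j (out j, t))"
    by (intro ext Suc.IH)
  then show ?case by (simp add: CP_trace1)
qed simp

text \<open>Every family of continuous traces is realised by functions constant in x, to which the
  hypothesis on C P applies.\<close>

lemma G_nilpotent:
  assumes z: "\<And>k. k \<in> {1..n} \<Longrightarrow> continuous_on UNIV (z k)" and j: "j \<in> {1..n}"
  shows "(G ^^ N) z j t = 0"
proof -
  have "((\<lambda>w. C_op m a b (P_op n m p w)) ^^ N) (\<lambda>k (x, t). z k t) j (out j, t) = 0"
  proof (rule nilpotent)
    show "continuous_on strip (\<lambda>(x, t). z k t)" if "k \<in> {1..n}" for k
      unfolding split_beta by (rule continuous_on_compose2[OF z[OF that]]) (auto intro!: continuous_intros)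
  qed (use j out01[of j] in auto)
  then show ?thesis unfolding CP_trace by simp
qed

lemma G_diff: "G (\<lambda>j t. z j t - y j t) j t = G z j t - G y j t"
  by (simp add: G_def right_diff_distrib sum_subtractf)

definition fl :: "nat \<Rightarrow> real \<Rightarrow> real \<Rightarrow> real \<Rightarrow> real" where "fl j x t = (\<lambda>\<eta>. flow (f j) \<eta> x t)"

lemma fl:
  assumes "j \<in> {1..n}" "x \<in> {0..1}"
  shows "deriv01 (fl j x t) (\<lambda>\<eta>. f j (\<eta>, fl j x t \<eta>))" "fl j x t x = t"
    "\<xi> \<in> {0..1} \<Longrightarrow> \<bar>fl j x t \<xi> - t\<bar> \<le> Q" "continuous_on {0..1} (fl j x t)"
  using flow_solution[OF f[OF assms(1)] assms(2)] flow_dist[OF f[OF assms(1)] assms(2)]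
  by (auto simp: fl_def intro: deriv01_continuous)

lemma \<sigma>_eq: "\<sigma> j t = fl j (out j) t (inn j)"
  unfolding \<sigma>_def fl_def charac_eq_flow unfolding f_def ..

lemma \<sigma>_dist: "j \<in> {1..n} \<Longrightarrow> \<bar>\<sigma> j t - t\<bar> \<le> Q"
  unfolding \<sigma>_eq by (rule fl(3)[OF _ out01 inn01])

text \<open>Exponents of the two integrating factors: \<open>Ar\<close> absorbs the diagonal term of
  the equation and yields the weight of C, \<open>At\<close> is the logarithm of the time derivative
  of the flow. Both vanish at the starting point x.\<close>

definition Ar :: "nat \<Rightarrow> real \<Rightarrow> real \<Rightarrow> real \<Rightarrow> real" where
  "Ar j x t \<xi> = integral {0..\<xi>} (\<lambda>\<eta>. r j (\<eta>, fl j x t \<eta>)) - integral {0..x} (\<lambda>\<eta>. r j (\<eta>, fl j x t \<eta>))"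
definition At :: "nat \<Rightarrow> real \<Rightarrow> real \<Rightarrow> real \<Rightarrow> real" where
  "At j x t \<xi> = integral {0..\<xi>} (\<lambda>\<eta>. ft j (\<eta>, fl j x t \<eta>)) - integral {0..x} (\<lambda>\<eta>. ft j (\<eta>, fl j x t \<eta>))"

lemma ArAt:
  assumes j: "j \<in> {1..n}" and x: "x \<in> {0..1}"
  shows "deriv01 (Ar j x t) (\<lambda>\<eta>. r j (\<eta>, fl j x t \<eta>))" "deriv01 (At j x t) (\<lambda>\<eta>. ft j (\<eta>, fl j x t \<eta>))"
    "Ar j x t x = 0" "At j x t x = 0"
    "\<xi> \<in> {0..1} \<Longrightarrow> \<bar>Ar j x t \<xi>\<bar> \<le> Q" "\<xi> \<in> {0..1} \<Longrightarrow> \<bar>At j x t \<xi>\<bar> \<le> Q"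
proof -
  show d: "deriv01 (Ar j x t) (\<lambda>\<eta>. r j (\<eta>, fl j x t \<eta>))" "deriv01 (At j x t) (\<lambda>\<eta>. ft j (\<eta>, fl j x t \<eta>))"
    unfolding Ar_def At_def
    by (intro deriv01_integral continuous_on_strip_curve fl(4)[OF j x] bc1_continuous(1)[OF r[OF j]] bc1_continuous(3)[OF f[OF j]])+
  show z: "Ar j x t x = 0" "At j x t x = 0" by (simp_all add: Ar_def At_def)
  assume \<xi>: "\<xi> \<in> {0..1}"
  have q: "Q * \<bar>\<xi> - x\<bar> \<le> Q" using \<xi> x Q0 by (intro mult_left_le) auto
  show "\<bar>Ar j x t \<xi>\<bar> \<le> Q" "\<bar>At j x t \<xi>\<bar> \<le> Q"
    using deriv01_bound[OF d(1) coef_bounds(4)[OF _ j j] x \<xi>] deriv01_bound[OF d(2) coef_bounds(3)[OF _ j j] x \<xi>] z q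
    by auto
qed

lemma weights:
  assumes j: "j \<in> {1..n}" and x: "x \<in> {0..1}"
  shows "deriv01 (\<lambda>\<eta>. exp (Ar j x t \<eta>)) (\<lambda>\<eta>. r j (\<eta>, fl j x t \<eta>) * exp (Ar j x t \<eta>))"
    "deriv01 (\<lambda>\<eta>. exp (Ar j x t \<eta> + At j x t \<eta>)) (\<lambda>\<eta>. (r j (\<eta>, fl j x t \<eta>) + ft j (\<eta>, fl j x t \<eta>)) * exp (Ar j x t \<eta> + At j x t \<eta>))"
    "\<xi> \<in> {0..1} \<Longrightarrow> 0 \<le> exp (Ar j x t \<xi>) \<and> exp (Ar j x t \<xi>) \<le> exp Q"
    "\<xi> \<in> {0..1} \<Longrightarrow> 0 \<le> exp (Ar j x t \<xi> + At j x t \<xi>) \<and> exp (Ar j x t \<xi> + At j x t \<xi>) \<le> exp (2 * Q)"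
proof -
  show "deriv01 (\<lambda>\<eta>. exp (Ar j x t \<eta>)) (\<lambda>\<eta>. r j (\<eta>, fl j x t \<eta>) * exp (Ar j x t \<eta>))"
    "deriv01 (\<lambda>\<eta>. exp (Ar j x t \<eta> + At j x t \<eta>)) (\<lambda>\<eta>. (r j (\<eta>, fl j x t \<eta>) + ft j (\<eta>, fl j x t \<eta>)) * exp (Ar j x t \<eta> + At j x t \<eta>))"
    using ArAt(1,2)[OF j x, of t] by (auto simp: deriv01_def intro!: derivative_eq_intros)
  assume \<xi>: "\<xi> \<in> {0..1}"
  show "0 \<le> exp (Ar j x t \<xi>) \<and> exp (Ar j x t \<xi>) \<le> exp Q"
    "0 \<le> exp (Ar j x t \<xi> + At j x t \<xi>) \<and> exp (Ar j x t \<xi> + At j x t \<xi>) \<le> exp (2 * Q)"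
    using ArAt(5,6)[OF j x \<xi>, of t] by auto
qed

lemma \<gamma>_eq:
  assumes j: "j \<in> {1..n}"
  shows "\<gamma> j t = exp (Ar j (out j) t (inn j))"
proof -
  have c: "charac (a j) \<eta> x t = fl j x t \<eta>" for \<eta> x t unfolding fl_def charac_eq_flow unfolding f_def ..
  have "char_weight (a j) (b j) (inn j) (out j) t = exp (Ar j (out j) t (inn j) - Ar j (out j) t (out j))"
  proof (rule char_weight_eq)
    show "bc1 Q (\<lambda>z. 1 / a j z) (fx j) (ft j)" using f[OF j] by (simp add: f_def)
    show "continuous_on strip (\<lambda>z. b j z / a j z)" using bc1_continuous(1)[OF r[OF j]] by (simp add: r_def)
    show "deriv01 (Ar j (out j) t) (\<lambda>\<eta>. b j (\<eta>, charac (a j) \<eta> (out j) t) / a j (\<eta>, charac (a j) \<eta> (out j) t))"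
      unfolding c using ArAt(1)[OF j out01[of j], of t] by (simp add: r_def)
  qed (rule inn01 out01)+
  then show ?thesis by (simp add: \<gamma>_def ArAt(3)[OF j out01[of j]])
qed

lemma \<gamma>_bound: "j \<in> {1..n} \<Longrightarrow> 0 \<le> \<gamma> j t \<and> \<gamma> j t \<le> exp Q"
  unfolding \<gamma>_eq by (rule weights(3)[OF _ out01 inn01])

lemma \<sigma>_deriv:
  assumes j: "j \<in> {1..n}"
  shows "(\<sigma> j has_real_derivative exp (At j (out j) t (inn j))) (at t)"
  using flow_deriv_t[OF f[OF j] _ out01[of j] inn01[of j], of "At j (out j) t" t] ArAt(2,4)[OF j out01[of j], of t]
  by (simp add: \<sigma>_eq[abs_def] fl_def)

text \<open>\<open>exp Q\<close> bounds the weight itself. The time derivative of its exponent is a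
  difference of two integrals, each at most \<open>Q * exp Q\<close>: \<open>Q\<close> for
  \<open>rt\<close>, \<open>exp Q\<close> for the derivative of the flow.\<close>

definition C\<gamma> :: real where "C\<gamma> = exp Q * (2 * (Q * exp Q))"

lemma \<gamma>_deriv:
  assumes j: "j \<in> {1..n}"
  shows "\<exists>D. (\<gamma> j has_real_derivative D) (at t) \<and> \<bar>D\<bar> \<le> C\<gamma>"
proof -
  let ?w = "fl j (out j)"
  define R' where "R' = (\<lambda>\<eta>. rt j (\<eta>, ?w t \<eta>) * exp (At j (out j) t \<eta>))"
  have cR': "continuous_on {0..1} R'"
    unfolding R'_def
    by (intro continuous_intros continuous_on_strip_curve bc1_continuous(3)[OF r[OF j]] fl(4)[OF j out01[of j]]
        deriv01_continuous[OF ArAt(2)[OF j out01[of j]]])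
  have bR': "\<bar>R' \<eta>\<bar> \<le> Q * exp Q" if "\<eta> \<in> {0..1}" for \<eta>
    unfolding R'_def abs_mult
    using coef_bounds(6)[OF that j j] ArAt(6)[OF j out01[of j] that, of t] Q0 by (intro mult_mono) auto
  have d: "((\<lambda>s. integral {0..\<xi>} (\<lambda>\<eta>. r j (\<eta>, ?w s \<eta>))) has_real_derivative integral {0..\<xi>} R') (at t)"
    if \<xi>: "\<xi> \<in> {0..1}" for \<xi>
  proof (rule deriv_integral_param[where L = "Q * exp Q"])
    show "continuous_on {0..\<xi>} (\<lambda>\<eta>. r j (\<eta>, ?w s \<eta>))" for s
      by (rule continuous_on_subset[OF continuous_on_strip_curve[OF bc1_continuous(1)[OF r[OF j]] fl(4)[OF j out01[of j]]]])
        (use \<xi> in auto)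
    fix \<eta> assume "\<eta> \<in> {0..\<xi>}"
    then have \<eta>: "\<eta> \<in> {0..1}" using \<xi> by auto
    have dw: "((\<lambda>s. ?w s \<eta>) has_real_derivative exp (At j (out j) t \<eta>)) (at t)"
      using flow_deriv_t[OF f[OF j] _ out01[of j] \<eta>, of "At j (out j) t" t] ArAt(2,4)[OF j out01[of j], of t]
      by (simp add: fl_def)
    show "((\<lambda>s. r j (\<eta>, ?w s \<eta>)) has_real_derivative R' \<eta>) (at t)"
      unfolding R'_def by (rule DERIV_chain2[OF bc1_deriv_t[OF r[OF j] \<eta>] dw])
    show "\<bar>r j (\<eta>, ?w s \<eta>) - r j (\<eta>, ?w t \<eta>)\<bar> \<le> Q * exp Q * \<bar>s - t\<bar>" for s
    proof -
      have "\<bar>r j (\<eta>, ?w s \<eta>) - r j (\<eta>, ?w t \<eta>)\<bar> \<le> Q * \<bar>?w s \<eta> - ?w t \<eta>\<bar>"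
        by (rule bc1_lipschitz[OF r[OF j] \<eta>])
      also have "\<dots> \<le> Q * (exp Q * \<bar>s - t\<bar>)"
        using flow_diff(1)[OF f[OF j] out01[of j] \<eta>, of s t] Q0 by (intro mult_left_mono) (auto simp: fl_def)
      finally show ?thesis by (simp add: mult.assoc)
    qed
  qed
  have ib: "\<bar>integral {0..\<xi>} R'\<bar> \<le> Q * exp Q" if \<xi>: "\<xi> \<in> {0..1}" for \<xi>
  proof -
    have "norm (integral {0..\<xi>} R') \<le> Q * exp Q * (\<xi> - 0)"
      by (rule integral_bound) (use \<xi> bR' in \<open>auto intro: continuous_on_subset[OF cR']\<close>)
    also have "\<dots> \<le> Q * exp Q" using \<xi> Q0 by (auto intro!: mult_left_le)
    finally show ?thesis by simp
  qed
  let ?D = "integral {0..inn j} R' - integral {0..out j} R'"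
  have "((\<lambda>s. Ar j (out j) s (inn j)) has_real_derivative ?D) (at t)"
    unfolding Ar_def by (rule DERIV_diff[OF d[OF inn01] d[OF out01]])
  then have "((\<lambda>s. exp (Ar j (out j) s (inn j))) has_real_derivative exp (Ar j (out j) t (inn j)) * ?D) (at t)"
    by (auto intro!: derivative_eq_intros)
  moreover have "\<bar>exp (Ar j (out j) t (inn j)) * ?D\<bar> \<le> C\<gamma>"
    unfolding C\<gamma>_def abs_mult
    using weights(3)[OF j out01[of j] inn01[of j], of t] ib[OF inn01[of j]] ib[OF out01[of j]] Q0
    by (intro mult_mono) auto
  moreover have "\<gamma> j = (\<lambda>s. exp (Ar j (out j) s (inn j)))" by (intro ext \<gamma>_eq j)
  ultimately show ?thesis by auto
qed

section \<open>Solutions with boundary conditions: estimates after repeated reflection\<close>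

definition bsol :: "real \<Rightarrow> (nat \<Rightarrow> real \<times> real \<Rightarrow> real) \<Rightarrow> (nat \<Rightarrow> real \<times> real \<Rightarrow> real) \<Rightarrow> (nat \<Rightarrow> real \<times> real \<Rightarrow> real) \<Rightarrow> bool" where
  "bsol \<tau> u ux ut \<longleftrightarrow> sol \<tau> u ux ut \<and>
     (\<forall>j\<in>{1..n}. \<forall>t>\<tau>. u j (inn j, t) = (\<Sum>k=1..n. p j k * u k (out k, t)))"

lemma bsol_sol: "bsol \<tau> u ux ut \<Longrightarrow> sol \<tau> u ux ut" by (simp add: bsol_def)

lemma bsol_bc: "bsol \<tau> u ux ut \<Longrightarrow> j \<in> {1..n} \<Longrightarrow> \<tau> < t \<Longrightarrow> u j (inn j, t) = (\<Sum>k=1..n. p j k * u k (out k, t))"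
  by (simp add: bsol_def)

text \<open>Continued by its initial value below \<tau>, the trace is continuous on the whole line,
  as the nilpotency of \<open>G\<close> demands. The estimates use it only from \<tau> on, where it
  is the true trace.\<close>

definition tr :: "real \<Rightarrow> (nat \<Rightarrow> real \<times> real \<Rightarrow> real) \<Rightarrow> nat \<Rightarrow> real \<Rightarrow> real" where
  "tr \<tau> u j t = u j (out j, max \<tau> t)"

lemma tr_nilpotent:
  assumes "bsol \<tau> u ux ut" "j \<in> {1..n}"
  shows "(G ^^ N) (tr \<tau> u) j t = 0"
proof (rule G_nilpotent[OF _ assms(2)])
  fix k assume "k \<in> {1..n}"
  have "continuous_on UNIV (\<lambda>t. u k (out k, max \<tau> t))"
    by (rule continuous_on_compose2[OF sol_continuous(1)[OF bsol_sol[OF assms(1)] \<open>k \<in> _\<close> order_refl]])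
      (use out01[of k] in \<open>auto intro!: continuous_intros\<close>)
  then show "continuous_on UNIV (tr \<tau> u k)" by (simp add: tr_def[abs_def])
qed

lemma sum_p_bound:
  assumes "j \<in> {1..n}" "\<And>k. k \<in> {1..n} \<Longrightarrow> \<bar>g k\<bar> \<le> D"
  shows "\<bar>\<Sum>k=1..n. p j k * g k\<bar> \<le> n * Pm * D"
proof -
  have "\<bar>\<Sum>k=1..n. p j k * g k\<bar> \<le> (\<Sum>k=1..n. Pm * D)"
    using assms(2) p[OF assms(1)] Pm0
    by (intro order_trans[OF sum_abs] sum_mono) (auto simp: abs_mult intro!: mult_mono)
  then show ?thesis by simp
qed

text \<open>Bounds the action of \<open>G\<close> in the sup norm: \<open>exp Q\<close> for the
  weight, \<open>n * Pm\<close> for a row of \<open>p\<close>.\<close>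

definition \<Gamma> :: real where "\<Gamma> = exp Q * (n * Pm)"

lemma \<Gamma>0: "0 \<le> \<Gamma>" using Pm0 by (simp add: \<Gamma>_def)

lemma G_bound:
  assumes j: "j \<in> {1..n}" and D: "\<And>k. k \<in> {1..n} \<Longrightarrow> \<bar>g k (\<sigma> j t)\<bar> \<le> D"
  shows "\<bar>G g j t\<bar> \<le> \<Gamma> * D"
proof -
  have "\<bar>\<Sum>k=1..n. p j k * g k (\<sigma> j t)\<bar> \<le> n * Pm * D" by (rule sum_p_bound[OF j D])
  then have "\<bar>\<gamma> j t\<bar> * \<bar>\<Sum>k=1..n. p j k * g k (\<sigma> j t)\<bar> \<le> exp Q * (n * Pm * D)"
    using \<gamma>_bound[OF j, of t] by (intro mult_mono) auto
  then show ?thesis by (simp add: G_def abs_mult \<Gamma>_def mult.assoc)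
qed

text \<open>Telescoping of 1 - G^i. Since the N-th power of \<open>G\<close> annihilates the traces,
  iteration bounds a trace by its defect z - G z, which is exactly what the coupling creates in one
  crossing.\<close>

lemma G_step:
  "z j t - (G ^^ Suc i) z j t = (z j t - G z j t) + G (\<lambda>k s. z k s - (G ^^ i) z k s) j t"
  by (simp add: G_diff)

definition geo :: "real \<Rightarrow> nat \<Rightarrow> real" where "geo c i = (\<Sum>l<i. c ^ l)"

lemma geo_Suc: "geo c (Suc i) = 1 + c * geo c i"
  by (simp add: geo_def sum.lessThan_Suc_shift sum_distrib_left del: sum.lessThan_Suc)

lemma geo0 [simp]: "geo c 0 = 0" by (simp add: geo_def)

text \<open>Up to the coupling error \<open>D\<close>, the value of a solution is a reflected trace,
  and N reflections annihilate the trace. Each reflection widens the required time interval by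
  \<open>Q\<close> on both sides, and one further \<open>Q\<close> leads from (x, t) to the inflow
  end: this is the margin \<open>(N + 1) * Q\<close>. The lower inequality is strict because the
  boundary conditions hold only after \<tau>.\<close>

lemma sup_bound:
  assumes u: "bsol \<tau> u ux ut" and M0: "0 < M" and S: "\<tau> \<le> S"
    and M: "\<And>t j. t \<in> {\<tau>..S} \<Longrightarrow> j \<in> {1..n} \<Longrightarrow> integral {0..1} (\<lambda>x. (u j (x, t))\<^sup>2) \<le> M\<^sup>2"
    and t: "\<tau> + (N + 1) * Q < t" "t \<le> S - (N + 1) * Q" and j: "j \<in> {1..n}" and x: "x \<in> {0..1}"
  shows "\<bar>u j (x, t)\<bar> \<le> K1 (exp Q) (S - \<tau>) * geo \<Gamma> (Suc N) * M"
proof -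
  define D where "D = K1 (exp Q) (S - \<tau>) * M"
  have step: "\<bar>u j (x, t) - exp (Ar j x t (inn j)) * (\<Sum>k=1..n. p j k * u k (out k, fl j x t (inn j)))\<bar> \<le> D"
    if j: "j \<in> {1..n}" and t: "\<tau> + Q < t" "t \<le> S - Q" and x: "x \<in> {0..1}" for j t x
  proof -
    have w: "fl j x t \<eta> \<in> {\<tau>..S}" "\<tau> < fl j x t \<eta>" if "\<eta> \<in> {0..1}" for \<eta>
      using fl(3)[OF j x that, of t] t by auto
    have "\<bar>exp (Ar j x t x) * u j (x, fl j x t x) - exp (Ar j x t (inn j)) * u j (inn j, fl j x t (inn j))\<bar> \<le> D"
      unfolding D_def
      by (rule transport_L2_bound[OF bsol_sol[OF u] S M0 M j fl(1)[OF j x] w(1) weights(1)[OF j x] weights(3)[OF j x] inn01 x])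
    then show ?thesis
      using bsol_bc[OF u j w(2)[OF inn01]] by (simp add: ArAt(3)[OF j x] fl(2)[OF j x])
  qed
  have D0: "0 \<le> D"
  proof -
    have "t \<in> {\<tau> + Q<..S - Q}"
    proof -
      have "0 \<le> N * Q" using Q0 by simp
      then show ?thesis using t by (simp add: algebra_simps)
    qed
    then show ?thesis using step[OF j, of t x] x by fastforce
  qed
  have h: "\<bar>tr \<tau> u j t - G (tr \<tau> u) j t\<bar> \<le> D" if j: "j \<in> {1..n}" and t: "\<tau> + Q < t" "t \<le> S - Q" for j t
  proof -
    have s: "\<tau> \<le> \<sigma> j t" "\<tau> \<le> t" using \<sigma>_dist[OF j, of t] t Q0 by auto
    show ?thesis
      using step[OF j t out01[of j]] s
      by (simp add: tr_def G_def \<gamma>_eq[OF j] max_absorb2 \<sigma>_eq[symmetric])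
  qed
  have it: "\<bar>tr \<tau> u j t - (G ^^ i) (tr \<tau> u) j t\<bar> \<le> D * geo \<Gamma> i"
    if "j \<in> {1..n}" "\<tau> + i * Q < t" "t \<le> S - i * Q" for i j t
    using that
  proof (induction i arbitrary: j t)
    case (Suc i)
    have iQ: "0 \<le> i * Q" using Q0 by simp
    have "\<bar>G (\<lambda>k s. tr \<tau> u k s - (G ^^ i) (tr \<tau> u) k s) j t\<bar> \<le> \<Gamma> * (D * geo \<Gamma> i)"
    proof (rule G_bound[OF Suc.prems(1)], rule Suc.IH)
      show "\<tau> + i * Q < \<sigma> j t" "\<sigma> j t \<le> S - i * Q"
        using \<sigma>_dist[OF Suc.prems(1), of t] Suc.prems(2,3) by (auto simp: algebra_simps)
    qed
    moreover have "\<bar>tr \<tau> u j t - G (tr \<tau> u) j t\<bar> \<le> D"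
      using Suc.prems iQ by (intro h) (auto simp: algebra_simps)
    ultimately show ?case
      unfolding G_step[of "tr \<tau> u" j t i] geo_Suc by (simp add: algebra_simps abs_le_iff)
  qed simp
  have z: "\<bar>tr \<tau> u j t\<bar> \<le> D * geo \<Gamma> N" if "j \<in> {1..n}" "\<tau> + N * Q < t" "t \<le> S - N * Q" for j t
    using it[OF that] tr_nilpotent[OF u that(1)] by simp
  have NQ: "0 \<le> N * Q" using Q0 by simp
  have t': "\<tau> + Q < t" "t \<le> S - Q" using t NQ by (auto simp: algebra_simps)
  let ?s = "fl j x t (inn j)"
  have s: "\<tau> + N * Q < ?s" "?s \<le> S - N * Q"
    using fl(3)[OF j x inn01[of j], of t] t NQ by (auto simp: algebra_simps)
  then have s\<tau>: "\<tau> \<le> ?s" using NQ by linarith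
  have "\<bar>\<Sum>k=1..n. p j k * u k (out k, ?s)\<bar> \<le> n * Pm * (D * geo \<Gamma> N)"
    using z[OF _ s(1,2)] s\<tau> by (intro sum_p_bound[OF j]) (simp add: tr_def max_absorb2)
  then have "\<bar>exp (Ar j x t (inn j))\<bar> * \<bar>\<Sum>k=1..n. p j k * u k (out k, ?s)\<bar> \<le> exp Q * (n * Pm * (D * geo \<Gamma> N))"
    using weights(3)[OF j x inn01[of j], of t] by (intro mult_mono) auto
  then have "\<bar>exp (Ar j x t (inn j)) * (\<Sum>k=1..n. p j k * u k (out k, ?s))\<bar> \<le> \<Gamma> * (D * geo \<Gamma> N)"
    by (simp add: abs_mult \<Gamma>_def mult.assoc)
  then have "\<bar>u j (x, t)\<bar> \<le> D + \<Gamma> * (D * geo \<Gamma> N)"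
    using step[OF j t' x] by linarith
  then show ?thesis by (simp add: D_def geo_Suc algebra_simps)
qed

text \<open>Dominates \<open>G\<close> on values and on derivatives simultaneously. Differentiating
  \<open>G\<close> lets the derivative of the weight act on values, and puts
  \<open>exp (2 * Q)\<close>, for the weight times the derivative of \<open>\<sigma>\<close>, in
  front of derivatives.\<close>

definition \<Delta> :: real where "\<Delta> = \<Gamma> + C\<gamma> * (n * Pm) + exp (2 * Q) * (n * Pm)"
text \<open>Dominates both the defect z - G z and its time derivative, in units of the sup bound
  M.\<close>

definition KD :: real where "KD = (1 + \<Gamma>) + (K2 (exp (2 * Q)) + C\<gamma> * (n * Pm))"

lemma \<Delta>0: "0 \<le> \<Delta>" "\<Gamma> \<le> \<Delta>" "C\<gamma> * (n * Pm) + exp (2 * Q) * (n * Pm) \<le> \<Delta>"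
  using Pm0 Q0 \<Gamma>0 by (auto simp: \<Delta>_def C\<gamma>_def intro!: add_nonneg_nonneg)

text \<open>Product and chain rule. The derivative of the weight enters only through its bound, but
  the part acting on derivatives is kept exact, since it has to cancel against the same term in the
  transport estimate for u_t.\<close>

lemma G_deriv:
  assumes j: "j \<in> {1..n}"
    and d: "\<And>k. k \<in> {1..n} \<Longrightarrow> (g k has_real_derivative g' k) (at (\<sigma> j t))"
    and A: "\<And>k. k \<in> {1..n} \<Longrightarrow> \<bar>g k (\<sigma> j t)\<bar> \<le> D"
  shows "\<exists>E. (G g j has_real_derivative E) (at t) \<and>
     \<bar>E - exp (Ar j (out j) t (inn j) + At j (out j) t (inn j)) * (\<Sum>k=1..n. p j k * g' k)\<bar> \<le> C\<gamma> * (n * Pm) * D"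
proof -
  obtain \<gamma>' where \<gamma>': "(\<gamma> j has_real_derivative \<gamma>') (at t)" "\<bar>\<gamma>'\<bar> \<le> C\<gamma>" using \<gamma>_deriv[OF j] by blast
  have "((\<lambda>t. \<Sum>k=1..n. p j k * g k (\<sigma> j t)) has_real_derivative (\<Sum>k=1..n. p j k * (g' k * exp (At j (out j) t (inn j))))) (at t)"
    by (intro DERIV_sum DERIV_cmult DERIV_chain2[OF d \<sigma>_deriv[OF j]])
  note DERIV_mult[OF \<gamma>'(1) this]
  then have "(G g j has_real_derivative \<gamma>' * (\<Sum>k=1..n. p j k * g k (\<sigma> j t)) + exp (Ar j (out j) t (inn j) + At j (out j) t (inn j)) * (\<Sum>k=1..n. p j k * g' k)) (at t)"
    unfolding G_def
    by (rule DERIV_cong) (simp add: \<gamma>_eq[OF j] exp_add sum_distrib_left sum_distrib_right algebra_simps)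
  moreover have "\<bar>\<gamma>' * (\<Sum>k=1..n. p j k * g k (\<sigma> j t))\<bar> \<le> C\<gamma> * (n * Pm * D)"
    unfolding abs_mult using \<gamma>'(2) sum_p_bound[OF j A] by (intro mult_mono) auto
  ultimately show ?thesis by (intro exI conjI) (auto simp: mult.assoc)
qed

text \<open>The reflection argument for u_t, with a sup bound in place of the L2 bound. Nilpotency
  is available for \<open>G\<close> and not for the operator that acts on derivatives; therefore the
  iteration carries the traces together with their derivatives and differentiates the telescoped
  identity.\<close>

lemma derivative_bound:
  assumes u: "bsol \<tau> u ux ut" and \<tau>': "\<tau> \<le> \<tau>'"
    and M: "\<And>t j x. t \<in> {\<tau>'..S} \<Longrightarrow> j \<in> {1..n} \<Longrightarrow> x \<in> {0..1} \<Longrightarrow> \<bar>u j (x, t)\<bar> \<le> M"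
    and t: "\<tau>' + (N + 1) * Q < t" "t < S - (N + 1) * Q" and j: "j \<in> {1..n}" and x: "x \<in> {0..1}"
  shows "\<bar>ut j (x, t)\<bar> \<le> (K2 (exp (2 * Q)) + exp (2 * Q) * (n * Pm) * (KD * geo \<Delta> N)) * M"
proof -
  define E where "E = (\<lambda>j x t. exp (Ar j x t (inn j) + At j x t (inn j)))"
  have Eb: "0 \<le> E j x t" "E j x t \<le> exp (2 * Q)" if "j \<in> {1..n}" "x \<in> {0..1}" for j x t
    using weights(4)[OF that inn01[of j], of t] by (auto simp: E_def)
  have NQ: "0 \<le> N * Q" using Q0 by simp
  have e1: "real (N + 1) * Q = N * Q + Q" by (simp add: algebra_simps)
  have "t \<in> {\<tau>'..S}" using t NQ Q0 unfolding e1 atLeastAtMost_iff by linarith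
  from M[OF this j x] have M0: "0 \<le> M" by linarith
  have dtr: "((\<lambda>t. u k (out k, t)) has_real_derivative ut k (out k, t)) (at t)" if "k \<in> {1..n}" "\<tau> < t" for k t
  proof -
    have "at t within {\<tau>..} = at t" by (rule at_within_interior) (use that in \<open>simp add: interior_Ici\<close>)
    then show ?thesis
      using has_cont_partialsD(5)[OF solD(1)[OF bsol_sol[OF u] that(1)] out01[of k], of t] that(2) by simp
  qed
  \<comment> \<open>The boundary condition holds on the open half-line after \<tau>, where one-sided
    and two-sided time derivatives agree, and so it may be differentiated in t.\<close>
  have dinn: "ut j (inn j, t) = (\<Sum>k=1..n. p j k * ut k (out k, t))" if "j \<in> {1..n}" "\<tau> < t" for j t
  proof (rule DERIV_unique)
    have "at t within {\<tau>..} = at t" by (rule at_within_interior) (use that in \<open>simp add: interior_Ici\<close>)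
    then show "((\<lambda>t. u j (inn j, t)) has_real_derivative ut j (inn j, t)) (at t)"
      using has_cont_partialsD(5)[OF solD(1)[OF bsol_sol[OF u] that(1)] inn01[of j], of t] that(2) by simp
    have "((\<lambda>t. \<Sum>k=1..n. p j k * u k (out k, t)) has_real_derivative (\<Sum>k=1..n. p j k * ut k (out k, t))) (at t)"
      by (intro DERIV_sum DERIV_cmult dtr that)
    then show "((\<lambda>t. u j (inn j, t)) has_real_derivative (\<Sum>k=1..n. p j k * ut k (out k, t))) (at t)"
      by (rule has_field_derivative_transform_within_open[of _ _ _ "{\<tau><..}"]) (use that bsol_bc[OF u] in auto)
  qed
  have step: "\<bar>ut j (x, t) - E j x t * (\<Sum>k=1..n. p j k * ut k (out k, fl j x t (inn j)))\<bar> \<le> K2 (exp (2 * Q)) * M"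
    if j: "j \<in> {1..n}" and t: "\<tau>' + Q < t" "t \<le> S - Q" and x: "x \<in> {0..1}" for j t x
  proof -
    have w: "fl j x t \<eta> \<in> {\<tau>'..S}" "\<tau> < fl j x t \<eta>" "\<tau> \<le> fl j x t \<eta>" if "\<eta> \<in> {0..1}" for \<eta>
      using fl(3)[OF j x that, of t] t \<tau>' by auto
    have "\<bar>exp (Ar j x t x + At j x t x) * ut j (x, fl j x t x) - exp (Ar j x t (inn j) + At j x t (inn j)) * ut j (inn j, fl j x t (inn j))\<bar> \<le> K2 (exp (2 * Q)) * M"
      by (rule transport_derivative_bound[OF bsol_sol[OF u] j fl(1)[OF j x] w(3) M[OF w(1)] weights(2)[OF j x] weights(4)[OF j x] inn01 x])
    then show ?thesis
      using dinn[OF j w(2)[OF inn01]] by (simp add: E_def ArAt(3,4)[OF j x] fl(2)[OF j x])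
  qed
  have trd: "(tr \<tau> u k has_real_derivative ut k (out k, t)) (at t)" if "k \<in> {1..n}" "\<tau> < t" for k t
    by (rule has_field_derivative_transform_within_open[OF dtr[OF that], of "{\<tau><..}"])
      (use that in \<open>auto simp: tr_def max_absorb2\<close>)
  have trb: "\<bar>tr \<tau> u k t\<bar> \<le> M" if "k \<in> {1..n}" "t \<in> {\<tau>'..S}" for k t
    using M[OF that(2,1) out01[of k]] that(2) \<tau>' by (simp add: tr_def max_absorb2)
  have h: "\<bar>tr \<tau> u j t - G (tr \<tau> u) j t\<bar> \<le> (1 + \<Gamma>) * M \<and>
     (\<exists>D. ((\<lambda>t. tr \<tau> u j t - G (tr \<tau> u) j t) has_real_derivative D) (at t) \<and> \<bar>D\<bar> \<le> (K2 (exp (2 * Q)) + C\<gamma> * (n * Pm)) * M)"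
    if j: "j \<in> {1..n}" and t: "\<tau>' + Q < t" "t \<le> S - Q" for j t
  proof -
    have s: "\<sigma> j t \<in> {\<tau>'..S}" "\<tau> < \<sigma> j t" "t \<in> {\<tau>'..S}" "\<tau> < t"
      using \<sigma>_dist[OF j, of t] t Q0 \<tau>' by auto
    have "\<bar>G (tr \<tau> u) j t\<bar> \<le> \<Gamma> * M" by (rule G_bound[where g = "tr \<tau> u", OF j trb[OF _ s(1)]])
    then have 1: "\<bar>tr \<tau> u j t - G (tr \<tau> u) j t\<bar> \<le> (1 + \<Gamma>) * M"
      using trb[OF j s(3)] by (simp add: algebra_simps abs_le_iff)
    obtain D where D: "(G (tr \<tau> u) j has_real_derivative D) (at t)"
      "\<bar>D - E j (out j) t * (\<Sum>k=1..n. p j k * ut k (out k, \<sigma> j t))\<bar> \<le> C\<gamma> * (n * Pm) * M"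
      using G_deriv[where g = "tr \<tau> u" and g' = "\<lambda>k. ut k (out k, \<sigma> j t)" and D = M, OF j trd[OF _ s(2)] trb[OF _ s(1)]]
      unfolding E_def by blast
    have "((\<lambda>t. tr \<tau> u j t - G (tr \<tau> u) j t) has_real_derivative ut j (out j, t) - D) (at t)"
      by (rule DERIV_diff[OF trd[OF j s(4)] D(1)])
    \<comment> \<open>The reflected term kept exact in \<open>G_deriv\<close> is the one in
      \<open>step\<close>, so the defect has a bounded derivative although neither of its two parts
      is controlled yet.\<close>
    moreover have "\<bar>ut j (out j, t) - D\<bar> \<le> (K2 (exp (2 * Q)) + C\<gamma> * (n * Pm)) * M"
      using D(2) step[OF j t out01[of j]] unfolding \<sigma>_eq distrib_right by linarith
    ultimately show ?thesis using 1 by blast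
  qed
  have K20: "0 \<le> K2 (exp (2 * Q))"
    using Q0 CH0 by (simp add: K2_def)
  have KD: "1 + \<Gamma> \<le> KD" "K2 (exp (2 * Q)) + C\<gamma> * (n * Pm) \<le> KD" "0 \<le> KD"
    using \<Gamma>0 K20 Pm0 Q0 by (auto simp: KD_def C\<gamma>_def intro!: add_nonneg_nonneg)
  have it: "\<bar>tr \<tau> u j t - (G ^^ i) (tr \<tau> u) j t\<bar> \<le> KD * geo \<Delta> i * M \<and>
     (\<exists>D. ((\<lambda>t. tr \<tau> u j t - (G ^^ i) (tr \<tau> u) j t) has_real_derivative D) (at t) \<and> \<bar>D\<bar> \<le> KD * geo \<Delta> i * M)"
    if "j \<in> {1..n}" "\<tau>' + i * Q < t" "t \<le> S - i * Q" for i j t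
    using that
  proof (induction i arbitrary: j t)
    case 0
    then show ?case by (auto intro!: exI[of _ 0])
  next
    case (Suc i)
    define d where "d = (\<lambda>k s. tr \<tau> u k s - (G ^^ i) (tr \<tau> u) k s)"
    define A where "A = KD * geo \<Delta> i * M"
    have iQ: "0 \<le> i * Q" using Q0 by simp
    have s: "\<tau>' + i * Q < \<sigma> j t" "\<sigma> j t \<le> S - i * Q"
      using \<sigma>_dist[OF Suc.prems(1), of t] Suc.prems(2,3) by (auto simp: algebra_simps)
    have A0: "0 \<le> A" using Suc.IH[OF Suc.prems(1) s] unfolding A_def by linarith
    have b: "\<bar>d k (\<sigma> j t)\<bar> \<le> A" if "k \<in> {1..n}" for k
      using Suc.IH[OF that s] by (simp add: d_def A_def)
    have "\<forall>k\<in>{1..n}. \<exists>D. (d k has_real_derivative D) (at (\<sigma> j t)) \<and> \<bar>D\<bar> \<le> A"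
      using Suc.IH[OF _ s] by (simp add: d_def A_def)
    then obtain d' where d': "\<And>k. k \<in> {1..n} \<Longrightarrow> (d k has_real_derivative d' k) (at (\<sigma> j t))" "\<And>k. k \<in> {1..n} \<Longrightarrow> \<bar>d' k\<bar> \<le> A"
      unfolding bchoice_iff by blast
    obtain e where e: "(G d j has_real_derivative e) (at t)"
      "\<bar>e - E j (out j) t * (\<Sum>k=1..n. p j k * d' k)\<bar> \<le> C\<gamma> * (n * Pm) * A"
      using G_deriv[where g = d and g' = d' and D = A, OF Suc.prems(1) d'(1) b] unfolding E_def by blast
    have "\<bar>E j (out j) t * (\<Sum>k=1..n. p j k * d' k)\<bar> \<le> exp (2 * Q) * (n * Pm * A)"
      unfolding abs_mult using Eb[OF Suc.prems(1) out01[of j], of t] sum_p_bound[OF Suc.prems(1) d'(2)] by (intro mult_mono) auto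
    then have "\<bar>e\<bar> \<le> (C\<gamma> * (n * Pm) + exp (2 * Q) * (n * Pm)) * A"
      using e(2) by (simp add: algebra_simps abs_le_iff)
    also have "\<dots> \<le> \<Delta> * A" by (rule mult_right_mono[OF \<Delta>0(3) A0])
    finally have e': "\<bar>e\<bar> \<le> \<Delta> * A" .
    have Gd: "\<bar>G d j t\<bar> \<le> \<Delta> * A"
      using G_bound[where g = d, OF Suc.prems(1) b] mult_right_mono[OF \<Delta>0(2) A0] by (rule order_trans)
    have hh: "\<tau>' + Q < t" "t \<le> S - Q" using Suc.prems iQ by (auto simp: algebra_simps)
    obtain D where D: "((\<lambda>t. tr \<tau> u j t - G (tr \<tau> u) j t) has_real_derivative D) (at t)" "\<bar>D\<bar> \<le> KD * M"
      and h1: "\<bar>tr \<tau> u j t - G (tr \<tau> u) j t\<bar> \<le> KD * M"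
      using h[OF Suc.prems(1) hh] mult_right_mono[OF KD(1) M0] mult_right_mono[OF KD(2) M0] by (meson order_trans)
    have eq: "(\<lambda>t. tr \<tau> u j t - (G ^^ Suc i) (tr \<tau> u) j t) = (\<lambda>t. (tr \<tau> u j t - G (tr \<tau> u) j t) + G d j t)"
      unfolding G_step d_def ..
    have geo: "KD * geo \<Delta> (Suc i) * M = KD * M + \<Delta> * A" by (simp add: geo_Suc A_def algebra_simps)
    have "((\<lambda>t. tr \<tau> u j t - (G ^^ Suc i) (tr \<tau> u) j t) has_real_derivative D + e) (at t)"
      unfolding eq by (rule DERIV_add[OF D(1) e(1)])
    moreover have "\<bar>D + e\<bar> \<le> KD * geo \<Delta> (Suc i) * M" unfolding geo using D(2) e' by linarith
    moreover have "\<bar>tr \<tau> u j t - (G ^^ Suc i) (tr \<tau> u) j t\<bar> \<le> KD * geo \<Delta> (Suc i) * M"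
      unfolding geo fun_cong[OF eq] using h1 Gd by linarith
    ultimately show ?case by blast
  qed
  \<comment> \<open>The N-th power of \<open>G\<close> vanishes as a function of time, so
    subtracting it changes neither the trace nor its derivative.\<close>
  have z: "\<bar>ut k (out k, t)\<bar> \<le> KD * geo \<Delta> N * M" if "k \<in> {1..n}" "\<tau>' + N * Q < t" "t \<le> S - N * Q" for k t
  proof -
    note k = that
    obtain D where D: "(tr \<tau> u k has_real_derivative D) (at t)" "\<bar>D\<bar> \<le> KD * geo \<Delta> N * M"
      using it[OF k] tr_nilpotent[OF u k(1)] by auto
    have "\<tau> < t" using that(2) NQ \<tau>' by linarith
    from DERIV_unique[OF D(1) trd[OF that(1) this]] D(2) show ?thesis by simp
  qed
  have t': "\<tau>' + Q < t" "t \<le> S - Q" using t NQ by (auto simp: algebra_simps)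
  let ?s = "fl j x t (inn j)"
  have s: "\<tau>' + N * Q < ?s" "?s \<le> S - N * Q"
    using fl(3)[OF j x inn01[of j], of t] t NQ by (auto simp: algebra_simps)
  have "\<bar>\<Sum>k=1..n. p j k * ut k (out k, ?s)\<bar> \<le> n * Pm * (KD * geo \<Delta> N * M)"
    using z[OF _ s] by (intro sum_p_bound[OF j])
  then have "\<bar>E j x t * (\<Sum>k=1..n. p j k * ut k (out k, ?s))\<bar> \<le> exp (2 * Q) * (n * Pm * (KD * geo \<Delta> N * M))"
    unfolding abs_mult using Eb[OF j x] by (intro mult_mono) auto
  then have "\<bar>ut j (x, t)\<bar> \<le> K2 (exp (2 * Q)) * M + exp (2 * Q) * (n * Pm * (KD * geo \<Delta> N * M))"
    using step[OF j t' x] by linarith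
  then show ?thesis by (simp add: algebra_simps)
qed

text \<open>The sup bound and the derivative bound each lose \<open>(N + 1) * Q\<close> at both ends
  of the window; one spare \<open>Q\<close> for each makes the inequalities strict, which gives 2 (N
  + 2). The window extends equally far beyond t. \<open>K\<close> depends on \<tau> and t through
  the length of the window, which is admissible because only the waiting time has to be
  uniform.\<close>

theorem smoothing_estimate:
  "\<exists>T>0. \<forall>\<tau> t. \<tau> + T \<le> t \<longrightarrow> (\<exists>S\<ge>t. \<exists>K. \<forall>M>0. \<forall>u ux ut. bsol \<tau> u ux ut \<longrightarrow>
     (\<forall>s\<in>{\<tau>..S}. \<forall>j\<in>{1..n}. integral {0..1} (\<lambda>x. (u j (x, s))\<^sup>2) \<le> M\<^sup>2) \<longrightarrow>
     (\<forall>j\<in>{1..n}. \<forall>x\<in>{0..1}. \<bar>u j (x, t)\<bar> \<le> K * M \<and> \<bar>ux j (x, t)\<bar> \<le> K * M))"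
proof (rule exI[of _ "(2 * N + 4) * Q"], intro conjI allI impI)
  show "0 < (2 * N + 4) * Q" using Qpos by simp
  fix \<tau> t assume t: "\<tau> + (2 * N + 4) * Q \<le> t"
  define S where "S = t + (2 * N + 4) * Q"
  define Ks where "Ks = K1 (exp Q) (S - \<tau>) * geo \<Gamma> (Suc N)"
  define Kt where "Kt = (K2 (exp (2 * Q)) + exp (2 * Q) * (n * Pm) * (KD * geo \<Delta> N)) * Ks"
  define K where "K = max Ks (Q * Kt + CH * (n * Ks))"
  define \<tau>' where "\<tau>' = \<tau> + (N + 2) * Q"
  define S' where "S' = S - (N + 2) * Q"
  have NQ: "0 \<le> N * Q" using Q0 by simp
  have e: "real (N + 1) * Q = N * Q + Q" "real (N + 2) * Q = N * Q + 2 * Q" "real (2 * N + 4) * Q = 2 * (N * Q) + 4 * Q"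
    by (simp_all add: algebra_simps)
  show "\<exists>S\<ge>t. \<exists>K. \<forall>M>0. \<forall>u ux ut. bsol \<tau> u ux ut \<longrightarrow>
     (\<forall>s\<in>{\<tau>..S}. \<forall>j\<in>{1..n}. integral {0..1} (\<lambda>x. (u j (x, s))\<^sup>2) \<le> M\<^sup>2) \<longrightarrow>
     (\<forall>j\<in>{1..n}. \<forall>x\<in>{0..1}. \<bar>u j (x, t)\<bar> \<le> K * M \<and> \<bar>ux j (x, t)\<bar> \<le> K * M)"
  proof (rule exI[of _ S], rule conjI, goal_cases)
    case 1
    show ?case using mult_pos_pos[of "2 * N + 4" Q] Qpos unfolding S_def by simp
  next
    case 2
    show ?case
    proof (rule exI[of _ K], intro conjI allI impI ballI)
    fix M u ux ut j x
    assume M0: "0 < (M::real)" and u: "bsol \<tau> u ux ut"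
      and M: "\<forall>s\<in>{\<tau>..S}. \<forall>j\<in>{1..n}. integral {0..1} (\<lambda>x. (u j (x, s))\<^sup>2) \<le> M\<^sup>2"
      and j: "j \<in> {1..n}" and x: "x \<in> {0..(1::real)}"
    have \<tau>S: "\<tau> \<le> S" using t mult_pos_pos[of "2 * N + 4" Q] Qpos unfolding S_def by linarith
    have sup: "\<bar>u k (y, s)\<bar> \<le> Ks * M" if "s \<in> {\<tau>'..S'}" "k \<in> {1..n}" "y \<in> {0..1}" for s k y
      unfolding Ks_def
    proof (rule sup_bound[OF u M0 \<tau>S _ _ _ that(2,3)])
      show "\<tau> + real (N + 1) * Q < s" "s \<le> S - real (N + 1) * Q"
        using that(1) Qpos by (auto simp: \<tau>'_def S'_def algebra_simps)
    qed (use M in auto)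
    have tt: "\<tau>' + real (N + 1) * Q < t" "t < S' - real (N + 1) * Q" "t \<in> {\<tau>'..S'}" "\<tau> \<le> t" "\<tau> \<le> \<tau>'"
      using t NQ Qpos unfolding \<tau>'_def S'_def S_def e atLeastAtMost_iff by (linarith | intro conjI)+
    have ut: "\<bar>ut j (x, t)\<bar> \<le> Kt * M"
      using derivative_bound[OF u tt(5) sup tt(1,2) j x] by (simp add: Kt_def mult.assoc)
    have "(\<Sum>l=1..n. \<bar>u l (x, t)\<bar>) \<le> (\<Sum>l=1..n. Ks * M)" by (intro sum_mono sup tt x)
    then have "CH * (\<Sum>l=1..n. \<bar>u l (x, t)\<bar>) \<le> CH * (n * (Ks * M))" by (intro mult_left_mono CH0) simp
    then have H: "\<bar>H u j (x, t)\<bar> \<le> CH * (n * (Ks * M))" using H_bound[OF x j, of u t] by linarith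
    \<comment> \<open>The x-derivative is recovered from the equation, using the bounds for u_t and
      for \<open>H\<close>.\<close>
    have "\<bar>f j (x, t) * ut j (x, t)\<bar> \<le> Q * (Kt * M)"
      unfolding abs_mult using coef_bounds(1)[OF x j j] ut Q0 by (intro mult_mono) auto
    then have "\<bar>ux j (x, t)\<bar> \<le> Q * (Kt * M) + CH * (n * (Ks * M))"
      using solD(2)[OF bsol_sol[OF u] j x tt(4)] H by (simp add: abs_le_iff)
    also have "\<dots> = (Q * Kt + CH * (n * Ks)) * M" by (simp add: algebra_simps)
    also have "\<dots> \<le> K * M" unfolding K_def using M0 by (intro mult_right_mono max.cobounded2) simp
    finally show "\<bar>ux j (x, t)\<bar> \<le> K * M" .
    have "Ks * M \<le> K * M" unfolding K_def using M0 by (intro mult_right_mono max.cobounded1) simp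
    then show "\<bar>u j (x, t)\<bar> \<le> K * M" using sup[OF tt(3) j x] by linarith
    qed
  qed
qed

end

section \<open>Density of the test functions\<close>

text \<open>With polynomial \<open>R\<close> this class is closed under differentiation, each
  derivative raising \<open>i\<close> by two, which yields smoothness of every order. The parameter
  \<open>k\<close> flattens the cutoff: as it grows, the exponential factor tends to one inside (c,
  d).\<close>

definition bump :: "real \<Rightarrow> real \<Rightarrow> real \<Rightarrow> (real \<Rightarrow> real) \<Rightarrow> nat \<Rightarrow> real \<Rightarrow> real" where
  "bump c d k R i x = (if c < x \<and> x < d
     then R x / ((x - c) * (d - x)) ^ i * exp (- 1 / (k * ((x - c) * (d - x)))) else 0)"

lemma power_le_fact_exp:
  assumes "0 \<le> (v::real)" shows "v ^ j \<le> fact j * exp v"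
proof -
  have "(\<Sum>i\<in>{j}. v ^ i /\<^sub>R fact i) \<le> (\<Sum>i. v ^ i /\<^sub>R fact i)"
    using exp_converges[of v] assms by (intro sum_le_suminf) (auto simp: sums_iff)
  also have "\<dots> = exp v" using exp_converges[of v] by (simp add: sums_iff)
  finally show ?thesis by (simp add: field_simps)
qed

text \<open>Inside (c, d) this is the quotient rule over a common denominator. Elsewhere, and at the
  endpoints in particular, the exponential beats every power of (x - c) (d - x), so the function is
  quadratically small near the point and the derivative is zero.\<close>

lemma bump_deriv:
  assumes k: "0 < k" and R: "real_polynomial_function R"
  shows "\<exists>R'. real_polynomial_function R' \<and> (\<forall>x. (bump c d k R i has_real_derivative bump c d k R' (i + 2) x) (at x))"
proof -
  obtain R0 where R0: "real_polynomial_function R0" "\<And>x. (R has_real_derivative R0 x) (at x)"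
    using has_real_derivative_polynomial_function[OF R] by blast
  define s where "s = (\<lambda>x. (x - c) * (d - x))"
  define s' where "s' = (\<lambda>x. c + d - 2 * x)"
  define R' where "R' = (\<lambda>x. R0 x * (s x * s x) + (- real i) * (R x * (s' x * s x)) + (1 / k) * (R x * s' x))"
  have lin: "real_polynomial_function (\<lambda>x::real. x)"
    by (rule real_polynomial_function.intros(1)) (rule bounded_linear_ident)
  have rs: "real_polynomial_function s"
    unfolding s_def
    using real_polynomial_function.intros(4)[OF real_polynomial_function_diff[OF lin real_polynomial_function.intros(2)]
      real_polynomial_function_diff[OF real_polynomial_function.intros(2) lin]] by simp
  have rs': "real_polynomial_function s'"
    unfolding s'_def
    using real_polynomial_function_diff[OF real_polynomial_function.intros(2)
      real_polynomial_function.intros(4)[OF real_polynomial_function.intros(2) lin]] by simp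
  have rR': "real_polynomial_function R'"
    unfolding R'_def
    by (intro real_polynomial_function.intros(3) real_polynomial_function.intros(4) rs rs' R0 R real_polynomial_function.intros(2))
  have ds: "(s has_real_derivative s' x) (at x)" for x
    unfolding s_def s'_def by (auto intro!: derivative_eq_intros)
  have "(bump c d k R i has_real_derivative bump c d k R' (i + 2) x) (at x)" for x
  proof (cases "c < x \<and> x < d")
    case True
    then have s0: "s x > 0" by (simp add: s_def)
    have inv: "((\<lambda>x. 1 / s x ^ i) has_real_derivative - (real i * s' x / s x ^ (i + 1))) (at x)"
    proof (cases i)
      case (Suc l)
      have "((\<lambda>x. 1 / s x ^ i) has_real_derivative - (real i * s x ^ (i - 1) * s' x) / (s x ^ i * s x ^ i)) (at x)"
        using s0 ds[of x] by (auto intro!: derivative_eq_intros simp: ac_simps)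
      moreover have "- (real i * s x ^ (i - 1) * s' x) / (s x ^ i * s x ^ i) = - (real i * s' x / s x ^ (i + 1))"
        using s0 Suc by (simp add: field_simps)
      ultimately show ?thesis by simp
    qed simp
    have ex: "((\<lambda>x. exp (- 1 / (k * s x))) has_real_derivative exp (- 1 / (k * s x)) * (s' x / (k * (s x)\<^sup>2))) (at x)"
      using s0 ds[of x] k by (auto intro!: derivative_eq_intros simp: power2_eq_square field_simps)
    have eq: "R0 x * (1 / s x ^ i) + - (real i * s' x / s x ^ (i + 1)) * R x + R x * (1 / s x ^ i) * (s' x / (k * (s x)\<^sup>2)) = R' x / s x ^ (i + 2)"
      using s0 k by (simp add: R'_def field_simps power2_eq_square)
    have "((\<lambda>x. (R x * (1 / s x ^ i)) * exp (- 1 / (k * s x))) has_real_derivative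
        (R0 x * (1 / s x ^ i) + - (real i * s' x / s x ^ (i + 1)) * R x) * exp (- 1 / (k * s x))
          + exp (- 1 / (k * s x)) * (s' x / (k * (s x)\<^sup>2)) * (R x * (1 / s x ^ i))) (at x)"
      by (rule DERIV_mult[OF DERIV_mult[OF R0(2) inv] ex])
    also have "(R0 x * (1 / s x ^ i) + - (real i * s' x / s x ^ (i + 1)) * R x) * exp (- 1 / (k * s x))
          + exp (- 1 / (k * s x)) * (s' x / (k * (s x)\<^sup>2)) * (R x * (1 / s x ^ i))
        = (R' x / s x ^ (i + 2)) * exp (- 1 / (k * s x))"
      unfolding eq[symmetric] by (simp only: distrib_right distrib_left ac_simps)
    finally have "((\<lambda>x. (R x * (1 / s x ^ i)) * exp (- 1 / (k * s x))) has_real_derivative (R' x / s x ^ (i + 2)) * exp (- 1 / (k * s x))) (at x)" .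
    then have "(bump c d k R i has_real_derivative (R' x / s x ^ (i + 2)) * exp (- 1 / (k * s x))) (at x)"
      by (rule has_field_derivative_transform_within_open[of _ _ _ "{c<..<d}"])
        (use True in \<open>auto simp: bump_def s_def\<close>)
    then show ?thesis using True by (simp add: bump_def s_def)
  next
    case False
    have "continuous_on {c..d} R" using R0(2) by (intro DERIV_continuous_on) (rule has_field_derivative_at_within)
    then have "bounded (R ` {c..d})" by (intro compact_imp_bounded compact_continuous_image) auto
    then obtain A where "\<forall>y\<in>R ` {c..d}. norm y \<le> A" unfolding bounded_iff by blast
    then have A: "\<bar>R y\<bar> \<le> A" if "y \<in> {c..d}" for y using that by simp
    define C where "C = A * (fact (i + 2) * k ^ (i + 2)) * (d - c)\<^sup>2"
    have z: "bump c d k R i x = 0" "bump c d k R' (i + 2) x = 0" using False by (auto simp: bump_def)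
    have est: "\<bar>bump c d k R i y\<bar> \<le> \<bar>C\<bar> * \<bar>y - x\<bar>\<^sup>2" for y
    proof (cases "c < y \<and> y < d")
      case True
      then have s0: "s y > 0" by (simp add: s_def)
      have "\<bar>R y\<bar> \<le> A" using A[of y] True by simp
      then have A0: "0 \<le> A" "\<bar>R y\<bar> \<le> A" by linarith+
      define v where "v = 1 / (k * s y)"
      have v0: "v > 0" using s0 k by (simp add: v_def)
      \<comment> \<open>Two powers more than the denominator contains are extracted from the
        exponential; they leave the square of (y - c) (d - y).\<close>
      have "v ^ (i + 2) * exp (- v) \<le> fact (i + 2)"
        using power_le_fact_exp[of v "i + 2"] v0 by (simp add: exp_minus divide_simps)
      then have "exp (- v) \<le> fact (i + 2) * k ^ (i + 2) * s y ^ (i + 2)"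
        using s0 k by (simp add: v_def field_simps)
      then have e: "exp (- v) / s y ^ i \<le> fact (i + 2) * k ^ (i + 2) * (s y)\<^sup>2"
        using s0 by (simp add: divide_le_eq power_add power2_eq_square mult_ac)
      \<comment> \<open>An endpoint lies between x and y, or is x itself, so one factor is at most
        |y - x| and the other at most d - c.\<close>
      have "s y \<le> (d - c) * \<bar>y - x\<bar>"
      proof (cases "x \<le> c")
        case True
        then have "(y - c) * (d - y) \<le> (y - x) * (d - c)" using \<open>c < y \<and> y < d\<close> by (intro mult_mono) auto
        then show ?thesis using True \<open>c < y \<and> y < d\<close> by (simp add: s_def mult.commute)
      next
        case False
        then have "(y - c) * (d - y) \<le> (d - c) * (x - y)" using \<open>c < y \<and> y < d\<close> \<open>\<not> (c < x \<and> x < d)\<close> by (intro mult_mono) auto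
        then show ?thesis using False \<open>c < y \<and> y < d\<close> \<open>\<not> (c < x \<and> x < d)\<close> by (simp add: s_def)
      qed
      then have s2: "(s y)\<^sup>2 \<le> ((d - c) * \<bar>y - x\<bar>)\<^sup>2" using s0 by (intro power_mono) auto
      have "\<bar>bump c d k R i y\<bar> = \<bar>R y\<bar> * (exp (- v) / s y ^ i)"
        using True s0 by (simp add: bump_def s_def v_def abs_mult)
      also have "\<dots> \<le> A * (fact (i + 2) * k ^ (i + 2) * (s y)\<^sup>2)"
        using A0 e s0 by (intro mult_mono) auto
      also have "\<dots> \<le> A * (fact (i + 2) * k ^ (i + 2) * ((d - c) * \<bar>y - x\<bar>)\<^sup>2)"
        using A0 s2 k by (intro mult_left_mono) auto
      also have "\<dots> = C * \<bar>y - x\<bar>\<^sup>2" by (simp add: C_def power_mult_distrib)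
      also have "\<dots> \<le> \<bar>C\<bar> * \<bar>y - x\<bar>\<^sup>2" by (intro mult_right_mono) auto
      finally show ?thesis .
    qed (auto simp: bump_def)
    have "((\<lambda>y. (bump c d k R i y - bump c d k R i x) / (y - x)) \<longlongrightarrow> 0) (at x)"
    proof (rule Lim_null_comparison)
      show "((\<lambda>y. \<bar>C\<bar> * \<bar>y - x\<bar>) \<longlongrightarrow> 0) (at x)"
        by (auto intro!: tendsto_eq_intros)
      have "norm ((bump c d k R i y - bump c d k R i x) / (y - x)) \<le> \<bar>C\<bar> * \<bar>y - x\<bar>" if "y \<noteq> x" for y
        using est[of y] that by (simp add: z divide_le_eq power2_eq_square)
      then show "\<forall>\<^sub>F y in at x. norm ((bump c d k R i y - bump c d k R i x) / (y - x)) \<le> \<bar>C\<bar> * \<bar>y - x\<bar>"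
        by (simp add: eventually_at_filter)
    qed
    then show ?thesis unfolding has_field_derivative_iff z(2) .
  qed
  then show ?thesis using rR' by blast
qed

lemma bump_smooth:
  assumes k: "0 < k" and R: "real_polynomial_function R"
  shows "(deriv ^^ l) (bump c d k R i) differentiable_on UNIV"
proof -
  have "\<exists>R i'. real_polynomial_function R \<and> (deriv ^^ l) (bump c d k R0 i) = bump c d k R i'"
    if "real_polynomial_function R0" for R0
  proof (induction l)
    case 0
    then show ?case using that by auto
  next
    case (Suc l)
    then obtain R1 i' where R1: "real_polynomial_function R1" "(deriv ^^ l) (bump c d k R0 i) = bump c d k R1 i'" by blast
    obtain R2 where R2: "real_polynomial_function R2" "\<And>x. (bump c d k R1 i' has_real_derivative bump c d k R2 (i' + 2) x) (at x)"
      using bump_deriv[OF k R1(1)] by blast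
    have "deriv (bump c d k R1 i') = bump c d k R2 (i' + 2)"
      using R2(2) by (intro ext DERIV_imp_deriv)
    then show ?case using R1(2) R2(1) by auto
  qed
  then obtain R1 i' where R1: "real_polynomial_function R1" "(deriv ^^ l) (bump c d k R i) = bump c d k R1 i'" using R by blast
  obtain R2 where "\<And>x. (bump c d k R1 i' has_real_derivative bump c d k R2 (i' + 2) x) (at x)"
    using bump_deriv[OF k R1(1)] by blast
  then show ?thesis
    unfolding R1(2) differentiable_on_def
    by (metis differentiable_at_withinI differentiable_def has_field_derivative_def)
qed

section \<open>Approximation on the unit interval by smooth compactly supported functions\<close>

abbreviation I01 :: "real measure" where "I01 \<equiv> lebesgue_on {0<..<1}"

lemma finite_measure_I01: "finite_measure I01"
  by (intro finite_measureI) (simp add: emeasure_restrict_space space_restrict_space)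

text \<open>Passage to negligible sets, the language in which continuous approximation of measurable
  functions is phrased.\<close>

lemma AE_I01_iff: "(AE x in I01. P x) \<longleftrightarrow> (\<exists>N. negligible N \<and> (\<forall>x\<in>{0<..<1} - N. P x))"
proof -
  have "(AE x in I01. P x) \<longleftrightarrow> (AE x in lebesgue. x \<in> {0<..<1} \<longrightarrow> P x)"
    by (rule AE_restrict_space_iff) simp
  also have "\<dots> \<longleftrightarrow> (\<exists>N\<in>null_sets lebesgue. {x \<in> space lebesgue. \<not> (x \<in> {0<..<1} \<longrightarrow> P x)} \<subseteq> N)"
    unfolding eventually_ae_filter ..
  also have "\<dots> \<longleftrightarrow> (\<exists>N. negligible N \<and> (\<forall>x\<in>{0<..<1} - N. P x))"
  proof
    assume "\<exists>N\<in>null_sets lebesgue. {x \<in> space lebesgue. \<not> (x \<in> {0<..<1} \<longrightarrow> P x)} \<subseteq> N"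
    then obtain N where N: "N \<in> null_sets lebesgue" "{x \<in> space lebesgue. \<not> (x \<in> {0<..<1} \<longrightarrow> P x)} \<subseteq> N" by blast
    have "P x" if "x \<in> {0<..<1} - N" for x
      using that subsetD[OF N(2), of x] by (cases "P x") auto
    then show "\<exists>N. negligible N \<and> (\<forall>x\<in>{0<..<1} - N. P x)"
      using N(1) unfolding negligible_iff_null_sets by blast
  next
    assume "\<exists>N. negligible N \<and> (\<forall>x\<in>{0<..<1} - N. P x)"
    then obtain N where N: "N \<in> null_sets lebesgue" "\<forall>x\<in>{0<..<1} - N. P x"
      unfolding negligible_iff_null_sets by blast
    have "{x \<in> space lebesgue. \<not> (x \<in> {0<..<1} \<longrightarrow> P x)} \<subseteq> N"
      using N(2) by auto
    then show "\<exists>N\<in>null_sets lebesgue. {x \<in> space lebesgue. \<not> (x \<in> {0<..<1} \<longrightarrow> P x)} \<subseteq> N"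
      using N(1) by blast
  qed
  finally show ?thesis .
qed

text \<open>Completeness of Lebesgue measure. Values of the evolution family are specified only up
  to equality almost everywhere, so their measurability has to be inherited from a
  representative.\<close>

lemma measurable_I01_AE_cong:
  fixes g h :: "real \<Rightarrow> real"
  assumes "g \<in> borel_measurable I01" "AE x in I01. g x = h x"
  shows "h \<in> borel_measurable I01"
proof -
  obtain N where N: "negligible N" "\<And>x. x \<in> {0<..<1} - N \<Longrightarrow> g x = h x"
    using assms(2) unfolding AE_I01_iff by blast
  have "g measurable_on {0<..<1}" using assms(1) by (simp add: measurable_on_iff_borel_measurable)
  then have "h measurable_on {0<..<1}"
    by (rule measurable_on_spike[OF _ N(1)]) (use N(2) in auto)
  then show ?thesis by (simp add: measurable_on_iff_borel_measurable)
qed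

lemma continuous_I01_measurable:
  fixes h :: "real \<Rightarrow> real"
  shows "continuous_on {0<..<1} h \<Longrightarrow> h \<in> borel_measurable I01"
  by (rule continuous_imp_measurable_on_sets_lebesgue) auto

text \<open>Measurability supplies continuous functions converging almost everywhere. They are
  clamped to [-B, B] for domination, replaced by polynomials because these are the admissible
  factors in \<open>bump\<close>, and multiplied by a cutoff; dominated convergence gives
  convergence in mean square.\<close>

lemma bounded_measurable_approx:
  fixes g :: "real \<Rightarrow> real"
  assumes g: "g \<in> borel_measurable I01" and B: "\<And>x. \<bar>g x\<bar> \<le> B"
  shows "\<exists>q. (\<forall>l. (\<forall>r. (deriv ^^ r) (q l) differentiable_on UNIV) \<and>
       (\<exists>K. compact K \<and> K \<subseteq> {0<..<1} \<and> (\<forall>x. x \<notin> K \<longrightarrow> q l x = 0))) \<and>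
     (\<forall>l. integrable I01 (\<lambda>x. (q l x - g x)\<^sup>2)) \<and> (\<lambda>l. LINT x|I01. (q l x - g x)\<^sup>2) \<longlonglongrightarrow> 0"
proof -
  interpret finite_measure I01 by (rule finite_measure_I01)
  have B0: "0 \<le> B" using B[of 0] by linarith
  have "g measurable_on {0<..<1}" using g by (simp add: measurable_on_iff_borel_measurable)
  then obtain Z h where Z: "negligible Z" and h: "\<And>l::nat. continuous_on UNIV (h l)"
    and hl: "\<And>x. x \<notin> Z \<Longrightarrow> (\<lambda>l. h l x) \<longlonglongrightarrow> (if x \<in> {0<..<1} then g x else 0)"
    unfolding measurable_on_def by blast
  define H where "H = (\<lambda>l x. max (- B) (min B (h l x)))"
  have H: "continuous_on {0..1} (H l)" for l
    unfolding H_def by (intro continuous_intros continuous_on_subset[OF h]) auto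
  have Hb: "\<bar>H l x\<bar> \<le> B" for l x using B0 by (auto simp: H_def)
  have Hl: "(\<lambda>l. H l x) \<longlonglongrightarrow> g x" if "x \<in> {0<..<1} - Z" for x
  proof -
    have "(\<lambda>l. H l x) \<longlonglongrightarrow> max (- B) (min B (g x))"
      unfolding H_def using hl[of x] that by (intro tendsto_intros) auto
    moreover have "max (- B) (min B (g x)) = g x" using B[of x] by auto
    ultimately show ?thesis by simp
  qed
  have "\<exists>p. real_polynomial_function p \<and> (\<forall>x\<in>{0..1}. \<bar>H l x - p x\<bar> < inverse (real (Suc l)))" for l
    using Stone_Weierstrass_real_polynomial_function[OF compact_Icc H[of l], of "inverse (real (Suc l))"] by (metis inverse_positive_iff_positive of_nat_0_less_iff zero_less_Suc)
  then obtain p where p: "\<And>l. real_polynomial_function (p l)"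
    and pH: "\<And>l x. x \<in> {0..1} \<Longrightarrow> \<bar>H l x - p l x\<bar> < inverse (real (Suc l))" by metis
  \<comment> \<open>Positive margins keep the support compact in (0, 1). Margins tending to zero,
    together with the growing factor \<open>Suc l\<close> in the exponent, make the cutoff tend to
    one pointwise.\<close>
  define c where "c = (\<lambda>l::nat. inverse (real (Suc l)) / 3)"
  have c: "0 < c l" "c l \<le> 1/3" for l by (auto simp: c_def field_simps)
  have clim: "c \<longlonglongrightarrow> 0" unfolding c_def using tendsto_divide[OF LIMSEQ_inverse_real_of_nat tendsto_const, of 3] by simp
  define q where "q = (\<lambda>l. bump (c l) (1 - c l) (real (Suc l)) (p l) 0)"
  have qb: "\<bar>q l x\<bar> \<le> B + 1" if "x \<in> {0<..<1}" for l x
  proof -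
    have "inverse (real (Suc l)) \<le> 1" by (simp add: field_simps)
    then have pb: "\<bar>p l x\<bar> \<le> B + 1" using pH[of x l] Hb[of l x] that by auto
    show ?thesis
    proof (cases "c l < x \<and> x < 1 - c l")
      case True
      then have "0 < (x - c l) * (1 - c l - x)" by simp
      then have "exp (- 1 / (real (Suc l) * ((x - c l) * (1 - c l - x)))) \<le> 1" by simp
      then have "\<bar>p l x\<bar> * exp (- 1 / (real (Suc l) * ((x - c l) * (1 - c l - x)))) \<le> (B + 1) * 1"
        using pb B0 by (intro mult_mono) auto
      then show ?thesis using True by (simp add: q_def bump_def abs_mult)
    qed (use B0 in \<open>auto simp: q_def bump_def\<close>)
  qed
  have ql: "(\<lambda>l. q l x) \<longlonglongrightarrow> g x" if x: "x \<in> {0<..<1} - Z" for x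
  proof -
    have pl: "(\<lambda>l. p l x) \<longlonglongrightarrow> g x"
    proof -
      have "(\<lambda>l. p l x - H l x) \<longlonglongrightarrow> 0"
      proof (rule Lim_null_comparison[OF _ LIMSEQ_inverse_real_of_nat])
        have "norm (p l x - H l x) \<le> inverse (real (Suc l))" for l
          using pH[of x l] x by (auto simp: abs_minus_commute less_imp_le)
        then show "\<forall>\<^sub>F l in sequentially. norm (p l x - H l x) \<le> inverse (real (Suc l))" by simp
      qed
      from tendsto_add[OF this Hl[OF x]] show ?thesis by simp
    qed
    have sl: "(\<lambda>l. (x - c l) * (1 - c l - x)) \<longlonglongrightarrow> (x - 0) * (1 - 0 - x)"
      by (intro tendsto_intros clim)
    have "(\<lambda>l. - inverse (real (Suc l)) / ((x - c l) * (1 - c l - x))) \<longlonglongrightarrow> - 0 / ((x - 0) * (1 - 0 - x))"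
      using x by (intro tendsto_intros LIMSEQ_inverse_real_of_nat clim) auto
    then have "(\<lambda>l. exp (- inverse (real (Suc l)) / ((x - c l) * (1 - c l - x)))) \<longlonglongrightarrow> exp 0"
      by (intro tendsto_exp) simp
    from tendsto_mult[OF pl this]
    have lim: "(\<lambda>l. p l x * exp (- inverse (real (Suc l)) / ((x - c l) * (1 - c l - x)))) \<longlonglongrightarrow> g x" by simp
    have "\<forall>\<^sub>F l in sequentially. c l < min x (1 - x)"
      using x by (intro order_tendstoD(2)[OF clim]) auto
    then have "\<forall>\<^sub>F l in sequentially. p l x * exp (- inverse (real (Suc l)) / ((x - c l) * (1 - c l - x))) = q l x"
      by eventually_elim (auto simp: q_def bump_def divide_inverse mult_ac)
    then show ?thesis using lim by (rule Lim_transform_eventually[rotated])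
  qed
  have qcont: "continuous_on {0<..<1} (q l)" for l
    using bump_smooth[of "real (Suc l)" "p l" 0 "c l" "1 - c l" 0] p
    by (auto simp: q_def intro: differentiable_imp_continuous_on continuous_on_subset)
  have qm: "q l \<in> borel_measurable I01" for l by (rule continuous_I01_measurable[OF qcont])
  have dom: "(q l x - g x)\<^sup>2 \<le> (2 * B + 1)\<^sup>2" if "x \<in> {0<..<1}" for l x
  proof -
    have "\<bar>q l x - g x\<bar> \<le> 2 * B + 1" using qb[OF that, of l] B[of x] by linarith
    then have "\<bar>q l x - g x\<bar>\<^sup>2 \<le> (2 * B + 1)\<^sup>2" by (intro power_mono) auto
    then show ?thesis by simp
  qed
  have int: "integrable I01 (\<lambda>x. (q l x - g x)\<^sup>2)" for l
    by (rule integrable_const_bound[where B = "(2 * B + 1)\<^sup>2"])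
      (use dom qm g in \<open>auto simp: space_restrict_space intro!: AE_I2\<close>)
  have "(\<lambda>l. LINT x|I01. (q l x - g x)\<^sup>2) \<longlonglongrightarrow> (LINT x|I01. 0)"
  proof (rule integral_dominated_convergence[where w = "\<lambda>_. (2 * B + 1)\<^sup>2"])
    have "\<forall>x\<in>{0<..<1} - Z. (\<lambda>l. (q l x - g x)\<^sup>2) \<longlonglongrightarrow> 0"
      using ql by (auto intro!: tendsto_eq_intros)
    then show "AE x in I01. (\<lambda>l. (q l x - g x)\<^sup>2) \<longlonglongrightarrow> 0"
      unfolding AE_I01_iff using Z by blast
    show "AE x in I01. norm ((q l x - g x)\<^sup>2) \<le> (2 * B + 1)\<^sup>2" for l
      using dom by (auto simp: space_restrict_space intro!: AE_I2)
  qed (use qm g in auto)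
  moreover have "\<exists>K. compact K \<and> K \<subseteq> {0<..<1} \<and> (\<forall>x. x \<notin> K \<longrightarrow> q l x = 0)" for l
    using c[of l] by (intro exI[of _ "{c l..1 - c l}"]) (auto simp: q_def bump_def)
  moreover have "(deriv ^^ r) (q l) differentiable_on UNIV" for l r
    unfolding q_def by (rule bump_smooth[OF _ p]) simp
  ultimately show ?thesis using int by (intro exI[of _ q] conjI allI) simp_all
qed

lemma L2_approx:
  fixes g :: "real \<Rightarrow> real"
  assumes g: "g \<in> borel_measurable I01" "integrable I01 (\<lambda>x. (g x)\<^sup>2)" and e: "0 < e"
  shows "\<exists>q. (\<forall>r. (deriv ^^ r) q differentiable_on UNIV) \<and>
       (\<exists>K. compact K \<and> K \<subseteq> {0<..<1} \<and> (\<forall>x. x \<notin> K \<longrightarrow> q x = 0)) \<and> (LINT x|I01. (q x - g x)\<^sup>2) < e"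
proof -
  define t where "t = (\<lambda>B::nat. \<lambda>x. max (- real B) (min (real B) (g x)))"
  have tm: "t B \<in> borel_measurable I01" for B unfolding t_def using g(1) by simp
  have td: "(t B x - g x)\<^sup>2 \<le> (g x)\<^sup>2" for B x
  proof -
    have "\<bar>t B x - g x\<bar> \<le> \<bar>g x\<bar>" by (auto simp: t_def)
    then show ?thesis by (simp add: abs_le_square_iff)
  qed
  have "(\<lambda>B. LINT x|I01. (t B x - g x)\<^sup>2) \<longlonglongrightarrow> (LINT x|I01. 0)"
  proof (rule integral_dominated_convergence[where w = "\<lambda>x. (g x)\<^sup>2"])
    have "(\<lambda>B. (t B x - g x)\<^sup>2) \<longlonglongrightarrow> 0" for x
    proof (rule tendsto_eventually)
      obtain B0 :: nat where "\<bar>g x\<bar> \<le> real B0" using real_arch_simple by blast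
      then have "\<forall>B\<ge>B0. (t B x - g x)\<^sup>2 = 0" by (auto simp: t_def)
      then show "\<forall>\<^sub>F B in sequentially. (t B x - g x)\<^sup>2 = 0" unfolding eventually_sequentially by blast
    qed
    then show "AE x in I01. (\<lambda>B. (t B x - g x)\<^sup>2) \<longlonglongrightarrow> 0" by simp
  qed (use td tm g in auto)
  \<comment> \<open>The threshold e / 4 compensates the factor 2 that the squared triangle
    inequality puts before each of the two errors, truncation and smoothing.\<close>
  then have "\<forall>\<^sub>F B in sequentially. (LINT x|I01. (t B x - g x)\<^sup>2) < e / 4"
    using e by (intro order_tendstoD(2)) auto
  then obtain B where B: "(LINT x|I01. (t B x - g x)\<^sup>2) < e / 4" by (auto simp: eventually_sequentially)
  have it: "integrable I01 (\<lambda>x. (t B x - g x)\<^sup>2)"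
    by (rule Bochner_Integration.integrable_bound[OF g(2)]) (use td tm g in \<open>auto\<close>)
  have "\<bar>t B x\<bar> \<le> real B" for x by (auto simp: t_def)
  from bounded_measurable_approx[OF tm this]
  obtain q where q: "\<And>l r. (deriv ^^ r) (q l) differentiable_on UNIV"
     "\<And>l. \<exists>K. compact K \<and> K \<subseteq> {0<..<1} \<and> (\<forall>x. x \<notin> K \<longrightarrow> q l x = 0)"
     "\<And>l::nat. integrable I01 (\<lambda>x. (q l x - t B x)\<^sup>2)" "(\<lambda>l. LINT x|I01. (q l x - t B x)\<^sup>2) \<longlonglongrightarrow> 0" by blast
  have "\<forall>\<^sub>F l in sequentially. (LINT x|I01. (q l x - t B x)\<^sup>2) < e / 4"
    using e q(4) by (intro order_tendstoD(2)) auto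
  then obtain l where l: "(LINT x|I01. (q l x - t B x)\<^sup>2) < e / 4" by (auto simp: eventually_sequentially)
  have "(LINT x|I01. (q l x - g x)\<^sup>2) \<le> (LINT x|I01. 2 * (q l x - t B x)\<^sup>2 + 2 * (t B x - g x)\<^sup>2)"
  proof (rule integral_mono')
    show "integrable I01 (\<lambda>x. 2 * (q l x - t B x)\<^sup>2 + 2 * (t B x - g x)\<^sup>2)" using q(3)[of l] it by simp
    fix x
    have "0 \<le> ((q l x - t B x) - (t B x - g x))\<^sup>2" by simp
    then show "(q l x - g x)\<^sup>2 \<le> 2 * (q l x - t B x)\<^sup>2 + 2 * (t B x - g x)\<^sup>2"
      by (simp add: power2_eq_square algebra_simps)
  qed simp
  also have "\<dots> = 2 * (LINT x|I01. (q l x - t B x)\<^sup>2) + 2 * (LINT x|I01. (t B x - g x)\<^sup>2)"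
    using q(3)[of l] it by simp
  also have "\<dots> < e" using l B by simp
  finally have "(LINT x|I01. (q l x - g x)\<^sup>2) < e" .
  then show ?thesis by (intro exI[of _ "q l"] conjI allI q(1,2))
qed

lemma L2_norm_less:
  assumes "1 \<le> n" "\<And>j. j \<in> {1..n} \<Longrightarrow> (LINT x|I01. (\<phi> j x)\<^sup>2) < e\<^sup>2" "0 < e"
  shows "L2_norm n \<phi> < e"
proof -
  have "sqrt (LINT x|I01. (\<phi> j x)\<^sup>2) < e" if "j \<in> {1..n}" for j
    using real_sqrt_less_mono[OF assms(2)[OF that]] assms(3) by simp
  then show ?thesis unfolding L2_norm_def using assms(1) by (subst Max_less_iff) auto
qed

lemma L2_norm_component:
  assumes "j \<in> {1..n}"
  shows "sqrt (LINT x|I01. (\<phi> j x)\<^sup>2) \<le> L2_norm n \<phi>" "(LINT x|I01. (\<phi> j x)\<^sup>2) \<le> (L2_norm n \<phi>)\<^sup>2" "0 \<le> L2_norm n \<phi>"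
proof -
  show 1: "sqrt (LINT x|I01. (\<phi> j x)\<^sup>2) \<le> L2_norm n \<phi>"
    unfolding L2_norm_def using assms by (intro Max_ge) auto
  have nn: "0 \<le> (LINT x|I01. (\<phi> j x)\<^sup>2)" by (rule Bochner_Integration.integral_nonneg) simp
  show 0: "0 \<le> L2_norm n \<phi>" using 1 nn by (meson order_trans real_sqrt_ge_zero)
  show "(LINT x|I01. (\<phi> j x)\<^sup>2) \<le> (L2_norm n \<phi>)\<^sup>2"
    using power_mono[OF 1, of 2] nn by simp
qed

lemma test_fun_dense:
  assumes "1 \<le> n" "\<phi> \<in> L2 n"
  obtains \<phi>s where "\<And>l::nat. \<phi>s l \<in> test_fun n" "(\<lambda>l. L2_norm n (vec_diff (\<phi>s l) \<phi>)) \<longlonglongrightarrow> 0"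
proof -
  have "\<exists>\<psi>\<in>test_fun n. L2_norm n (vec_diff \<psi> \<phi>) < e" if e: "0 < e" for e
  proof -
    have "\<forall>j\<in>{1..n}. \<exists>q. (\<forall>r. (deriv ^^ r) q differentiable_on UNIV) \<and>
       (\<exists>K. compact K \<and> K \<subseteq> {0<..<1} \<and> (\<forall>x. x \<notin> K \<longrightarrow> q x = 0)) \<and> (LINT x|I01. (q x - \<phi> j x)\<^sup>2) < e\<^sup>2"
      using assms(2) e by (intro ballI L2_approx) (auto simp: L2_def)
    then obtain \<psi> where \<psi>: "\<And>j. j \<in> {1..n} \<Longrightarrow> (\<forall>r. (deriv ^^ r) (\<psi> j) differentiable_on UNIV) \<and>
       (\<exists>K. compact K \<and> K \<subseteq> {0<..<1} \<and> (\<forall>x. x \<notin> K \<longrightarrow> \<psi> j x = 0)) \<and> (LINT x|I01. (\<psi> j x - \<phi> j x)\<^sup>2) < e\<^sup>2"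
      unfolding bchoice_iff by blast
    have "\<psi> \<in> test_fun n" using \<psi> by (simp add: test_fun_def)
    moreover have "L2_norm n (vec_diff \<psi> \<phi>) < e"
      using \<psi> by (intro L2_norm_less assms(1) e) (simp add: vec_diff_def)
    ultimately show ?thesis by blast
  qed
  then have "\<exists>\<psi>\<in>test_fun n. L2_norm n (vec_diff \<psi> \<phi>) < inverse (real (Suc l))" for l by simp
  then obtain \<phi>s where \<phi>s: "\<And>l. \<phi>s l \<in> test_fun n" "\<And>l. L2_norm n (vec_diff (\<phi>s l) \<phi>) < inverse (real (Suc l))" by metis
  have "(\<lambda>l. L2_norm n (vec_diff (\<phi>s l) \<phi>)) \<longlonglongrightarrow> 0"
  proof (rule tendsto_sandwich[OF _ _ tendsto_const LIMSEQ_inverse_real_of_nat])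
    show "\<forall>\<^sub>F l in sequentially. 0 \<le> L2_norm n (vec_diff (\<phi>s l) \<phi>)"
      using L2_norm_component(3)[of 1 n] assms(1) by simp
    show "\<forall>\<^sub>F l in sequentially. L2_norm n (vec_diff (\<phi>s l) \<phi>) \<le> inverse (real (Suc l))"
      using \<phi>s(2) by (simp add: less_imp_le)
  qed
  then show ?thesis using that \<phi>s(1) by blast
qed

section \<open>Classical solutions\<close>

lemma classical_solutionE:
  assumes "classical_solution n m a B p \<tau> \<phi> u"
  obtains ux ut where "\<forall>j\<in>{1..n}. has_cont_partials {\<tau>..} (u j) (ux j) (ut j)"
    "\<forall>j\<in>{1..n}. \<forall>x\<in>{0<..<1}. \<forall>t>\<tau>.
      ut j (x, t) + a j (x, t) * ux j (x, t) + (\<Sum>k\<in>{1..n}. B j k (x, t) * u k (x, t)) = 0"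
  using assms unfolding classical_solution_def by - (elim conjE exE, rule that, assumption, assumption)

text \<open>Divided by a_j, the factor (a_k - a_j) / a_k of the coupling becomes a difference of
  reciprocals, f_j - f_k. The differential equation is given only in the open strip after \<tau>;
  its continuous residual vanishes on the closure as well.\<close>

lemma (in hyp_boundary) classical_imp_bsol:
  assumes a0: "\<And>j z. j \<in> {1..n} \<Longrightarrow> z \<in> strip \<Longrightarrow> a j z \<noteq> 0"
    and bt: "\<And>j k z. j \<in> {1..n} \<Longrightarrow> k \<in> {1..n} \<Longrightarrow> z \<in> strip \<Longrightarrow> bt j k z = \<kappa> j k z / a k z * (a k z - a j z)"
    and u: "classical_solution n m a (\<lambda>j k z. (if j = k then b j z else 0) + bt j k z) p \<tau> \<phi> u"
  shows "\<exists>ux ut. bsol \<tau> u ux ut"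
proof -
  obtain ux ut where 1: "\<forall>j\<in>{1..n}. has_cont_partials {\<tau>..} (u j) (ux j) (ut j)"
    and 2: "\<forall>j\<in>{1..n}. \<forall>x\<in>{0<..<1}. \<forall>t>\<tau>.
      ut j (x, t) + a j (x, t) * ux j (x, t) + (\<Sum>k\<in>{1..n}. ((if j = k then b j (x, t) else 0) + bt j k (x, t)) * u k (x, t)) = 0"
    by (rule classical_solutionE[OF u])
  note h = bspec[OF 1] and pde = 2[THEN bspec, THEN bspec, THEN spec, THEN mp]
  have eq: "ux j (x, t) = - f j (x, t) * ut j (x, t) - H u j (x, t)"
    if j: "j \<in> {1..n}" and x: "x \<in> {0..1}" and t: "\<tau> \<le> t" for j x t
  proof -
    define Rs where "Rs = (\<lambda>z. ux j z + f j z * ut j z + H u j z)"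
    let ?S = "{0<..<1::real} \<times> {\<tau><..}"
    have cl: "closure ?S = {0..1} \<times> {\<tau>..}" by (simp add: closure_Times)
    have "continuous_on ({0..1} \<times> {\<tau>..}) Rs"
      unfolding Rs_def H_def
      by (intro continuous_intros coef_continuous(1-4)[OF _ j] coef_continuous(5-7)[OF j] has_cont_partialsD(1-3)[OF h] j; simp)
    then have "Rs (x, t) = 0"
    proof (rule continuous_constant_on_closure[of ?S, unfolded cl])
      fix z assume "z \<in> ?S"
      then obtain y s where z: "z = (y, s)" and ys: "y \<in> {0<..<1}" "\<tau> < s" by auto
      have st: "(y, s) \<in> strip" using ys by simp
      note aj = a0[OF j st]
      have "(\<Sum>k\<in>{1..n}. ((if j = k then b j (y, s) else 0) + bt j k (y, s)) * u k (y, s))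
          = b j (y, s) * u j (y, s) + (\<Sum>k=1..n. bt j k (y, s) * u k (y, s))"
        using j by (simp add: distrib_right sum.distrib if_distrib[of "\<lambda>v. v * _"] cong: if_cong)
      also have "(\<Sum>k=1..n. bt j k (y, s) * u k (y, s)) = a j (y, s) * (\<Sum>k=1..n. \<kappa> j k (y, s) * (f j (y, s) - f k (y, s)) * u k (y, s))"
        unfolding sum_distrib_left
      proof (rule sum.cong[OF refl])
        fix k assume k: "k \<in> {1..n}"
        show "bt j k (y, s) * u k (y, s) = a j (y, s) * (\<kappa> j k (y, s) * (f j (y, s) - f k (y, s)) * u k (y, s))"
          unfolding bt[OF j k st] f_def using aj a0[OF k st] by (simp add: field_simps)
      qed
      also have "b j (y, s) * u j (y, s) = a j (y, s) * (r j (y, s) * u j (y, s))"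
        unfolding r_def using aj by simp
      finally have "ut j (y, s) + a j (y, s) * ux j (y, s) + a j (y, s) * H u j (y, s) = 0"
        using pde[OF j ys] by (simp add: H_def distrib_left)
      moreover have "ut j (y, s) = a j (y, s) * (f j (y, s) * ut j (y, s))" unfolding f_def using aj by simp
      ultimately have "a j (y, s) * Rs (y, s) = 0" unfolding Rs_def distrib_left by linarith
      then show "Rs z = 0" using aj z by simp
    qed (use x t in auto)
    then show ?thesis by (simp add: Rs_def)
  qed
  have bc: "u j (inn j, t) = (\<Sum>k=1..n. p j k * u k (out k, t))" if j: "j \<in> {1..n}" and t: "\<tau> < t" for j t
  proof -
    have "u j (inn j, t) = P_op n m p u j t"
      using u j t unfolding classical_solution_def inflow_end_def by (cases "j \<le> m") auto
    then show ?thesis unfolding P_op_outflow[OF mn] out_def .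
  qed
  have "bsol \<tau> u ux ut" using h eq bc by (auto simp: bsol_def sol_def)
  then show ?thesis by blast
qed

lemma classical_solution_lin_comb:
  assumes u: "classical_solution n m a B p \<tau> \<phi> u" and v: "classical_solution n m a B p \<tau> \<psi> v"
  shows "classical_solution n m a B p \<tau> (lin_comb c \<phi> d \<psi>) (\<lambda>j z. c * u j z + d * v j z)"
proof -
  obtain ux ut where 1: "\<forall>j\<in>{1..n}. has_cont_partials {\<tau>..} (u j) (ux j) (ut j)"
    and 2: "\<forall>j\<in>{1..n}. \<forall>x\<in>{0<..<1}. \<forall>t>\<tau>.
      ut j (x, t) + a j (x, t) * ux j (x, t) + (\<Sum>k\<in>{1..n}. B j k (x, t) * u k (x, t)) = 0"
    by (rule classical_solutionE[OF u])
  note hu = bspec[OF 1] and pu = 2[THEN bspec, THEN bspec, THEN spec, THEN mp]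
  obtain vx vt where 1: "\<forall>j\<in>{1..n}. has_cont_partials {\<tau>..} (v j) (vx j) (vt j)"
    and 2: "\<forall>j\<in>{1..n}. \<forall>x\<in>{0<..<1}. \<forall>t>\<tau>.
      vt j (x, t) + a j (x, t) * vx j (x, t) + (\<Sum>k\<in>{1..n}. B j k (x, t) * v k (x, t)) = 0"
    by (rule classical_solutionE[OF v])
  note hv = bspec[OF 1] and pv = 2[THEN bspec, THEN bspec, THEN spec, THEN mp]
  have P: "P_op n m p (\<lambda>j z. c * u j z + d * v j z) j t = c * P_op n m p u j t + d * P_op n m p v j t" for j t
    by (simp add: P_op_def sum.distrib sum_distrib_left algebra_simps)
  have h: "has_cont_partials {\<tau>..} (\<lambda>z. c * u j z + d * v j z) (\<lambda>z. c * ux j z + d * vx j z) (\<lambda>z. c * ut j z + d * vt j z)"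
    if "j \<in> {1..n}" for j
    unfolding has_cont_partials_def
    by (intro conjI ballI continuous_intros DERIV_add DERIV_cmult
        has_cont_partialsD[OF hu[OF that]] has_cont_partialsD[OF hv[OF that]])
  have e: "(c * ut j (x, t) + d * vt j (x, t)) + a j (x, t) * (c * ux j (x, t) + d * vx j (x, t))
      + (\<Sum>k\<in>{1..n}. B j k (x, t) * (c * u k (x, t) + d * v k (x, t))) = 0"
    if "j \<in> {1..n}" "x \<in> {0<..<1}" "\<tau> < t" for j x t
  proof -
    have "(c * ut j (x, t) + d * vt j (x, t)) + a j (x, t) * (c * ux j (x, t) + d * vx j (x, t))
      + (\<Sum>k\<in>{1..n}. B j k (x, t) * (c * u k (x, t) + d * v k (x, t)))
      = c * (ut j (x, t) + a j (x, t) * ux j (x, t) + (\<Sum>k\<in>{1..n}. B j k (x, t) * u k (x, t)))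
      + d * (vt j (x, t) + a j (x, t) * vx j (x, t) + (\<Sum>k\<in>{1..n}. B j k (x, t) * v k (x, t)))"
      by (simp add: sum.distrib sum_distrib_left algebra_simps)
    then show ?thesis using pu[OF that] pv[OF that] by simp
  qed
  show ?thesis
    unfolding classical_solution_def P
  proof (rule conjI, goal_cases)
    case 1
    show ?case
      by (rule exI[of _ "\<lambda>j z. c * ux j z + d * vx j z"], rule exI[of _ "\<lambda>j z. c * ut j z + d * vt j z"])
        (intro conjI ballI allI impI h e; assumption)
  next
    case 2
    show ?case using u v by (simp add: classical_solution_def lin_comb_def)
  qed
qed

lemma classical_solution_slice:
  assumes u: "classical_solution n m a B p \<tau> \<phi> u" and j: "j \<in> {1..n}" and t: "\<tau> \<le> t"
  shows "continuous_on {0..1} (\<lambda>x. u j (x, t))"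
    and "\<exists>d. continuous_on {0..1} d \<and> (\<forall>x\<in>{0..1}. ((\<lambda>x. u j (x, t)) has_real_derivative d x) (at x within {0..1}))"
proof -
  obtain ux ut where h: "has_cont_partials {\<tau>..} (u j) (ux j) (ut j)"
    using u j unfolding classical_solution_def by blast
  show "continuous_on {0..1} (\<lambda>x. u j (x, t))"
    using continuous_on_slices(2)[OF has_cont_partialsD(1)[OF h]] t by simp
  show "\<exists>d. continuous_on {0..1} d \<and> (\<forall>x\<in>{0..1}. ((\<lambda>x. u j (x, t)) has_real_derivative d x) (at x within {0..1}))"
    using continuous_on_slices(2)[OF has_cont_partialsD(2)[OF h]] has_cont_partialsD(4)[OF h] t
    by (intro exI[of _ "\<lambda>x. ux j (x, t)"]) auto
qed

section \<open>Square integrable functions\<close>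

lemma continuous_I01:
  fixes h :: "real \<Rightarrow> real"
  assumes h: "continuous_on {0..1} h"
  shows "h \<in> borel_measurable I01" "integrable I01 (\<lambda>x. (h x)\<^sup>2)"
    "(LINT x|I01. (h x)\<^sup>2) = integral {0..1} (\<lambda>x. (h x)\<^sup>2)"
proof -
  interpret finite_measure I01 by (rule finite_measure_I01)
  show m: "h \<in> borel_measurable I01"
    by (rule continuous_I01_measurable[OF continuous_on_subset[OF h]]) auto
  have "bounded (h ` {0..1})" by (intro compact_imp_bounded compact_continuous_image h) auto
  then obtain A where A: "\<forall>y\<in>h ` {0..1}. norm y \<le> A" unfolding bounded_iff by blast
  show i: "integrable I01 (\<lambda>x. (h x)\<^sup>2)"
  proof (rule integrable_const_bound[where B = "A\<^sup>2"])
    have "(h x)\<^sup>2 \<le> A\<^sup>2" if "x \<in> {0<..<1}" for x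
    proof -
      have "\<bar>h x\<bar> \<le> A" using A that by auto
      then have "\<bar>h x\<bar>\<^sup>2 \<le> A\<^sup>2" by (intro power_mono) auto
      then show ?thesis by simp
    qed
    then show "AE x in I01. norm ((h x)\<^sup>2) \<le> A\<^sup>2" by (auto simp: space_restrict_space intro!: AE_I2)
  qed (use m in auto)
  have "(LINT x|I01. (h x)\<^sup>2) = integral {0<..<1} (\<lambda>x. (h x)\<^sup>2)"
    by (rule lebesgue_integral_eq_integral[OF i]) simp
  also have "\<dots> = integral {0..1} (\<lambda>x. (h x)\<^sup>2)"
    using integral_open_interval[of "0::real" 1 "\<lambda>x. (h x)\<^sup>2"] by simp
  finally show "(LINT x|I01. (h x)\<^sup>2) = integral {0..1} (\<lambda>x. (h x)\<^sup>2)" .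
qed

lemma L2I_continuous: "(\<And>j. j \<in> {1..n} \<Longrightarrow> continuous_on {0..1} (\<phi> j)) \<Longrightarrow> \<phi> \<in> L2 n"
  unfolding L2_def using continuous_I01(1,2) by blast

lemma test_fun_L2: "\<phi> \<in> test_fun n \<Longrightarrow> \<phi> \<in> L2 n"
proof (rule L2I_continuous)
  fix j assume "\<phi> \<in> test_fun n" "j \<in> {1..n}"
  then have "(deriv ^^ 0) (\<phi> j) differentiable_on UNIV" unfolding test_fun_def by blast
  then have "continuous_on UNIV (\<phi> j)" by (simp add: differentiable_imp_continuous_on)
  then show "continuous_on {0..1} (\<phi> j)" by (rule continuous_on_subset) simp
qed

lemma square_sum_le:
  assumes "\<bar>A\<bar> \<le> \<bar>B\<bar> + \<bar>C\<bar>" shows "(A::real)\<^sup>2 \<le> 2 * B\<^sup>2 + 2 * C\<^sup>2"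
proof -
  have "\<bar>A\<bar>\<^sup>2 \<le> (\<bar>B\<bar> + \<bar>C\<bar>)\<^sup>2" using assms by (intro power_mono) auto
  also have "\<dots> \<le> 2 * B\<^sup>2 + 2 * C\<^sup>2"
    using sum_squares_bound[of "\<bar>B\<bar>" "\<bar>C\<bar>"] by (simp add: power2_sum)
  finally show ?thesis by simp
qed

lemma L2_vec_diff:
  assumes "\<phi> \<in> L2 n" "\<psi> \<in> L2 n" shows "vec_diff \<phi> \<psi> \<in> L2 n"
  unfolding L2_def vec_diff_def
proof (intro CollectI ballI conjI)
  fix j assume j: "j \<in> {1..n}"
  have m: "\<phi> j \<in> borel_measurable I01" "\<psi> j \<in> borel_measurable I01"
    and i: "integrable I01 (\<lambda>x. (\<phi> j x)\<^sup>2)" "integrable I01 (\<lambda>x. (\<psi> j x)\<^sup>2)"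
    using assms j by (auto simp: L2_def)
  show "(\<lambda>x. \<phi> j x - \<psi> j x) \<in> borel_measurable I01" using m by simp
  show "integrable I01 (\<lambda>x. (\<phi> j x - \<psi> j x)\<^sup>2)"
  proof (rule Bochner_Integration.integrable_bound)
    show "integrable I01 (\<lambda>x. 2 * (\<phi> j x)\<^sup>2 + 2 * (\<psi> j x)\<^sup>2)" using i by simp
    show "AE x in I01. norm ((\<phi> j x - \<psi> j x)\<^sup>2) \<le> norm (2 * (\<phi> j x)\<^sup>2 + 2 * (\<psi> j x)\<^sup>2)"
      using square_sum_le[OF abs_triangle_ineq4] by (intro AE_I2) simp
  qed (use m in simp)
qed

lemma L2_norm_le:
  assumes "1 \<le> n" "0 \<le> c" "\<And>j. j \<in> {1..n} \<Longrightarrow> (LINT x|I01. (\<phi> j x)\<^sup>2) \<le> c\<^sup>2"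
  shows "L2_norm n \<phi> \<le> c"
proof -
  have "sqrt (LINT x|I01. (\<phi> j x)\<^sup>2) \<le> c" if "j \<in> {1..n}" for j
    using real_sqrt_le_mono[OF assms(3)[OF that]] assms(2) by simp
  then show ?thesis unfolding L2_norm_def using assms(1) by (subst Max_le_iff) auto
qed

text \<open>A substitute for the triangle inequality that rests only on (b + c)^2 <= 2 b^2 + 2 c^2.
  It is enough for limits, and its factor sqrt 2 reappears in the operator bound.\<close>

lemma L2_norm_quasi_triangle:
  assumes "1 \<le> n" "B \<in> L2 n" "C \<in> L2 n"
    and "\<And>j x. j \<in> {1..n} \<Longrightarrow> \<bar>A j x\<bar> \<le> \<bar>B j x\<bar> + \<bar>C j x\<bar>"
  shows "L2_norm n A \<le> sqrt (2 * (L2_norm n B)\<^sup>2 + 2 * (L2_norm n C)\<^sup>2)"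
proof (rule L2_norm_le[OF assms(1)])
  fix j assume j: "j \<in> {1..n}"
  have i: "integrable I01 (\<lambda>x. (B j x)\<^sup>2)" "integrable I01 (\<lambda>x. (C j x)\<^sup>2)"
    using assms j by (auto simp: L2_def)
  have "(LINT x|I01. (A j x)\<^sup>2) \<le> (LINT x|I01. 2 * (B j x)\<^sup>2 + 2 * (C j x)\<^sup>2)"
    using i square_sum_le[OF assms(4)[OF j]] by (intro integral_mono') auto
  also have "\<dots> = 2 * (LINT x|I01. (B j x)\<^sup>2) + 2 * (LINT x|I01. (C j x)\<^sup>2)" using i by simp
  also have "\<dots> \<le> 2 * (L2_norm n B)\<^sup>2 + 2 * (L2_norm n C)\<^sup>2"
    using L2_norm_component(2)[OF j] by (intro add_mono mult_left_mono) auto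
  also have "\<dots> = (sqrt (2 * (L2_norm n B)\<^sup>2 + 2 * (L2_norm n C)\<^sup>2))\<^sup>2" by simp
  finally show "(LINT x|I01. (A j x)\<^sup>2) \<le> (sqrt (2 * (L2_norm n B)\<^sup>2 + 2 * (L2_norm n C)\<^sup>2))\<^sup>2" .
qed simp

lemma L2_norm_scale:
  assumes "1 \<le> n" shows "L2_norm n (\<lambda>j x. c * \<phi> j x) = \<bar>c\<bar> * L2_norm n \<phi>"
proof -
  have "mono (\<lambda>y. \<bar>c\<bar> * y)" by (intro monoI mult_left_mono) auto
  then have "\<bar>c\<bar> * L2_norm n \<phi> = Max ((\<lambda>y. \<bar>c\<bar> * y) ` (\<lambda>j. sqrt (LINT x|I01. (\<phi> j x)\<^sup>2)) ` {1..n})"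
    unfolding L2_norm_def using assms by (intro mono_Max_commute) auto
  also have "\<dots> = L2_norm n (\<lambda>j x. c * \<phi> j x)"
    unfolding L2_norm_def image_image by (simp add: power_mult_distrib real_sqrt_mult)
  finally show ?thesis by simp
qed

text \<open>Lets a measurable representative from \<open>L2 n\<close> replace the value of the
  evolution family inside the norm.\<close>

lemma L2_norm_diff_AE_cong:
  assumes w: "\<And>j. j \<in> {1..n} \<Longrightarrow> w j \<in> borel_measurable I01"
    and V: "\<And>j. j \<in> {1..n} \<Longrightarrow> V j \<in> borel_measurable I01" and ae: "ae_eq n Y V"
  shows "L2_norm n (vec_diff w Y) = L2_norm n (vec_diff w V)"
proof -
  have "(LINT x|I01. (w j x - Y j x)\<^sup>2) = (LINT x|I01. (w j x - V j x)\<^sup>2)" if j: "j \<in> {1..n}" for j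
  proof (rule integral_cong_AE)
    have ae': "AE x in I01. Y j x = V j x" using ae j by (simp add: ae_eq_def)
    then have "AE x in I01. V j x = Y j x" by (rule AE_mp) simp
    then have "Y j \<in> borel_measurable I01" by (rule measurable_I01_AE_cong[OF V[OF j]])
    then show "(\<lambda>x. (w j x - Y j x)\<^sup>2) \<in> borel_measurable I01" using w[OF j] by simp
    show "AE x in I01. (w j x - Y j x)\<^sup>2 = (w j x - V j x)\<^sup>2" using ae' by (rule AE_mp) simp
  qed (use w[OF j] V[OF j] in simp)
  then have "(\<lambda>j. sqrt (LINT x|I01. (w j x - Y j x)\<^sup>2)) ` {1..n} = (\<lambda>j. sqrt (LINT x|I01. (w j x - V j x)\<^sup>2)) ` {1..n}"
    by (intro image_cong) auto
  then show ?thesis unfolding L2_norm_def vec_diff_def by simp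
qed

lemma deriv_power_lin_comb:
  fixes f g :: "real \<Rightarrow> real"
  assumes "\<And>r. (deriv ^^ r) f differentiable_on UNIV" "\<And>r. (deriv ^^ r) g differentiable_on UNIV"
  shows "(deriv ^^ r) (\<lambda>x. c * f x + d * g x) = (\<lambda>x. c * (deriv ^^ r) f x + d * (deriv ^^ r) g x)"
proof (induction r)
  case (Suc r)
  have D: "((deriv ^^ r) h has_real_derivative deriv ((deriv ^^ r) h) x) (at x)"
    if "(deriv ^^ r) h differentiable_on UNIV" for h :: "real \<Rightarrow> real" and x
    using that by (simp add: DERIV_deriv_iff_real_differentiable differentiable_on_def)
  show ?case
    unfolding funpow.simps o_def Suc.IH
    by (intro ext DERIV_imp_deriv) (auto intro!: derivative_eq_intros D assms)
qed simp

lemma test_fun_lin_comb: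
  assumes "\<phi> \<in> test_fun n" "\<psi> \<in> test_fun n"
  shows "lin_comb c \<phi> d \<psi> \<in> test_fun n"
  unfolding test_fun_def lin_comb_def
proof (intro CollectI ballI conjI allI)
  fix j assume j: "j \<in> {1..n}"
  have s: "(deriv ^^ r) (\<phi> j) differentiable_on UNIV" "(deriv ^^ r) (\<psi> j) differentiable_on UNIV" for r
    using assms j by (auto simp: test_fun_def)
  show "(deriv ^^ r) (\<lambda>x. c * \<phi> j x + d * \<psi> j x) differentiable_on UNIV" for r
    unfolding deriv_power_lin_comb[OF s] using s by (intro derivative_intros) auto
  obtain K L where "compact K" "K \<subseteq> {0<..<1}" "\<forall>x. x \<notin> K \<longrightarrow> \<phi> j x = 0"
    "compact L" "L \<subseteq> {0<..<1}" "\<forall>x. x \<notin> L \<longrightarrow> \<psi> j x = 0"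
    using assms j unfolding test_fun_def by blast
  then show "\<exists>K. compact K \<and> K \<subseteq> {0<..<1} \<and> (\<forall>x. x \<notin> K \<longrightarrow> c * \<phi> j x + d * \<psi> j x = 0)"
    by (intro exI[of _ "K \<union> L"]) auto
qed

section \<open>The evolution family\<close>

text \<open>The locally uniform limits in the definition of the generated family, applied with limit \<open>0\<close>,
  play the role of the uniform boundedness principle.\<close>

lemma L2_bound_uniform_in_time:
  assumes n: "1 \<le> n" and ev: "evolution_family n U" and gen: "generated_by n m a B p U" and S: "\<tau> \<le> S"
  shows "\<exists>K>0. \<forall>\<phi>\<in>test_fun n. \<forall>u. classical_solution n m a B p \<tau> \<phi> u \<longrightarrow>
    (\<forall>t\<in>{\<tau>..S}. L2_norm n (time_slice u t) \<le> K * L2_norm n \<phi>)"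
proof (rule ccontr)
  assume neg: "\<not> ?thesis"
  have L0: "0 \<le> L2_norm n \<phi>" for \<phi> using L2_norm_component(3)[of 1 n] n by simp
  have "\<exists>\<phi> u t. \<phi> \<in> test_fun n \<and> classical_solution n m a B p \<tau> \<phi> u \<and> t \<in> {\<tau>..S} \<and>
      real (Suc l) * L2_norm n \<phi> < L2_norm n (time_slice u t)" for l
  proof -
    have "0 < real (Suc l)" by simp
    then show ?thesis using neg by (meson linorder_not_less)
  qed
  then obtain \<phi> u t where \<phi>: "\<And>l. \<phi> l \<in> test_fun n" and u: "\<And>l. classical_solution n m a B p \<tau> (\<phi> l) (u l)"
    and t: "\<And>l. t l \<in> {\<tau>..S}" and big: "\<And>l. real (Suc l) * L2_norm n (\<phi> l) < L2_norm n (time_slice (u l) (t l))"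
    by metis
  \<comment> \<open>Normalising by the large slice makes the data tend to zero while the slice at
    the bad time \<open>t l\<close> keeps norm one. Uniformity in time of the defining limit matters
    because \<open>t l\<close> varies with l.\<close>
  define N where "N = (\<lambda>l. L2_norm n (time_slice (u l) (t l)))"
  have N0: "0 < N l" for l
  proof -
    have "0 \<le> real (Suc l) * L2_norm n (\<phi> l)" using L0 by (intro mult_nonneg_nonneg) auto
    then show ?thesis using big[of l] by (simp add: N_def)
  qed
  define \<phi>' where "\<phi>' = (\<lambda>l. lin_comb (1 / N l) (\<phi> l) 0 (\<phi> l))"
  define u' where "u' = (\<lambda>l j z. 1 / N l * u l j z + 0 * u l j z)"
  define Z :: vecfun where "Z = (\<lambda>j x. 0)"
  have \<phi>': "\<phi>' l \<in> test_fun n" for l unfolding \<phi>'_def by (rule test_fun_lin_comb[OF \<phi> \<phi>])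
  have u': "classical_solution n m a B p \<tau> (\<phi>' l) (u' l)" for l
    unfolding \<phi>'_def u'_def by (rule classical_solution_lin_comb[OF u u])
  have \<phi>'n: "L2_norm n (vec_diff (\<phi>' l) Z) = L2_norm n (\<phi> l) / N l" for l
    using L2_norm_scale[OF n, of "1 / N l" "\<phi> l"] N0[of l] by (simp add: \<phi>'_def lin_comb_def vec_diff_def Z_def)
  have "(\<lambda>l. L2_norm n (vec_diff (\<phi>' l) Z)) \<longlonglongrightarrow> 0"
  proof (rule tendsto_sandwich[OF _ _ tendsto_const LIMSEQ_inverse_real_of_nat])
    show "\<forall>\<^sub>F l in sequentially. 0 \<le> L2_norm n (vec_diff (\<phi>' l) Z)" using L0 by simp
    have "L2_norm n (\<phi> l) / N l \<le> inverse (real (Suc l))" for l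
    proof -
      have "real (Suc l) * L2_norm n (\<phi> l) < N l" using big[of l] by (simp only: N_def)
      then show ?thesis using N0[of l] by (simp add: field_simps)
    qed
    then show "\<forall>\<^sub>F l in sequentially. L2_norm n (vec_diff (\<phi>' l) Z) \<le> inverse (real (Suc l))"
      by (simp add: \<phi>'n)
  qed
  moreover have ZL: "Z \<in> L2 n" by (rule L2I_continuous) (simp add: Z_def)
  ultimately have ul: "uniform_limit {\<tau>..S} (\<lambda>l t. L2_norm n (vec_diff (time_slice (u' l) t) (U t \<tau> Z))) (\<lambda>_. 0) sequentially"
    using gen \<phi>' u' S unfolding generated_by_def by blast
  have "\<forall>\<^sub>F l in sequentially. \<forall>s\<in>{\<tau>..S}. dist (L2_norm n (vec_diff (time_slice (u' l) s) (U s \<tau> Z))) 0 < 1"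
    using uniform_limitD[OF ul, of 1] by simp
  then obtain l where l: "\<forall>s\<in>{\<tau>..S}. dist (L2_norm n (vec_diff (time_slice (u' l) s) (U s \<tau> Z))) 0 < 1"
    by (auto simp: eventually_sequentially)
  have tl: "\<tau> \<le> t l" using t[of l] by simp
  have "bounded_operator n (L2 n) (L2_norm n) (L2 n) (L2_norm n) (U (t l) \<tau>)"
    using ev tl by (simp add: evolution_family_def)
  \<comment> \<open>Linearity with both coefficients zero evaluates the operator at the zero
    function.\<close>
  then have "ae_eq n (U (t l) \<tau> (lin_comb 0 Z 0 Z)) (lin_comb 0 (U (t l) \<tau> Z) 0 (U (t l) \<tau> Z))"
    using ZL by (simp add: bounded_operator_def)
  then have UZ: "ae_eq n (U (t l) \<tau> Z) Z" by (simp add: lin_comb_def Z_def)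
  have "L2_norm n (vec_diff (time_slice (u' l) (t l)) (U (t l) \<tau> Z)) = L2_norm n (vec_diff (time_slice (u' l) (t l)) Z)"
  proof (rule L2_norm_diff_AE_cong[OF _ _ UZ])
    show "time_slice (u' l) (t l) j \<in> borel_measurable I01" if "j \<in> {1..n}" for j
      unfolding time_slice_def by (rule continuous_I01(1)[OF classical_solution_slice(1)[OF u' that tl]])
  qed (simp add: Z_def)
  also have "vec_diff (time_slice (u' l) (t l)) Z = (\<lambda>j x. 1 / N l * time_slice (u l) (t l) j x)"
    by (simp add: vec_diff_def Z_def time_slice_def u'_def)
  also have "L2_norm n \<dots> = 1"
    using L2_norm_scale[OF n, of "1 / N l" "time_slice (u l) (t l)"] N0[of l] by (simp add: N_def)
  finally show False using bspec[OF l t[of l]] by simp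
qed

text \<open>Removes the auxiliary M > 0: the data norm may be zero, so the estimates hold first for
  every larger M and pass to the limit.\<close>

lemma le_mult_of_all_greater:
  fixes y :: real
  assumes "0 \<le> c" "\<And>M. c < M \<Longrightarrow> y \<le> K * M"
  shows "y \<le> K * c"
proof (rule tendsto_lowerbound)
  show "((\<lambda>M. K * M) \<longlongrightarrow> K * c) (at_right c)" by (intro tendsto_intros)
  show "\<forall>\<^sub>F M in at_right c. y \<le> K * M" using assms(2) by (auto simp: eventually_at_filter)
qed simp

lemma has_real_derivative_unique_01:
  assumes "(g has_real_derivative d) (at x within {0..1})" "(g has_real_derivative d') (at x within {0..1})" "x \<in> {0..1}"
  shows "d = d'"
  using vector_derivative_unique_within_closed_interval[of 0 1 x g d d'] assms
  by (simp add: has_real_derivative_iff_has_vector_derivative)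

lemma C1_norm_le:
  fixes \<psi> d :: vecfun
  assumes n: "1 \<le> n" and d: "\<And>j x. j \<in> {1..n} \<Longrightarrow> x \<in> {0..1} \<Longrightarrow> (\<psi> j has_real_derivative d j x) (at x within {0..1})"
    and b: "\<And>j x. j \<in> {1..n} \<Longrightarrow> x \<in> {0..1} \<Longrightarrow> \<bar>\<psi> j x\<bar> \<le> C \<and> \<bar>d j x\<bar> \<le> C"
  shows "C1_norm n \<psi> \<le> 2 * C"
proof -
  have "(SUP x\<in>{0..1}. \<bar>\<psi> j x\<bar>) + (SUP x\<in>{0..1}. \<bar>vector_derivative (\<psi> j) (at x within {0..1})\<bar>) \<le> C + C"
    if j: "j \<in> {1..n}" for j
  proof (rule add_mono)
    show "(SUP x\<in>{0..1}. \<bar>\<psi> j x\<bar>) \<le> C" using b[OF j] by (intro cSUP_least) auto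
    have "vector_derivative (\<psi> j) (at x within {0..1}) = d j x" if "x \<in> {0..1}" for x
      using vector_derivative_within_cbox[of 0 1 x "\<psi> j" "d j x"] d[OF j that] that
      by (simp add: has_real_derivative_iff_has_vector_derivative)
    then show "(SUP x\<in>{0..1}. \<bar>vector_derivative (\<psi> j) (at x within {0..1})\<bar>) \<le> C"
      using b[OF j] by (intro cSUP_least) auto
  qed
  then show ?thesis unfolding C1_norm_def using n by (subst Max_le_iff) auto
qed

text \<open>The evolution family bounds the L2 norm on the whole window [\<tau>, S], times after t
  included; this feeds the C^1 estimate at t.\<close>

lemma (in hyp_boundary) classical_estimate:
  assumes n: "1 \<le> n" and a0: "\<And>j z. j \<in> {1..n} \<Longrightarrow> z \<in> strip \<Longrightarrow> a j z \<noteq> 0"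
    and bt: "\<And>j k z. j \<in> {1..n} \<Longrightarrow> k \<in> {1..n} \<Longrightarrow> z \<in> strip \<Longrightarrow> bt j k z = \<kappa> j k z / a k z * (a k z - a j z)"
    and ev: "evolution_family n U"
    and gen: "generated_by n m a (\<lambda>j k z. (if j = k then b j z else 0) + bt j k z) p U"
  shows "\<exists>T>0. \<forall>\<tau> t. \<tau> + T \<le> t \<longrightarrow> (\<exists>K\<ge>0. \<forall>\<phi>\<in>test_fun n. \<forall>u.
    classical_solution n m a (\<lambda>j k z. (if j = k then b j z else 0) + bt j k z) p \<tau> \<phi> u \<longrightarrow>
    (\<forall>j\<in>{1..n}. \<forall>x\<in>{0..1}. \<bar>u j (x, t)\<bar> \<le> K * L2_norm n \<phi> \<and>
      (\<exists>d. ((\<lambda>x. u j (x, t)) has_real_derivative d) (at x within {0..1}) \<and> \<bar>d\<bar> \<le> K * L2_norm n \<phi>)))"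
proof -
  let ?B = "\<lambda>j k z. (if j = k then b j z else 0) + bt j k z"
  obtain T where T: "T > 0" and est: "\<And>\<tau> t. \<tau> + T \<le> t \<Longrightarrow> \<exists>S\<ge>t. \<exists>K. \<forall>M>0. \<forall>u ux ut. bsol \<tau> u ux ut \<longrightarrow>
     (\<forall>s\<in>{\<tau>..S}. \<forall>j\<in>{1..n}. integral {0..1} (\<lambda>x. (u j (x, s))\<^sup>2) \<le> M\<^sup>2) \<longrightarrow>
     (\<forall>j\<in>{1..n}. \<forall>x\<in>{0..1}. \<bar>u j (x, t)\<bar> \<le> K * M \<and> \<bar>ux j (x, t)\<bar> \<le> K * M)"
    using smoothing_estimate by (elim exE conjE) (rule that, assumption, simp only:)
  show ?thesis
  proof (rule exI[of _ T], intro conjI T allI impI)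
    fix \<tau> t assume t: "\<tau> + T \<le> t"
    obtain S K where S: "t \<le> S" and K': "\<forall>M>0. \<forall>u ux ut. bsol \<tau> u ux ut \<longrightarrow>
     (\<forall>s\<in>{\<tau>..S}. \<forall>j\<in>{1..n}. integral {0..1} (\<lambda>x. (u j (x, s))\<^sup>2) \<le> M\<^sup>2) \<longrightarrow>
     (\<forall>j\<in>{1..n}. \<forall>x\<in>{0..1}. \<bar>u j (x, t)\<bar> \<le> K * M \<and> \<bar>ux j (x, t)\<bar> \<le> K * M)"
      using est[OF t] by - (elim exE conjE, rule that, assumption, assumption)
    note K = K'[THEN spec, THEN mp, THEN spec, THEN spec, THEN spec, THEN mp, THEN mp]
    have \<tau>: "\<tau> \<le> t" "\<tau> \<le> S" using t T S by auto
    obtain L where L: "0 < L" "\<And>\<phi> u s. \<phi> \<in> test_fun n \<Longrightarrow> classical_solution n m a ?B p \<tau> \<phi> u \<Longrightarrow> s \<in> {\<tau>..S} \<Longrightarrow>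
        L2_norm n (time_slice u s) \<le> L * L2_norm n \<phi>"
      using L2_bound_uniform_in_time[OF n ev gen \<tau>(2)] by blast
    \<comment> \<open>The constant \<open>K\<close> carries no sign; with \<open>max 0\<close> the
      bound becomes monotone in M. The factor \<open>L\<close> converts the norm of the data into
      that of the slices.\<close>
    define K' where "K' = max 0 K * L"
    show "\<exists>K\<ge>0. \<forall>\<phi>\<in>test_fun n. \<forall>u. classical_solution n m a ?B p \<tau> \<phi> u \<longrightarrow>
      (\<forall>j\<in>{1..n}. \<forall>x\<in>{0..1}. \<bar>u j (x, t)\<bar> \<le> K * L2_norm n \<phi> \<and>
      (\<exists>d. ((\<lambda>x. u j (x, t)) has_real_derivative d) (at x within {0..1}) \<and> \<bar>d\<bar> \<le> K * L2_norm n \<phi>))"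
    proof (rule exI[of _ K'], intro conjI ballI allI impI)
      show "0 \<le> K'" using L by (simp add: K'_def)
      fix \<phi> u j x assume \<phi>: "\<phi> \<in> test_fun n" and u: "classical_solution n m a ?B p \<tau> \<phi> u"
        and j: "j \<in> {1..n}" and x: "x \<in> {0..1::real}"
      obtain ux ut where bs: "bsol \<tau> u ux ut"
        using classical_imp_bsol[OF a0 bt u] by blast
      have N0: "0 \<le> L * L2_norm n \<phi>" using L(1) L2_norm_component(3)[OF j] by simp
      have b: "\<bar>u j (x, t)\<bar> \<le> max 0 K * M \<and> \<bar>ux j (x, t)\<bar> \<le> max 0 K * M" if M: "L * L2_norm n \<phi> < M" for M
      proof -
        have M0: "0 < M" using N0 M by linarith
        have "integral {0..1} (\<lambda>x. (u k (x, s))\<^sup>2) \<le> M\<^sup>2" if s: "s \<in> {\<tau>..S}" and k: "k \<in> {1..n}" for s k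
        proof -
          have "integral {0..1} (\<lambda>x. (u k (x, s))\<^sup>2) = (LINT x|I01. (time_slice u s k x)\<^sup>2)"
            unfolding time_slice_def
            by (rule continuous_I01(3)[symmetric, OF classical_solution_slice(1)[OF u k]]) (use s in simp)
          also have "\<dots> \<le> (L2_norm n (time_slice u s))\<^sup>2" by (rule L2_norm_component(2)[OF k])
          also have "\<dots> \<le> M\<^sup>2"
            using L(2)[OF \<phi> u s] M L2_norm_component(3)[OF k] by (intro power_mono) auto
          finally show ?thesis .
        qed
        then have "\<bar>u j (x, t)\<bar> \<le> K * M \<and> \<bar>ux j (x, t)\<bar> \<le> K * M"
          using K[OF M0 bs] j x by simp
        moreover have "K * M \<le> max 0 K * M" using M0 by (intro mult_right_mono) auto
        ultimately show ?thesis by linarith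
      qed
      show "\<bar>u j (x, t)\<bar> \<le> K' * L2_norm n \<phi>"
        using le_mult_of_all_greater[OF N0, of "\<bar>u j (x, t)\<bar>" "max 0 K"] b by (simp add: K'_def mult.assoc)
      have "\<bar>ux j (x, t)\<bar> \<le> K' * L2_norm n \<phi>"
        using le_mult_of_all_greater[OF N0, of "\<bar>ux j (x, t)\<bar>" "max 0 K"] b by (simp add: K'_def mult.assoc)
      moreover have "((\<lambda>x. u j (x, t)) has_real_derivative ux j (x, t)) (at x within {0..1})"
        by (rule has_cont_partialsD(4)[OF solD(1)[OF bsol_sol[OF bs] j] x]) (use \<tau> in simp)
      ultimately show "\<exists>d. ((\<lambda>x. u j (x, t)) has_real_derivative d) (at x within {0..1}) \<and> \<bar>d\<bar> \<le> K' * L2_norm n \<phi>"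
        by blast
    qed
  qed
qed

text \<open>The derivatives converge uniformly and the functions at the point 0. Both limits are
  returned explicitly, so that bounds on the sequence can be passed on to them.\<close>

lemma uniform_C1_limit:
  fixes w d :: "nat \<Rightarrow> real \<Rightarrow> real"
  assumes c: "\<And>l. continuous_on {0..1} (d l)"
    and dw: "\<And>l x. x \<in> {0..1} \<Longrightarrow> (w l has_real_derivative d l x) (at x within {0..1})"
    and cau: "\<And>e. 0 < e \<Longrightarrow> \<exists>N. \<forall>l\<ge>N. \<forall>k\<ge>N. \<forall>x\<in>{0..1}. \<bar>w l x - w k x\<bar> < e \<and> \<bar>d l x - d k x\<bar> < e"
  shows "\<exists>g g'. continuous_on {0..1} g' \<and> (\<forall>x\<in>{0..1}. (\<lambda>l. w l x) \<longlonglongrightarrow> g x \<and> (\<lambda>l. d l x) \<longlonglongrightarrow> g' x \<and>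
     (g has_real_derivative g' x) (at x within {0..1}))"
proof -
  have "uniformly_Cauchy_on {0..1} d"
    unfolding uniformly_Cauchy_on_def dist_real_def using cau by meson
  then obtain g' where g': "uniform_limit {0..1} d g' sequentially"
    using uniformly_convergent_on_def Cauchy_uniformly_convergent by blast
  have "Cauchy (\<lambda>l. w l 0)"
    unfolding Cauchy_def dist_real_def using cau by (metis atLeastAtMost_iff order_refl zero_le_one)
  then obtain w0 where w0: "(\<lambda>l. w l 0) \<longlonglongrightarrow> w0" using real_Cauchy_convergent convergent_def by blast
  have "\<exists>g. \<forall>x\<in>{0..1}. (\<lambda>l. w l x) \<longlonglongrightarrow> g x \<and> (g has_derivative (*) (g' x)) (at x within {0..1})"
  proof (rule has_derivative_sequence[of "{0..1}" w "\<lambda>l x. (*) (d l x)" "\<lambda>x. (*) (g' x)" 0 w0])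
    show "(w l has_derivative (*) (d l x)) (at x within {0..1})" if "x \<in> {0..1}" for l x
      using dw[OF that] by (simp add: has_field_derivative_def)
    show "\<forall>\<^sub>F l in sequentially. \<forall>x\<in>{0..1}. \<forall>h. norm (d l x * h - g' x * h) \<le> e * norm h" if "0 < e" for e
      using uniform_limitD[OF g' that]
    proof eventually_elim
      case (elim l)
      show ?case
      proof (intro ballI allI)
        fix x h :: real assume "x \<in> {0..1}"
        then have "\<bar>d l x - g' x\<bar> \<le> e" using elim by (auto simp: dist_real_def less_imp_le)
        then show "norm (d l x * h - g' x * h) \<le> e * norm h"
          by (simp add: abs_mult mult_right_mono flip: left_diff_distrib)
      qed
    qed
  qed (use w0 in auto)
  then obtain g where g: "\<forall>x\<in>{0..1}. (\<lambda>l. w l x) \<longlonglongrightarrow> g x \<and> (g has_derivative (*) (g' x)) (at x within {0..1})" by blast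
  have "continuous_on {0..1} g'"
    by (rule uniform_limit_theorem[OF _ g']) (use c in auto)
  moreover have "(\<lambda>l. d l x) \<longlonglongrightarrow> g' x" if "x \<in> {0..1}" for x
    by (rule tendsto_uniform_limitI[OF g' that])
  ultimately show ?thesis
    using g by (intro exI[of _ g] exI[of _ g']) (auto simp: has_field_derivative_def)
qed

text \<open>Extension by density. Slices of approximating classical solutions form a Cauchy sequence
  in C^1 by linearity and the estimate; since they also converge in L2 to the value of the family,
  the C^1 limit is a representative of that value.\<close>

lemma smoothing_of_classical_estimate:
  assumes n: "1 \<le> n" and ev: "evolution_family n U" and gen: "generated_by n m a B p U"
    and t: "\<tau> \<le> t" and K0: "0 \<le> K"
    and est: "\<And>\<phi> u j x. \<phi> \<in> test_fun n \<Longrightarrow> classical_solution n m a B p \<tau> \<phi> u \<Longrightarrow> j \<in> {1..n} \<Longrightarrow> x \<in> {0..1} \<Longrightarrow>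
      \<bar>u j (x, t)\<bar> \<le> K * L2_norm n \<phi> \<and>
      (\<exists>d. ((\<lambda>x. u j (x, t)) has_real_derivative d) (at x within {0..1}) \<and> \<bar>d\<bar> \<le> K * L2_norm n \<phi>)"
  shows "bounded_operator n (L2 n) (L2_norm n) (C1 n) (C1_norm n) (U t \<tau>)"
proof -
  have bo: "bounded_operator n (L2 n) (L2_norm n) (L2 n) (L2_norm n) (U t \<tau>)"
    using ev t by (simp add: evolution_family_def)
  have L0: "0 \<le> L2_norm n \<phi>" for \<phi> using L2_norm_component(3)[of 1 n] n by simp
  have main: "\<exists>\<psi>\<in>C1 n. ae_eq n (U t \<tau> \<phi>) \<psi> \<and> C1_norm n \<psi> \<le> (2 * (K * sqrt 2)) * L2_norm n \<phi>" if \<phi>: "\<phi> \<in> L2 n" for \<phi>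
  proof -
    obtain \<phi>s where \<phi>s: "\<And>l::nat. \<phi>s l \<in> test_fun n" and \<phi>l: "(\<lambda>l. L2_norm n (vec_diff (\<phi>s l) \<phi>)) \<longlonglongrightarrow> 0"
      using test_fun_dense[OF n \<phi>] by metis
    have "\<exists>u. classical_solution n m a B p \<tau> (\<phi>s l) u" for l
      using gen \<phi>s unfolding generated_by_def by blast
    then obtain us where us: "\<And>l. classical_solution n m a B p \<tau> (\<phi>s l) (us l)" by metis
    define \<delta> where "\<delta> = (\<lambda>l. L2_norm n (vec_diff (\<phi>s l) \<phi>))"
    have \<delta>0: "0 \<le> \<delta> l" for l unfolding \<delta>_def by (rule L0)
    have vd: "vec_diff (\<phi>s l) \<phi> \<in> L2 n" for l by (rule L2_vec_diff[OF test_fun_L2[OF \<phi>s] \<phi>])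
    define w where "w = (\<lambda>l j x. us l j (x, t))"
    have wc: "continuous_on {0..1} (w l j)" if "j \<in> {1..n}" for l j
      unfolding w_def by (rule classical_solution_slice(1)[OF us that t])
    have "\<forall>l. \<forall>j\<in>{1..n}. \<exists>d. continuous_on {0..1} d \<and> (\<forall>x\<in>{0..1}. (w l j has_real_derivative d x) (at x within {0..1}))"
      unfolding w_def using classical_solution_slice(2)[OF us _ t] by blast
    then have "\<forall>l. \<exists>d. \<forall>j\<in>{1..n}. continuous_on {0..1} (d j) \<and> (\<forall>x\<in>{0..1}. (w l j has_real_derivative d j x) (at x within {0..1}))"
      unfolding bchoice_iff .
    then obtain d where "\<forall>l. \<forall>j\<in>{1..n}. continuous_on {0..1} (d l j) \<and> (\<forall>x\<in>{0..1}. (w l j has_real_derivative d l j x) (at x within {0..1}))"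
      unfolding choice_iff by blast
    then have dc: "continuous_on {0..1} (d l j)"
      and dw: "x \<in> {0..1} \<Longrightarrow> (w l j has_real_derivative d l j x) (at x within {0..1})" if "j \<in> {1..n}" for l j x
      using that by blast+
    have bound: "\<bar>w l j x\<bar> \<le> K * sqrt (2 * (\<delta> l)\<^sup>2 + 2 * (L2_norm n \<phi>)\<^sup>2) \<and> \<bar>d l j x\<bar> \<le> K * sqrt (2 * (\<delta> l)\<^sup>2 + 2 * (L2_norm n \<phi>)\<^sup>2)"
      if j: "j \<in> {1..n}" and x: "x \<in> {0..1}" for l j x
    proof -
      have "L2_norm n (\<phi>s l) \<le> sqrt (2 * (\<delta> l)\<^sup>2 + 2 * (L2_norm n \<phi>)\<^sup>2)"
        unfolding \<delta>_def by (rule L2_norm_quasi_triangle[OF n vd \<phi>]) (simp add: vec_diff_def)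
      then have *: "K * L2_norm n (\<phi>s l) \<le> K * sqrt (2 * (\<delta> l)\<^sup>2 + 2 * (L2_norm n \<phi>)\<^sup>2)"
        using K0 by (rule mult_left_mono)
      obtain d' where "(w l j has_real_derivative d') (at x within {0..1})" "\<bar>d'\<bar> \<le> K * L2_norm n (\<phi>s l)"
        and "\<bar>w l j x\<bar> \<le> K * L2_norm n (\<phi>s l)"
        using est[OF \<phi>s us j x, of l] unfolding w_def by blast
      moreover from this(1) have "d' = d l j x" by (rule has_real_derivative_unique_01[OF _ dw[OF j x] x])
      ultimately show ?thesis using * by auto
    qed
    have diff: "\<bar>w l j x - w k j x\<bar> \<le> K * sqrt (2 * (\<delta> l)\<^sup>2 + 2 * (\<delta> k)\<^sup>2) \<and> \<bar>d l j x - d k j x\<bar> \<le> K * sqrt (2 * (\<delta> l)\<^sup>2 + 2 * (\<delta> k)\<^sup>2)"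
      if j: "j \<in> {1..n}" and x: "x \<in> {0..1}" for l k j x
    proof -
      let ?\<phi> = "lin_comb 1 (\<phi>s l) (- 1) (\<phi>s k)"
      \<comment> \<open>The difference of two approximating solutions solves the problem with the
        difference of the data, so the estimate controls the distance of their slices.\<close>
      have cl: "classical_solution n m a B p \<tau> ?\<phi> (\<lambda>j z. 1 * us l j z + (- 1) * us k j z)"
        by (rule classical_solution_lin_comb[OF us us])
      have "L2_norm n ?\<phi> \<le> sqrt (2 * (\<delta> l)\<^sup>2 + 2 * (\<delta> k)\<^sup>2)"
        unfolding \<delta>_def by (rule L2_norm_quasi_triangle[OF n vd vd]) (simp add: vec_diff_def lin_comb_def)
      then have *: "K * L2_norm n ?\<phi> \<le> K * sqrt (2 * (\<delta> l)\<^sup>2 + 2 * (\<delta> k)\<^sup>2)"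
        using K0 by (rule mult_left_mono)
      obtain d' where d': "((\<lambda>x. w l j x - w k j x) has_real_derivative d') (at x within {0..1})" "\<bar>d'\<bar> \<le> K * L2_norm n ?\<phi>"
        and b: "\<bar>w l j x - w k j x\<bar> \<le> K * L2_norm n ?\<phi>"
        using est[OF test_fun_lin_comb[OF \<phi>s \<phi>s] cl j x] unfolding w_def by auto
      have "d' = d l j x - d k j x"
        by (rule has_real_derivative_unique_01[OF d'(1) DERIV_diff[OF dw[OF j x] dw[OF j x]] x])
      then show ?thesis using * d'(2) b by auto
    qed
    have sq: "(\<lambda>l. (\<delta> l)\<^sup>2) \<longlonglongrightarrow> 0" using tendsto_power[OF \<phi>l, of 2] by (simp add: \<delta>_def)
    have cauchy: "\<exists>N. \<forall>l\<ge>N. \<forall>k\<ge>N. \<forall>x\<in>{0..1}. \<bar>w l j x - w k j x\<bar> < e \<and> \<bar>d l j x - d k j x\<bar> < e"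
      if j: "j \<in> {1..n}" and e: "0 < e" for j e
    proof -
      \<comment> \<open>With both data errors below \<epsilon> the square root is at most 2
        \<epsilon>. Using K + 1 avoids division by zero for K = 0 and makes the final inequality
        strict.\<close>
      define \<epsilon> where "\<epsilon> = e / (2 * (K + 1))"
      have \<epsilon>: "0 < \<epsilon>" using e K0 by (simp add: \<epsilon>_def)
      have "\<forall>\<^sub>F l in sequentially. \<delta> l < \<epsilon>"
        using \<phi>l \<epsilon> unfolding \<delta>_def by (rule order_tendstoD(2))
      then obtain N where N: "\<And>l. N \<le> l \<Longrightarrow> \<delta> l < \<epsilon>" by (auto simp: eventually_sequentially)
      have "K * sqrt (2 * (\<delta> l)\<^sup>2 + 2 * (\<delta> k)\<^sup>2) < e" if "N \<le> l" "N \<le> k" for l k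
      proof -
        have "(\<delta> l)\<^sup>2 \<le> \<epsilon>\<^sup>2" "(\<delta> k)\<^sup>2 \<le> \<epsilon>\<^sup>2"
          using N[OF that(1)] N[OF that(2)] \<delta>0 by (auto intro!: power_mono)
        then have "sqrt (2 * (\<delta> l)\<^sup>2 + 2 * (\<delta> k)\<^sup>2) \<le> sqrt ((2 * \<epsilon>)\<^sup>2)"
          by (intro real_sqrt_le_mono) (simp add: power_mult_distrib)
        also have "\<dots> = 2 * \<epsilon>" using \<epsilon> by (intro real_sqrt_unique) auto
        finally have "K * sqrt (2 * (\<delta> l)\<^sup>2 + 2 * (\<delta> k)\<^sup>2) \<le> K * (2 * \<epsilon>)" using K0 by (rule mult_left_mono)
        also have "\<dots> < (K + 1) * (2 * \<epsilon>)" using \<epsilon> by simp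
        also have "\<dots> = (2 * (K + 1)) * \<epsilon>" by simp
        also have "\<dots> = e" unfolding \<epsilon>_def times_divide_eq_right by (rule nonzero_mult_div_cancel_left) (use K0 in simp)
        finally show ?thesis .
      qed
      then show ?thesis using diff[OF j] by (meson order_le_less_trans)
    qed
    \<comment> \<open>Limit and derivative are packed as a pair, so that a single choice over the
      components yields both consistently.\<close>
    have "\<forall>j\<in>{1..n}. \<exists>gg. continuous_on {0..1} (snd gg) \<and> (\<forall>x\<in>{0..1}. (\<lambda>l. w l j x) \<longlonglongrightarrow> fst gg x \<and> (\<lambda>l. d l j x) \<longlonglongrightarrow> snd gg x \<and>
         (fst gg has_real_derivative snd gg x) (at x within {0..1}))"
    proof
      fix j assume j: "j \<in> {1..n}"
      obtain g g' where "continuous_on {0..1} g'" "\<forall>x\<in>{0..1}. (\<lambda>l. w l j x) \<longlonglongrightarrow> g x \<and> (\<lambda>l. d l j x) \<longlonglongrightarrow> g' x \<and>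
         (g has_real_derivative g' x) (at x within {0..1})"
        using uniform_C1_limit[of "\<lambda>l. d l j" "\<lambda>l. w l j", OF dc[OF j] dw[OF j] cauchy[OF j]] by blast
      then show "\<exists>gg. continuous_on {0..1} (snd gg) \<and> (\<forall>x\<in>{0..1}. (\<lambda>l. w l j x) \<longlonglongrightarrow> fst gg x \<and> (\<lambda>l. d l j x) \<longlonglongrightarrow> snd gg x \<and>
         (fst gg has_real_derivative snd gg x) (at x within {0..1}))"
        by (intro exI[of _ "(g, g')"]) simp
    qed
    then obtain gg where gg: "\<forall>j\<in>{1..n}. continuous_on {0..1} (snd (gg j)) \<and> (\<forall>x\<in>{0..1}. (\<lambda>l. w l j x) \<longlonglongrightarrow> fst (gg j) x \<and> (\<lambda>l. d l j x) \<longlonglongrightarrow> snd (gg j) x \<and>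
         (fst (gg j) has_real_derivative snd (gg j) x) (at x within {0..1}))"
      unfolding bchoice_iff by blast
    define \<psi> where "\<psi> = (\<lambda>j. fst (gg j))"
    define \<psi>' where "\<psi>' = (\<lambda>j. snd (gg j))"
    have \<psi>'c: "continuous_on {0..1} (\<psi>' j)" if "j \<in> {1..n}" for j using gg that by (simp add: \<psi>'_def)
    have \<psi>: "(\<lambda>l. w l j x) \<longlonglongrightarrow> \<psi> j x" "(\<lambda>l. d l j x) \<longlonglongrightarrow> \<psi>' j x"
      "(\<psi> j has_real_derivative \<psi>' j x) (at x within {0..1})" if "j \<in> {1..n}" "x \<in> {0..1}" for j x
      using gg that unfolding \<psi>_def \<psi>'_def by blast+
    have \<psi>c: "continuous_on {0..1} (\<psi> j)" if "j \<in> {1..n}" for j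
      using \<psi>(3)[OF that] by (intro DERIV_continuous_on)
    have "\<psi> \<in> C1 n" unfolding C1_def using \<psi>'c \<psi>(3) by blast
    moreover have "C1_norm n \<psi> \<le> (2 * (K * sqrt 2)) * L2_norm n \<phi>"
    proof -
      have lim: "(\<lambda>l. K * sqrt (2 * (\<delta> l)\<^sup>2 + 2 * (L2_norm n \<phi>)\<^sup>2)) \<longlonglongrightarrow> K * sqrt (2 * 0 + 2 * (L2_norm n \<phi>)\<^sup>2)"
        by (intro tendsto_intros sq)
      have eq: "sqrt (2 * 0 + 2 * (L2_norm n \<phi>)\<^sup>2) = sqrt 2 * L2_norm n \<phi>"
        using L0 by (simp add: real_sqrt_mult)
      have "\<bar>\<psi> j x\<bar> \<le> K * (sqrt 2 * L2_norm n \<phi>) \<and> \<bar>\<psi>' j x\<bar> \<le> K * (sqrt 2 * L2_norm n \<phi>)"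
        if j: "j \<in> {1..n}" and x: "x \<in> {0..1}" for j x
        using LIMSEQ_le[OF tendsto_rabs[OF \<psi>(1)[OF j x]] lim] LIMSEQ_le[OF tendsto_rabs[OF \<psi>(2)[OF j x]] lim] bound[OF j x]
        unfolding eq by blast
      from C1_norm_le[OF n \<psi>(3) this] show ?thesis by (simp add: mult.assoc)
    qed
    moreover have "ae_eq n (U t \<tau> \<phi>) \<psi>"
    proof -
      obtain V where V: "V \<in> L2 n" "ae_eq n (U t \<tau> \<phi>) V"
        using bo \<phi> unfolding bounded_operator_def by blast
      have ws: "time_slice (us l) t = w l" for l by (simp add: time_slice_def w_def)
      have "uniform_limit {\<tau>..t} (\<lambda>l s. L2_norm n (vec_diff (time_slice (us l) s) (U s \<tau> \<phi>))) (\<lambda>_. 0) sequentially"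
        using gen \<phi> \<phi>s us \<phi>l t unfolding generated_by_def by blast
      then have "(\<lambda>l. L2_norm n (vec_diff (time_slice (us l) t) (U t \<tau> \<phi>))) \<longlonglongrightarrow> 0"
        by (rule tendsto_uniform_limitI) (use t in simp)
      then have wV: "(\<lambda>l. L2_norm n (vec_diff (w l) V)) \<longlonglongrightarrow> 0"
        unfolding ws using L2_norm_diff_AE_cong[OF continuous_I01(1)[OF wc] _ V(2)] V(1) by (simp add: L2_def)
      \<comment> \<open>The data errors converge and hence are bounded; this yields a bound
        \<open>A\<close> for all slices, the dominating constant below.\<close>
      obtain D where "\<forall>l. norm (\<delta> l) \<le> D"
        using BseqE[OF convergent_imp_Bseq[OF convergentI[OF \<phi>l[folded \<delta>_def]]]] by blast
      then have D: "\<delta> l \<le> D" for l using \<delta>0[of l] by (simp add: abs_le_iff)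
      define A where "A = K * sqrt (2 * D\<^sup>2 + 2 * (L2_norm n \<phi>)\<^sup>2)"
      have "K * sqrt (2 * (\<delta> l)\<^sup>2 + 2 * (L2_norm n \<phi>)\<^sup>2) \<le> A" for l
        unfolding A_def using D[of l] \<delta>0[of l] K0 by (intro mult_left_mono real_sqrt_le_mono add_right_mono power_mono) auto
      then have wA: "\<bar>w l j x\<bar> \<le> A" if "j \<in> {1..n}" "x \<in> {0..1}" for l j x
        using bound[OF that, of l] by (meson order_trans)
      have \<psi>A: "\<bar>\<psi> j x\<bar> \<le> A" if "j \<in> {1..n}" "x \<in> {0..1}" for j x
        by (rule LIMSEQ_le_const2[OF tendsto_rabs[OF \<psi>(1)[OF that]]]) (use wA[OF that] in blast)
      have "AE x in I01. V j x = \<psi> j x" if j: "j \<in> {1..n}" for j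
      proof -
        interpret finite_measure I01 by (rule finite_measure_I01)
        note mw = continuous_I01(1)[OF wc[OF j]] and m\<psi> = continuous_I01(1)[OF \<psi>c[OF j]]
        have mV: "V j \<in> borel_measurable I01" using V(1) j by (simp add: L2_def)
        have vwV: "integrable I01 (\<lambda>x. (w l j x - V j x)\<^sup>2)" for l
        proof -
          have "w l \<in> L2 n" by (rule L2I_continuous) (rule wc)
          from L2_vec_diff[OF this V(1)] show ?thesis using j by (simp add: L2_def vec_diff_def)
        qed
        have iw: "integrable I01 (\<lambda>x. (\<psi> j x - w l j x)\<^sup>2)" for l
          by (rule continuous_I01(2)) (intro continuous_intros wc \<psi>c j)
        have i\<psi>: "integrable I01 (\<lambda>x. (\<psi> j x - V j x)\<^sup>2)"
        proof -
          have "\<psi> \<in> L2 n" by (rule L2I_continuous) (rule \<psi>c)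
          from L2_vec_diff[OF this V(1)] show ?thesis using j by (simp add: L2_def vec_diff_def)
        qed
        have l1: "(\<lambda>l. LINT x|I01. (\<psi> j x - w l j x)\<^sup>2) \<longlonglongrightarrow> (LINT x|I01. 0)"
        proof (rule integral_dominated_convergence[where w = "\<lambda>_. (2 * A)\<^sup>2"])
          have "(\<lambda>l. (\<psi> j x - w l j x)\<^sup>2) \<longlonglongrightarrow> 0" if "x \<in> {0<..<1}" for x
          proof -
            have "(\<lambda>l. (\<psi> j x - w l j x)\<^sup>2) \<longlonglongrightarrow> (\<psi> j x - \<psi> j x)\<^sup>2"
              using that by (intro tendsto_intros \<psi>(1)[OF j]) auto
            then show ?thesis by simp
          qed
          then show "AE x in I01. (\<lambda>l. (\<psi> j x - w l j x)\<^sup>2) \<longlonglongrightarrow> 0"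
            by (intro AE_I2) (simp add: space_restrict_space)
          have "(\<psi> j x - w l j x)\<^sup>2 \<le> (2 * A)\<^sup>2" if "x \<in> {0<..<1}" for l x
          proof -
            have x: "x \<in> {0..1}" using that by simp
            have "\<bar>\<psi> j x - w l j x\<bar> \<le> 2 * A" using wA[OF j x, of l] \<psi>A[OF j x] by linarith
            then have "\<bar>\<psi> j x - w l j x\<bar>\<^sup>2 \<le> (2 * A)\<^sup>2" by (intro power_mono) auto
            then show ?thesis by simp
          qed
          then show "AE x in I01. norm ((\<psi> j x - w l j x)\<^sup>2) \<le> (2 * A)\<^sup>2" for l
            by (intro AE_I2) (simp add: space_restrict_space)
        qed (use mw m\<psi> in auto)
        \<comment> \<open>The slice \<open>w l\<close> mediates between the two candidates: it tends
          to \<open>\<psi>\<close> by dominated convergence and to \<open>V\<close> by the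
          definition of the generated family. The left-hand side does not depend on l and must
          vanish.\<close>
        have le: "(LINT x|I01. (\<psi> j x - V j x)\<^sup>2) \<le> 2 * (LINT x|I01. (\<psi> j x - w l j x)\<^sup>2) + 2 * (L2_norm n (vec_diff (w l) V))\<^sup>2" for l
        proof -
          have sq: "(\<psi> j x - V j x)\<^sup>2 \<le> 2 * (\<psi> j x - w l j x)\<^sup>2 + 2 * (w l j x - V j x)\<^sup>2" for x
            by (rule square_sum_le) linarith
          have "(LINT x|I01. (\<psi> j x - V j x)\<^sup>2) \<le> (LINT x|I01. 2 * (\<psi> j x - w l j x)\<^sup>2 + 2 * (w l j x - V j x)\<^sup>2)"
            by (rule integral_mono') (use iw[of l] vwV[of l] sq in simp_all)
          also have "\<dots> = 2 * (LINT x|I01. (\<psi> j x - w l j x)\<^sup>2) + 2 * (LINT x|I01. (w l j x - V j x)\<^sup>2)"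
            using iw[of l] vwV[of l] by simp
          also have "(LINT x|I01. (w l j x - V j x)\<^sup>2) \<le> (L2_norm n (vec_diff (w l) V))\<^sup>2"
            using L2_norm_component(2)[OF j, of "vec_diff (w l) V"] by (simp add: vec_diff_def)
          finally show ?thesis by simp
        qed
        have "(\<lambda>l. 2 * (LINT x|I01. (\<psi> j x - w l j x)\<^sup>2) + 2 * (L2_norm n (vec_diff (w l) V))\<^sup>2) \<longlonglongrightarrow> 2 * (LINT x|I01. 0) + 2 * 0\<^sup>2"
          by (intro tendsto_intros l1 wV)
        then have "(LINT x|I01. (\<psi> j x - V j x)\<^sup>2) \<le> 2 * (LINT x|I01. 0) + 2 * 0\<^sup>2"
          by (rule LIMSEQ_le_const) (use le in blast)
        moreover have "0 \<le> (LINT x|I01. (\<psi> j x - V j x)\<^sup>2)" by (rule Bochner_Integration.integral_nonneg) simp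
        ultimately have "(LINT x|I01. (\<psi> j x - V j x)\<^sup>2) = 0" by simp
        then have "AE x in I01. (\<psi> j x - V j x)\<^sup>2 = 0"
          using integral_nonneg_eq_0_iff_AE[OF i\<psi>] by simp
        then show ?thesis by (rule AE_mp) simp
      qed
      note V\<psi> = this
      show ?thesis
        unfolding ae_eq_def
      proof
        fix j assume j: "j \<in> {1..n}"
        have "AE x in I01. U t \<tau> \<phi> j x = V j x" using V(2) j by (simp add: ae_eq_def)
        then show "AE x in I01. U t \<tau> \<phi> j x = \<psi> j x" using V\<psi>[OF j] by eventually_elim simp
      qed
    qed
    ultimately show ?thesis by blast
  qed
  show ?thesis
    unfolding bounded_operator_def
  proof
    show "\<forall>\<phi>\<in>L2 n. \<forall>\<psi>\<in>L2 n. \<forall>c d. ae_eq n (U t \<tau> (lin_comb c \<phi> d \<psi>)) (lin_comb c (U t \<tau> \<phi>) d (U t \<tau> \<psi>))"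
      using bo unfolding bounded_operator_def by (rule conjunct1)
    show "\<exists>K. \<forall>\<phi>\<in>L2 n. \<exists>\<psi>\<in>C1 n. ae_eq n (U t \<tau> \<phi>) \<psi> \<and> C1_norm n \<psi> \<le> K * L2_norm n \<phi>"
      by (rule exI[of _ "2 * (K * sqrt 2)"]) (use main in blast)
  qed
qed

section \<open>Verification of the hypotheses for the given problem\<close>

lemma BC_bdd:
  assumes "f \<in> BC" shows "bdd_above (f ` strip)" "bdd_below (f ` strip)"
  using assms bounded_imp_bdd_above bounded_imp_bdd_below by (auto simp: BC_def)

text \<open>The sum of the absolute values dominates every individual bound, so a finite family can
  share the single \<open>Q\<close> demanded by the locale.\<close>

lemma BC1_family_bc1:
  assumes "finite A" "\<And>i. i \<in> A \<Longrightarrow> f i \<in> BC1"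
  shows "\<exists>Q\<ge>0. \<exists>fx ft. \<forall>i\<in>A. bc1 Q (f i) (fx i) (ft i)"
proof -
  have "\<forall>i\<in>A. \<exists>q. bc1 (fst q) (f i) (fst (snd q)) (snd (snd q))"
    using BC1_imp_bc1[OF assms(2)] by fastforce
  then obtain q where q: "\<forall>i\<in>A. bc1 (fst (q i)) (f i) (fst (snd (q i))) (snd (snd (q i)))"
    unfolding bchoice_iff by blast
  define Q where "Q = (\<Sum>i\<in>A. \<bar>fst (q i)\<bar>)"
  have "fst (q i) \<le> Q" if "i \<in> A" for i
    using member_le_sum[OF that, of "\<lambda>i. \<bar>fst (q i)\<bar>"] assms(1) by (simp add: Q_def)
  then have "\<forall>i\<in>A. bc1 Q (f i) (fst (snd (q i))) (snd (snd (q i)))" using q bc1_mono by blast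
  moreover have "0 \<le> Q" unfolding Q_def by (intro sum_nonneg) auto
  ultimately show ?thesis
    by (intro exI[of _ Q] conjI exI[of _ "\<lambda>i. fst (snd (q i))"] exI[of _ "\<lambda>i. snd (snd (q i))"]) auto
qed

theorem corollary2p6:
  fixes n m :: nat
    and p :: "nat \<Rightarrow> nat \<Rightarrow> real"
    and a b :: "nat \<Rightarrow> real \<times> real \<Rightarrow> real"
    and bt :: "nat \<Rightarrow> nat \<Rightarrow> real \<times> real \<Rightarrow> real"
    and U :: "real \<Rightarrow> real \<Rightarrow> vecfun \<Rightarrow> vecfun"
  assumes "2 \<le> n" and "m \<le> n"
    and "\<forall>j\<in>{1..n}. a j \<in> BC1"
    and "\<forall>j\<in>{1..n}. b j \<in> BC1"
    and "\<forall>j\<in>{1..n}. \<forall>k\<in>{1..n}. bt j k \<in> BC1"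
    and "\<exists>\<Lambda>0>0. (\<forall>j\<in>{1..m}. (INF z\<in>strip. a j z) \<ge> \<Lambda>0) \<and>
                 (\<forall>j\<in>{m+1..n}. (SUP z\<in>strip. a j z) \<le> - \<Lambda>0)"
    and "\<exists>N::nat. \<forall>u. (\<forall>j\<in>{1..n}. continuous_on strip (u j)) \<longrightarrow>
           (\<forall>j\<in>{1..n}. \<forall>z\<in>strip. ((\<lambda>w. C_op m a b (P_op n m p w)) ^^ N) u j z = 0)"
    and "\<forall>j\<in>{1..n}. \<forall>z\<in>strip. bt j j z = 0"
    and "\<forall>j\<in>{1..n}. \<forall>k\<in>{1..n}. j \<noteq> k \<longrightarrow>
           (\<exists>\<beta>\<in>BC1. \<forall>z\<in>strip. bt j k z = \<beta> z * (a k z - a j z))"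
    and "evolution_family n U"
    and "generated_by n m a (\<lambda>j k z. (if j = k then b j z else 0) + bt j k z) p U"
  shows "smoothing n (L2 n) (L2_norm n) (C1 n) (C1_norm n) U"
proof -
  note aBC = bspec[OF assms(3)] and bBC = bspec[OF assms(4)]
  obtain \<Lambda> where \<Lambda>: "0 < \<Lambda>" "\<forall>j\<in>{1..m}. (INF z\<in>strip. a j z) \<ge> \<Lambda>" "\<forall>j\<in>{m+1..n}. (SUP z\<in>strip. a j z) \<le> - \<Lambda>"
    using assms(6) by blast
  \<comment> \<open>The one-sided bounds for the two groups of speeds merge into one lower bound for
    |a j|, the form in which inverting a j within BC^1 uses them.\<close>
  have a\<Lambda>: "\<Lambda> \<le> \<bar>a j z\<bar>" if j: "j \<in> {1..n}" and z: "z \<in> strip" for j z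
  proof (cases "j \<le> m")
    case True
    have "(INF z\<in>strip. a j z) \<le> a j z"
      using aBC[OF j] z by (intro cINF_lower BC_bdd) (auto simp: BC1_def)
    moreover have "\<Lambda> \<le> (INF z\<in>strip. a j z)" using \<Lambda>(2) True j by simp
    ultimately show ?thesis by linarith
  next
    case False
    have "a j z \<le> (SUP z\<in>strip. a j z)"
      using aBC[OF j] z by (intro cSUP_upper BC_bdd) (auto simp: BC1_def)
    moreover have "(SUP z\<in>strip. a j z) \<le> - \<Lambda>" using \<Lambda>(3) False j by simp
    ultimately show ?thesis by linarith
  qed
  have a0: "a j z \<noteq> 0" if "j \<in> {1..n}" "z \<in> strip" for j z
    using a\<Lambda>[OF that] \<Lambda>(1) by auto
  have "\<forall>jk\<in>{1..n} \<times> {1..n}. \<exists>\<beta>. \<beta> \<in> BC1 \<and> (\<forall>z\<in>strip. bt (fst jk) (snd jk) z = \<beta> z * (a (snd jk) z - a (fst jk) z))"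
  proof
    fix jk assume jk: "jk \<in> {1..n} \<times> {1..n}"
    show "\<exists>\<beta>. \<beta> \<in> BC1 \<and> (\<forall>z\<in>strip. bt (fst jk) (snd jk) z = \<beta> z * (a (snd jk) z - a (fst jk) z))"
    proof (cases "fst jk = snd jk")
      \<comment> \<open>On the diagonal the coefficient vanishes, so \<beta> = 0 extends the
        representation to all pairs.\<close>
      case True
      then show ?thesis using assms(8) jk BC1_const by (intro exI[of _ "\<lambda>_. 0"]) auto
    next
      case False
      have "fst jk \<in> {1..n}" "snd jk \<in> {1..n}" using jk by auto
      then show ?thesis using assms(9) False by blast
    qed
  qed
  then obtain \<beta> where "\<forall>jk\<in>{1..n} \<times> {1..n}. \<beta> jk \<in> BC1 \<and> (\<forall>z\<in>strip. bt (fst jk) (snd jk) z = \<beta> jk z * (a (snd jk) z - a (fst jk) z))"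
    unfolding bchoice_iff by blast
  then have \<beta>: "\<beta> (j, k) \<in> BC1" "z \<in> strip \<Longrightarrow> bt j k z = \<beta> (j, k) z * (a k z - a j z)"
    if "j \<in> {1..n}" "k \<in> {1..n}" for j k z using that by force+
  define f where "f = (\<lambda>j z. 1 / a j z)"
  define r where "r = (\<lambda>j z. b j z / a j z)"
  \<comment> \<open>From a_k - a_j = a_j a_k (f_j - f_k): division by a_j leaves a_k, which joins
    \<beta>.\<close>
  define \<kappa> where "\<kappa> = (\<lambda>j k z. \<beta> (j, k) z * a k z)"
  have fBC: "f j \<in> BC1" if "j \<in> {1..n}" for j
    unfolding f_def by (rule BC1_inverse[OF aBC[OF that] \<Lambda>(1) a\<Lambda>[OF that]])
  have rBC: "r j \<in> BC1" if "j \<in> {1..n}" for j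
    using BC1_mult[OF bBC[OF that] fBC[OF that]] by (simp add: r_def f_def)
  have \<kappa>BC: "\<kappa> (fst jk) (snd jk) \<in> BC1" if "jk \<in> {1..n} \<times> {1..n}" for jk
    unfolding \<kappa>_def using that by (intro BC1_mult \<beta>(1) aBC) auto
  obtain Q1 fx ft where Q1: "0 \<le> Q1" "\<forall>j\<in>{1..n}. bc1 Q1 (f j) (fx j) (ft j)"
    using BC1_family_bc1[of "{1..n}" f] fBC by (metis finite_atLeastAtMost)
  obtain Q2 rx rt where Q2: "0 \<le> Q2" "\<forall>j\<in>{1..n}. bc1 Q2 (r j) (rx j) (rt j)"
    using BC1_family_bc1[of "{1..n}" r] rBC by (metis finite_atLeastAtMost)
  obtain Q3 \<kappa>x \<kappa>t where Q3: "0 \<le> Q3" "\<forall>jk\<in>{1..n} \<times> {1..n}. bc1 Q3 (\<kappa> (fst jk) (snd jk)) (\<kappa>x jk) (\<kappa>t jk)"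
    using BC1_family_bc1[of "{1..n} \<times> {1..n}" "\<lambda>jk. \<kappa> (fst jk) (snd jk)"] \<kappa>BC by (metis finite_cartesian_product finite_atLeastAtMost)
  \<comment> \<open>The summand 1 makes \<open>Q\<close>, and with it the waiting time, positive
    without further argument.\<close>
  define Q where "Q = 1 + Q1 + Q2 + Q3"
  have Q: "Q1 \<le> Q" "Q2 \<le> Q" "Q3 \<le> Q" "0 < Q" using Q1(1) Q2(1) Q3(1) by (auto simp: Q_def)
  obtain N where N: "\<And>u. \<forall>j\<in>{1..n}. continuous_on strip (u j) \<Longrightarrow>
      \<forall>j\<in>{1..n}. \<forall>z\<in>strip. ((\<lambda>w. C_op m a b (P_op n m p w)) ^^ N) u j z = 0"
    using assms(7) by blast
  define Pm where "Pm = (\<Sum>jk\<in>{1..n} \<times> {1..n}. \<bar>p (fst jk) (snd jk)\<bar>)"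
  interpret hyp_boundary n f fx ft r rx rt \<kappa> "\<lambda>j k. \<kappa>x (j, k)" "\<lambda>j k. \<kappa>t (j, k)" Q m a b p N Pm
  proof
    fix j k assume j: "j \<in> {1..n}"
    show "bc1 Q (f j) (fx j) (ft j)" using Q1(2) j Q(1) bc1_mono by blast
    show "bc1 Q (r j) (rx j) (rt j)" using Q2(2) j Q(2) bc1_mono by blast
    assume k: "k \<in> {1..n}"
    have jk: "(j, k) \<in> {1..n} \<times> {1..n}" using j k by simp
    show "bc1 Q (\<kappa> j k) (\<kappa>x (j, k)) (\<kappa>t (j, k))"
      using bspec[OF Q3(2) jk] Q(3) bc1_mono by simp
    show "\<bar>p j k\<bar> \<le> Pm"
      using member_le_sum[OF jk, of "\<lambda>jk. \<bar>p (fst jk) (snd jk)\<bar>"] by (simp add: Pm_def)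
  next
    show "((\<lambda>w. C_op m a b (P_op n m p w)) ^^ N) u j z = 0"
      if "\<And>j. j \<in> {1..n} \<Longrightarrow> continuous_on strip (u j)" "j \<in> {1..n}" "z \<in> strip" for u j z
      using N[of u] that by simp
    show "0 \<le> Pm" unfolding Pm_def by (intro sum_nonneg) auto
  qed (use Q assms(2) in \<open>auto simp: f_def r_def\<close>)
  have n: "1 \<le> n" using assms(1) by simp
  have bt\<kappa>: "bt j k z = \<kappa> j k z / a k z * (a k z - a j z)" if "j \<in> {1..n}" "k \<in> {1..n}" "z \<in> strip" for j k z
    using \<beta>(2)[OF that] a0[OF that(2,3)] by (simp add: \<kappa>_def)
  obtain T where T: "0 < T" and est: "\<forall>\<tau> t. \<tau> + T \<le> t \<longrightarrow> (\<exists>K\<ge>0. \<forall>\<phi>\<in>test_fun n. \<forall>u.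
    classical_solution n m a (\<lambda>j k z. (if j = k then b j z else 0) + bt j k z) p \<tau> \<phi> u \<longrightarrow>
    (\<forall>j\<in>{1..n}. \<forall>x\<in>{0..1}. \<bar>u j (x, t)\<bar> \<le> K * L2_norm n \<phi> \<and>
      (\<exists>d. ((\<lambda>x. u j (x, t)) has_real_derivative d) (at x within {0..1}) \<and> \<bar>d\<bar> \<le> K * L2_norm n \<phi>)))"
    using classical_estimate[OF n a0 bt\<kappa> assms(10,11)] by blast
  have "bounded_operator n (L2 n) (L2_norm n) (C1 n) (C1_norm n) (U t \<tau>)" if t: "\<tau> + T \<le> t" for t \<tau>
  proof -
    obtain K where K: "0 \<le> K" "\<forall>\<phi>\<in>test_fun n. \<forall>u.
      classical_solution n m a (\<lambda>j k z. (if j = k then b j z else 0) + bt j k z) p \<tau> \<phi> u \<longrightarrow>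
      (\<forall>j\<in>{1..n}. \<forall>x\<in>{0..1}. \<bar>u j (x, t)\<bar> \<le> K * L2_norm n \<phi> \<and>
      (\<exists>d. ((\<lambda>x. u j (x, t)) has_real_derivative d) (at x within {0..1}) \<and> \<bar>d\<bar> \<le> K * L2_norm n \<phi>))"
      using est t by blast
    have "\<tau> \<le> t" using t T by simp
    then show ?thesis
      by (rule smoothing_of_classical_estimate[OF n assms(10,11) _ K(1)])
        (rule K(2)[THEN bspec, THEN spec, THEN mp, THEN bspec, THEN bspec])
  qed
  then show ?thesis
    using assms(10) T unfolding smoothing_def evolution_family_def by blast
qed

end
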